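(* Let $j\in\mathbb N$, $\gamma\in\mathbb R$, $T>0$. Let $u_0$, $\boldsymbol\varphi=(\varphi_1,\dots,\varphi_j)$, and $f$ be sufficiently smooth and decaying, and let $u$ be a sufficiently smooth solution, whose spatial derivatives decay at infinity, of the linear problem $$\partial_tu+(-1)^{j+1}\partial_x^{2j+1}u=f(t,x)\ (0<t<T,\ x>0),\quad u(0,x)=u_0(x)\ (x>0),\quad (\partial_x+\gamma)\partial_x^{\ell-1}u(t,0)=\varphi_\ell(t)\ (0<t<T,\ 1\le\ell\le j).$$ Then, for $x>0$ and $0\le t\le T$, $$\begin{aligned}u(t,x)=&\frac1{2\pi}\int_{\mathbb R}e^{ikx+ik^{2j+1}t}\left(\widehat{u_0}(k)+F(t,k)\right)dk\\&-\frac1{2\pi}\sum_{p=1}^j\sum_{n=1}^{j+1}\int_{\partial D_{2p}^+}e^{ikx+ik^{2j+1}t}\left(\widehat{u_0}(\alpha_{p,n}k)+F(T,\alpha_{p,n}k)\right)\mathcal P_{p,n}(k)\,dk\\&+\frac1{2\pi}\sum_{p=1}^j\sum_{\ell=1}^jc_{p,\ell}\int_{\partial D_{2p}^+}e^{ikx+ik^{2j+1}t}\frac{k^{2j+1-\ell}}{k-i\gamma}\widetilde\varphi_\ell(T,k^{2j+1})\,dk\\&+\mathcal R_{j,\gamma}[u_0,\boldsymbol\varphi,f](t,x).\end{aligned}$$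
   Context: Let $\omega=e^{2\pi i/(2j+1)}$, $\alpha_{p,n}=\omega^{j-p+n}$ ($1\le p\le j$, $1\le n\le j+1$), $Q_p(z)=\prod_{m=1}^{j+1}(z-\alpha_{p,m})$, $L_{p,n}(z)=\prod_{1\le m\le j+1,\,m\ne n}\frac{z-\alpha_{p,m}}{\alpha_{p,n}-\alpha_{p,m}}$, and $$\mathcal P_{p,n}(k)=L_{p,n}(1)-\frac{Q_p(1)}{Q_p'(\alpha_{p,n})}\frac{k}{k-i\gamma}.$$ For $1\le\ell\le j$ let $S_{p,\ell}$ be the quotient in the Euclidean division $z^{2j+1-\ell}=Q_p(z)S_{p,\ell}(z)+E_{p,\ell}(z)$, $\deg E_{p,\ell}\le j$, and set $c_{p,\ell}=(-1)^{j+1}i^{2j-\ell}Q_p(1)S_{p,\ell}(1)$. $D_{2p}^+=\{re^{i\theta}:r>0,\ \frac{(2p-1)\pi}{2j+1}<\theta<\frac{2p\pi}{2j+1}\}$, and $\partial D_{2p}^+$ is its positively oriented boundary (incoming from infinity along the ray of larger argument, outgoing along the ray of smaller argument). $\widehat{u_0}(k)=\int_0^\infty e^{-ikx}u_0(x)\,dx$ and $\widehat f(t,k)=\int_0^\infty e^{-ikx}f(t,x)\,dx$ for $\operatorname{Im}k\le0$; $F(t,k)=\int_0^te^{-ik^{2j+1}\tau}\widehat f(\tau,k)\,d\tau$; $\widetilde\varphi_\ell(t,\zeta)=\int_0^te^{-i\zeta\tau}\varphi_\ell(\tau)\,d\tau$. The residue term is $\mathcal R_{j,\gamma}[u_0,\boldsymbol\varphi,f]=0$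 unless $j$ is odd and $\gamma>0$; if $j$ is odd and $\gamma>0$, with $p_*=\frac{j+1}{2}$, $$\mathcal R_{j,\gamma}[u_0,\boldsymbol\varphi,f](t,x)=\gamma Q_{p_*}(1)e^{-\gamma x+\gamma^{2j+1}t}\sum_{n=1}^{j+1}\frac{\widehat{u_0}(i\gamma\alpha_{p_*,n})+F(T,i\gamma\alpha_{p_*,n})}{Q_{p_*}'(\alpha_{p_*,n})}-ie^{-\gamma x+\gamma^{2j+1}t}\sum_{\ell=1}^jc_{p_*,\ell}(i\gamma)^{2j+1-\ell}\widetilde\varphi_\ell(T,-i\gamma^{2j+1}).$$ When $\gamma=0$, the factor $k/(k-i\gamma)$ is read as $1$ and $k^{2j+1-\ell}/(k-i\gamma)$ as $k^{2j-\ell}$ (removable singularity at $k=0$). *)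

theory Defs
  imports "HOL-Analysis.Analysis" "HOL-Computational_Algebra.Polynomial"
begin

section \<open>Regularity classes on the closed half-line and the closed half-strip\<close>

text \<open>Derivatives are taken within the closed domain, hence are one-sided on its boundary.\<close>

definition deriv_within :: "real set \<Rightarrow> (real \<Rightarrow> complex) \<Rightarrow> real \<Rightarrow> complex" where
  "deriv_within S g x = vector_derivative g (at x within S)"

definition Dx :: "(real \<Rightarrow> real \<Rightarrow> complex) \<Rightarrow> real \<Rightarrow> real \<Rightarrow> complex" where
  "Dx v t x = deriv_within {0..} (v t) x"

definition Dt :: "real \<Rightarrow> (real \<Rightarrow> real \<Rightarrow> complex) \<Rightarrow> real \<Rightarrow> real \<Rightarrow> complex" where
  "Dt T v t x = deriv_within {0..T} (\<lambda>s. v s x) t"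

primrec Ck_on :: "nat \<Rightarrow> real set \<Rightarrow> (real \<Rightarrow> complex) \<Rightarrow> bool" where
  "Ck_on 0 S g \<longleftrightarrow> continuous_on S g"
| "Ck_on (Suc N) S g \<longleftrightarrow> g differentiable_on S \<and> Ck_on N S (deriv_within S g)"

primrec Ck_strip :: "nat \<Rightarrow> real \<Rightarrow> (real \<Rightarrow> real \<Rightarrow> complex) \<Rightarrow> bool" where
  "Ck_strip 0 T v \<longleftrightarrow> continuous_on ({0..T} \<times> {0..}) (\<lambda>(t, x). v t x)"
| "Ck_strip (Suc N) T v \<longleftrightarrow>
     continuous_on ({0..T} \<times> {0..}) (\<lambda>(t, x). v t x) \<and>
     (\<forall>t\<in>{0..T}. v t differentiable_on {0..}) \<and>
     (\<forall>x\<in>{0..}. (\<lambda>s. v s x) differentiable_on {0..T}) \<and>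
     Ck_strip N T (Dx v) \<and> Ck_strip N T (Dt T v)"

text \<open>``Sufficiently smooth and decaying'' is expressed through a single order \<open>N\<close>, which
  bounds the number of derivatives and gives the polynomial rate of decay; the theorem
  asserts that some \<open>N\<close> depending only on \<open>j\<close> suffices.\<close>

definition initial_class :: "nat \<Rightarrow> (real \<Rightarrow> complex) \<Rightarrow> bool" where
  "initial_class N u0 \<longleftrightarrow> Ck_on N {0..} u0 \<and>
     (\<exists>C. \<forall>n\<le>N. \<forall>x\<ge>0. (1 + x) ^ N * norm ((deriv_within {0..} ^^ n) u0 x) \<le> C)"

definition forcing_class :: "nat \<Rightarrow> real \<Rightarrow> (real \<Rightarrow> real \<Rightarrow> complex) \<Rightarrow> bool" where
  "forcing_class N T f \<longleftrightarrow> Ck_strip N T f \<and>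
     (\<exists>C. \<forall>a b. a + b \<le> N \<longrightarrow> (\<forall>t\<in>{0..T}. \<forall>x\<ge>0.
        (1 + x) ^ N * norm ((Dt T ^^ a) ((Dx ^^ b) f) t x) \<le> C))"

text \<open>For the solution, decay is required of the spatial derivatives only.\<close>

definition solution_class :: "nat \<Rightarrow> real \<Rightarrow> (real \<Rightarrow> real \<Rightarrow> complex) \<Rightarrow> bool" where
  "solution_class N T u \<longleftrightarrow> Ck_strip N T u \<and>
     (\<exists>C. \<forall>n\<le>N. \<forall>t\<in>{0..T}. \<forall>x\<ge>0. (1 + x) ^ N * norm ((Dx ^^ n) u t x) \<le> C)"

definition solves_ibvp ::
  "nat \<Rightarrow> real \<Rightarrow> real \<Rightarrow> (real \<Rightarrow> complex) \<Rightarrow> (nat \<Rightarrow> real \<Rightarrow> complex) \<Rightarrow>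
   (real \<Rightarrow> real \<Rightarrow> complex) \<Rightarrow> (real \<Rightarrow> real \<Rightarrow> complex) \<Rightarrow> bool" where
  "solves_ibvp j \<gamma> T u0 \<phi> f u \<longleftrightarrow>
     (\<forall>t\<in>{0<..<T}. \<forall>x>0. Dt T u t x + (-1) ^ (j + 1) * (Dx ^^ (2 * j + 1)) u t x = f t x) \<and>
     (\<forall>x>0. u 0 x = u0 x) \<and>
     (\<forall>t\<in>{0<..<T}. \<forall>l\<in>{1..j}.
        Dx ((Dx ^^ (l - 1)) u) t 0 + of_real \<gamma> * (Dx ^^ (l - 1)) u t 0 = \<phi> l t)"


section \<open>Transforms\<close>

definition half_fourier :: "(real \<Rightarrow> complex) \<Rightarrow> complex \<Rightarrow> complex" where
  "half_fourier g k = integral {0..} (\<lambda>x. exp (- \<i> * k * of_real x) * g x)"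

definition forcing_transform ::
  "nat \<Rightarrow> (real \<Rightarrow> real \<Rightarrow> complex) \<Rightarrow> real \<Rightarrow> complex \<Rightarrow> complex" where
  "forcing_transform j f t k =
     integral {0..t} (\<lambda>\<tau>. exp (- \<i> * k ^ (2 * j + 1) * of_real \<tau>) * half_fourier (f \<tau>) k)"

definition time_transform :: "(real \<Rightarrow> complex) \<Rightarrow> real \<Rightarrow> complex \<Rightarrow> complex" where
  "time_transform g t \<zeta> = integral {0..t} (\<lambda>\<tau>. exp (- \<i> * \<zeta> * of_real \<tau>) * g \<tau>)"


section \<open>Algebraic coefficients\<close>

definition omega :: "nat \<Rightarrow> complex" where
  "omega j = exp (2 * of_real pi * \<i> / of_nat (2 * j + 1))"

text \<open>The truncated subtraction is harmless since always \<open>p \<le> j\<close>.\<close>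

definition alpha :: "nat \<Rightarrow> nat \<Rightarrow> nat \<Rightarrow> complex" where
  "alpha j p n = omega j ^ (j - p + n)"

definition Qpoly :: "nat \<Rightarrow> nat \<Rightarrow> complex poly" where
  "Qpoly j p = (\<Prod>m=1..j+1. [:- alpha j p m, 1:])"

definition Lfun :: "nat \<Rightarrow> nat \<Rightarrow> nat \<Rightarrow> complex \<Rightarrow> complex" where
  "Lfun j p n z = (\<Prod>m\<in>{1..j+1} - {n}. (z - alpha j p m) / (alpha j p n - alpha j p m))"

definition Pfun :: "nat \<Rightarrow> real \<Rightarrow> nat \<Rightarrow> nat \<Rightarrow> complex \<Rightarrow> complex" where
  "Pfun j \<gamma> p n k = Lfun j p n 1 -
     poly (Qpoly j p) 1 / poly (pderiv (Qpoly j p)) (alpha j p n) *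
     (if \<gamma> = 0 then 1 else k / (k - \<i> * of_real \<gamma>))"

definition Spoly :: "nat \<Rightarrow> nat \<Rightarrow> nat \<Rightarrow> complex poly" where
  "Spoly j p l = monom 1 (2 * j + 1 - l) div Qpoly j p"

definition ccoef :: "nat \<Rightarrow> nat \<Rightarrow> nat \<Rightarrow> complex" where
  "ccoef j p l = (-1) ^ (j + 1) * \<i> ^ (2 * j - l) * poly (Qpoly j p) 1 * poly (Spoly j p l) 1"

definition boundary_symbol :: "nat \<Rightarrow> real \<Rightarrow> nat \<Rightarrow> complex \<Rightarrow> complex" where
  "boundary_symbol j \<gamma> l k =
     (if \<gamma> = 0 then k ^ (2 * j - l) else k ^ (2 * j + 1 - l) / (k - \<i> * of_real \<gamma>))"


section \<open>Contour integrals over the boundary of the sector $D_{2p}^+$\<close>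

text \<open>The sector is \<open>arg_lo j p < arg k < arg_hi j p\<close>. Its positively oriented boundary comes in
  from infinity along the ray of argument \<open>arg_hi\<close> and goes out along the ray of argument
  \<open>arg_lo\<close>.\<close>

definition arg_lo :: "nat \<Rightarrow> nat \<Rightarrow> real" where
  "arg_lo j p = (2 * real p - 1) * pi / real (2 * j + 1)"

definition arg_hi :: "nat \<Rightarrow> nat \<Rightarrow> real" where
  "arg_hi j p = 2 * real p * pi / real (2 * j + 1)"

definition sector_integrable :: "nat \<Rightarrow> nat \<Rightarrow> (complex \<Rightarrow> complex) \<Rightarrow> bool" where
  "sector_integrable j p g \<longleftrightarrow>
     (\<lambda>r. g (of_real r * cis (arg_lo j p))) integrable_on {0..} \<and>
     (\<lambda>r. g (of_real r * cis (arg_hi j p))) integrable_on {0..}"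

definition sector_integral :: "nat \<Rightarrow> nat \<Rightarrow> (complex \<Rightarrow> complex) \<Rightarrow> complex" where
  "sector_integral j p g =
     integral {0..} (\<lambda>r. g (of_real r * cis (arg_lo j p)) * cis (arg_lo j p)) -
     integral {0..} (\<lambda>r. g (of_real r * cis (arg_hi j p)) * cis (arg_hi j p))"


section \<open>The terms of the solution formula\<close>

definition wave :: "nat \<Rightarrow> real \<Rightarrow> real \<Rightarrow> complex \<Rightarrow> complex" where
  "wave j t x k = exp (\<i> * k * of_real x + \<i> * k ^ (2 * j + 1) * of_real t)"

definition line_integrand ::
  "nat \<Rightarrow> (real \<Rightarrow> complex) \<Rightarrow> (real \<Rightarrow> real \<Rightarrow> complex) \<Rightarrow> real \<Rightarrow> real \<Rightarrow> real \<Rightarrow> complex" where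
  "line_integrand j u0 f t x k =
     wave j t x (of_real k) *
     (half_fourier u0 (of_real k) + forcing_transform j f t (of_real k))"

definition data_integrand ::
  "nat \<Rightarrow> real \<Rightarrow> real \<Rightarrow> (real \<Rightarrow> complex) \<Rightarrow> (real \<Rightarrow> real \<Rightarrow> complex) \<Rightarrow> nat \<Rightarrow> nat \<Rightarrow>
   real \<Rightarrow> real \<Rightarrow> complex \<Rightarrow> complex" where
  "data_integrand j \<gamma> T u0 f p n t x k =
     wave j t x k *
     (half_fourier u0 (alpha j p n * k) + forcing_transform j f T (alpha j p n * k)) *
     Pfun j \<gamma> p n k"

definition boundary_integrand ::
  "nat \<Rightarrow> real \<Rightarrow> real \<Rightarrow> (nat \<Rightarrow> real \<Rightarrow> complex) \<Rightarrow> nat \<Rightarrow> real \<Rightarrow> real \<Rightarrow> complex \<Rightarrow> complex" where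
  "boundary_integrand j \<gamma> T \<phi> l t x k =
     wave j t x k * boundary_symbol j \<gamma> l k * time_transform (\<phi> l) T (k ^ (2 * j + 1))"

definition residue_term ::
  "nat \<Rightarrow> real \<Rightarrow> real \<Rightarrow> (real \<Rightarrow> complex) \<Rightarrow> (nat \<Rightarrow> real \<Rightarrow> complex) \<Rightarrow>
   (real \<Rightarrow> real \<Rightarrow> complex) \<Rightarrow> real \<Rightarrow> real \<Rightarrow> complex" where
  "residue_term j \<gamma> T u0 \<phi> f t x =
     (if odd j \<and> \<gamma> > 0 then
        (let p = (j + 1) div 2;
             e = complex_of_real (exp (- \<gamma> * x + \<gamma> ^ (2 * j + 1) * t))
         in of_real \<gamma> * poly (Qpoly j p) 1 * e *
              (\<Sum>n=1..j+1.
                 (half_fourier u0 (\<i> * of_real \<gamma> * alpha j p n) +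
                  forcing_transform j f T (\<i> * of_real \<gamma> * alpha j p n)) /
                 poly (pderiv (Qpoly j p)) (alpha j p n)) -
            \<i> * e *
              (\<Sum>l=1..j. ccoef j p l * (\<i> * of_real \<gamma>) ^ (2 * j + 1 - l) *
                 time_transform (\<phi> l) T (- \<i> * of_real (\<gamma> ^ (2 * j + 1)))))
      else 0)"

end

theory Submission
  imports Defs "HOL-Complex_Analysis.Complex_Analysis"
begin

text \<open>
  Write \<open>m = 2 * j + 1\<close>. The proof rests on the global relation: applying the half-line
  Fourier transform to the equation and integrating in time gives, for \<open>Im k \<le> 0\<close>,
  an identity between \<open>exp (- \<i> * k ^ m * t)\<close> times the transform of \<open>u t\<close>, the transforms of
  the data, and a form \<open>boundary_form t k\<close> that collects the time transforms of the boundary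
  values \<open>\<partial>\<^sub>x\<^sup>l u t 0\<close>, \<open>l \<le> 2 * j\<close> (\<open>global_relation\<close>). On the real line, Fourier inversion
  (\<open>half_line_fourier_inversion\<close>) then expresses \<open>u t x\<close> through the line integral of the
  theorem and the line integral of \<open>wave * boundary_form t\<close>.

  The second integrand is entire in \<open>k\<close>. Where \<open>Im (k ^ m) \<ge> 0\<close>, that is, in the part of the
  upper half-plane outside the \<open>D\<^sub>2\<^sub>p\<^sup>+\<close>, one integration by parts in time shows that it is
  \<open>O(exp (- x * Im k) / k)\<close>. By Jordan's lemma the line can be deformed through this part
  onto the boundaries of the \<open>D\<^sub>2\<^sub>p\<^sup>+\<close> (\<open>line_integral_eq_sector_integrals\<close>). There the
  exponential factor \<open>exp (\<i> * k * x)\<close> decays, all integrals converge absolutely, and \<open>t\<close> may be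
  replaced by the final time \<open>T\<close> inside the boundary form, because the difference only involves
  later times and vanishes by Cauchy's theorem (\<open>sector_integral_final_time\<close>).

  It remains to eliminate the unknown boundary values. The number \<open>k ^ m\<close> does not change when
  \<open>k\<close> is multiplied by an \<open>m\<close>-th root of unity, and \<open>j + 1\<close> of these roots, the \<open>alpha j p n\<close>, carry
  \<open>D\<^sub>2\<^sub>p\<^sup>+\<close> into the lower half-plane, where the global relation holds. Multiplication of the form by
  \<open>\<i> * k * z + \<gamma>\<close> turns neighbouring boundary values into the prescribed data and leaves a
  polynomial in \<open>z\<close> of degree at most \<open>j\<close> with unknown coefficients, which Lagrange interpolation
  at the \<open>j + 1\<close> nodes evaluates at \<open>z = 1\<close> (\<open>elimination_identity\<close>,
  \<open>boundary_form_elimination\<close>). The price is the transform of the terminal values \<open>u T\<close> at the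
  points \<open>alpha j p n * k\<close>. Its contribution is again the integral of a function holomorphic in the
  sector, up to the simple pole \<open>k = \<i> * \<gamma>\<close> of the coefficients. If that pole lies in a sector,
  which happens only for odd \<open>j\<close>, \<open>\<gamma> > 0\<close> and \<open>p = (j + 1) / 2\<close>, its residue is computed from the
  same two identities at \<open>k = \<i> * \<gamma>\<close> and yields the residue term (\<open>terminal_sum_at_pole\<close>).
\<close>

section \<open>Improper integrals\<close>

text \<open>The gauge integral over an unbounded interval is itself a limit over exhausting intervals, so
  convergence of the integrals over \<open>[a, R]\<close> is enough.\<close>

lemma has_integral_halfline_limit:
  fixes g :: "real \<Rightarrow> 'a::banach"
  assumes int: "\<And>R. g integrable_on {a..R}"
    and lim: "((\<lambda>R. integral {a..R} g) \<longlongrightarrow> I) at_top"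
  shows "(g has_integral I) {a..}"
proof -
  have eq: "((\<lambda>x. if x \<in> {a..} then g x else 0) has_integral integral {a..d} g) (cbox c d)" 
    if "c \<le> a" for c d
  proof -
    have "((\<lambda>x. if x \<in> {a..d} then g x else 0) has_integral integral {a..d} g) (cbox c d)"
      using int[of d] that by (subst has_integral_restrict) (auto simp: integrable_integral)
    then show ?thesis
      by (rule has_integral_eq[rotated]) auto
  qed
  have "\<exists>B>0. \<forall>c d. ball 0 B \<subseteq> cbox c d \<longrightarrow>
      (\<exists>z. ((\<lambda>x. if x \<in> {a..} then g x else 0) has_integral z) (cbox c d) \<and> norm (z - I) < e)"
    if e: "e > 0" for e
  proof -
    from lim e obtain B0 where B0: "\<And>R. R \<ge> B0 \<Longrightarrow> dist (integral {a..R} g) I < e"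
      unfolding tendsto_iff eventually_at_top_linorder by blast
    define B where "B = max (\<bar>B0\<bar>) (\<bar>a\<bar>) + 1"
    have "B > 0" by (auto simp: B_def)
    moreover have "\<exists>z. ((\<lambda>x. if x \<in> {a..} then g x else 0) has_integral z) (cbox c d) \<and> norm (z - I) < e"
      if "ball 0 B \<subseteq> cbox c d" for c d
    proof -
      have "\<bar>B0\<bar> \<in> ball 0 B" "- \<bar>a\<bar> \<in> ball 0 B" by (auto simp: B_def)
      with that have "\<bar>B0\<bar> \<in> cbox c d" "- \<bar>a\<bar> \<in> cbox c d"
        by blast+
      then have "\<bar>B0\<bar> \<le> d" "c \<le> - \<bar>a\<bar>" by auto
      with eq[of c d] B0[of d] show ?thesis
        by (intro exI[of _ "integral {a..d} g"]) (auto simp: dist_norm)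
    qed
    ultimately show ?thesis by blast
  qed
  moreover have "\<not> (\<exists>c d. {a..} = cbox c d)" by (auto)
  ultimately show ?thesis
    by (subst has_integral_alt) auto
qed

text \<open>The intervals that exhaust the line need not be symmetric, hence both ends have to converge
  separately; a principal value would not do. Absolute convergence is not available on the line,
  where the integrand may decay only like \<open>1 / k\<close>.\<close>

lemma has_integral_UNIV_limits:
  fixes g :: "real \<Rightarrow> 'a::banach"
  assumes int: "\<And>R. g integrable_on {0..R}" "\<And>R. g integrable_on {-R..0}"
    and pos: "((\<lambda>R. integral {0..R} g) \<longlongrightarrow> I) at_top"
    and neg: "((\<lambda>R. integral {-R..0} g) \<longlongrightarrow> J) at_top"
  shows "(g has_integral (I + J)) UNIV"
proof -
  have "\<exists>B>0. \<forall>c d. ball 0 B \<subseteq> cbox c d \<longrightarrow>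
      (\<exists>z. ((\<lambda>x. if x \<in> UNIV then g x else 0) has_integral z) (cbox c d) \<and> norm (z - (I + J)) < e)"
    if e: "e > 0" for e
  proof -
    from pos e obtain B1 where B1: "\<And>R. R \<ge> B1 \<Longrightarrow> dist (integral {0..R} g) I < e / 2"
      unfolding tendsto_iff eventually_at_top_linorder by (meson half_gt_zero)
    from neg e obtain B2 where B2: "\<And>R. R \<ge> B2 \<Longrightarrow> dist (integral {-R..0} g) J < e / 2"
      unfolding tendsto_iff eventually_at_top_linorder by (meson half_gt_zero)
    define B where "B = max \<bar>B1\<bar> \<bar>B2\<bar> + 1"
    have "B > 0" by (auto simp: B_def)
    moreover have "\<exists>z. ((\<lambda>x. if x \<in> UNIV then g x else 0) has_integral z) (cbox c d) \<and> norm (z - (I + J)) < e"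
      if "ball 0 B \<subseteq> cbox c d" for c d
    proof -
      have "\<bar>B1\<bar> \<in> ball 0 B" "- \<bar>B2\<bar> \<in> ball 0 B" by (auto simp: B_def)
      with that have "\<bar>B1\<bar> \<in> cbox c d" "- \<bar>B2\<bar> \<in> cbox c d"
        by blast+
      then have cd: "\<bar>B1\<bar> \<le> d" "c \<le> - \<bar>B2\<bar>" by auto
      have "(g has_integral (integral {c..0} g + integral {0..d} g)) {c..d}"
        by (rule has_integral_combine[of _ 0]) (use int(1)[of d] int(2)[of "-c"] cd in auto)
      moreover have "norm (integral {c..0} g + integral {0..d} g - (I + J)) < e"
      proof -
        have "norm ((integral {0..d} g - I) + (integral {- (- c)..0} g - J)) < e / 2 + e / 2"
          by (rule norm_add_less) (use B1[of d] B2[of "-c"] cd in \<open>auto simp: dist_norm\<close>)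
        then show ?thesis by (simp add: algebra_simps)
      qed
      ultimately show ?thesis by auto
    qed
    ultimately show ?thesis by blast
  qed
  moreover have "\<not> (\<exists>c d. UNIV = cbox c (d::real))" by (metis not_interval_UNIV)
  ultimately show ?thesis
    by (subst has_integral_alt) auto
qed

text \<open>\<open>C / (1 + r)\<^sup>2\<close> is the common majorant of the absolutely convergent integrals below; its
  explicit tail makes truncation uniform in every parameter.\<close>

lemma has_integral_inverse_square_halfline:
  fixes C :: real
  assumes "X \<ge> 0"
  shows "((\<lambda>r. C / (1 + r)\<^sup>2) has_integral (C / (1 + X))) {X..}"
proof -
  have FTC: "((\<lambda>r. C / (1 + r)\<^sup>2) has_integral (C / (1 + X) - C / (1 + R))) {X..R}" if "R \<ge> X" for R
  proof -
    have "((\<lambda>r. C / (1 + r)\<^sup>2) has_integral ((- C / (1 + R)) - (- C / (1 + X)))) {X..R}"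
      using assms that
      by (intro fundamental_theorem_of_calculus)
         (auto intro!: derivative_eq_intros simp: has_real_derivative_iff_has_vector_derivative[symmetric] power2_eq_square)
    then show ?thesis by simp
  qed
  show ?thesis
  proof (rule has_integral_halfline_limit)
    show "(\<lambda>r. C / (1 + r)\<^sup>2) integrable_on {X..R}" for R
      using FTC[of R] by (cases "R \<ge> X") (auto simp: integrable_on_def)
    have "((\<lambda>R. C / (1 + X) - C / (1 + R)) \<longlongrightarrow> C / (1 + X)) at_top"
      by real_asymp
    then show "((\<lambda>R. integral {X..R} (\<lambda>r. C / (1 + r)\<^sup>2)) \<longlongrightarrow> C / (1 + X)) at_top"
    proof (rule Lim_transform_eventually)
      show "\<forall>\<^sub>F R in at_top. C / (1 + X) - C / (1 + R) = integral {X..R} (\<lambda>r. C / (1 + r)\<^sup>2)"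
        using eventually_ge_at_top[of X] by eventually_elim (rule integral_unique[OF FTC, symmetric])
    qed
  qed
qed

lemma inverse_square_decay_integrable:
  fixes g :: "real \<Rightarrow> 'a::euclidean_space"
  assumes "X \<ge> 0" "continuous_on {X..} g" "\<And>r. r \<ge> X \<Longrightarrow> norm (g r) \<le> C / (1 + r)\<^sup>2"
  shows "g integrable_on {X..}"
proof (rule integrable_on_all_intervals_integrable_bound)
  show "(\<lambda>r. C / (1 + r)\<^sup>2) integrable_on {X..}"
    using has_integral_inverse_square_halfline[OF assms(1)] by blast
  show "(\<lambda>x. if x \<in> {X..} then g x else 0) integrable_on cbox a b" for a b
  proof -
    have "g integrable_on {X..} \<inter> {a..b}"
    proof -
      have eq: "{X..} \<inter> {a..b} = {max X a..b}" by auto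
      show ?thesis unfolding eq
        by (rule integrable_continuous_interval) (rule continuous_on_subset[OF assms(2)], auto)
    qed
    then show ?thesis using integrable_restrict_Int[of "{X..}" g "{a..b}"] by simp
  qed
qed (use assms in auto)

lemma inverse_square_decay_tail:
  fixes g :: "real \<Rightarrow> 'a::euclidean_space"
  assumes "X \<ge> 0" "continuous_on {0..} g" "\<And>r. r \<ge> 0 \<Longrightarrow> norm (g r) \<le> C / (1 + r)\<^sup>2"
  shows "norm (integral {0..X} g - integral {0..} g) \<le> C / (1 + X)"
proof -
  have gX: "g integrable_on {X..}"
    by (rule inverse_square_decay_integrable[of _ _ C])
       (use assms in \<open>auto intro: continuous_on_subset\<close>)
  have g0: "g integrable_on {0..X}"
    by (rule integrable_continuous_interval) (rule continuous_on_subset[OF assms(2)], auto)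
  have "(g has_integral (integral {0..X} g + integral {X..} g)) ({0..X} \<union> {X..})"
    by (rule has_integral_Un) (use gX g0 assms in \<open>auto intro: negligible_subset[of "{X}"]\<close>)
  moreover have "{0..X} \<union> {X..} = {0..}" using assms by auto
  ultimately have "integral {0..} g = integral {0..X} g + integral {X..} g"
    by (simp add: integral_unique)
  then have "norm (integral {0..X} g - integral {0..} g) = norm (integral {X..} g)"
    by (simp add: norm_minus_commute)
  also have "\<dots> \<le> integral {X..} (\<lambda>r. C / (1 + r)\<^sup>2)"
    by (rule integral_norm_bound_integral)
       (use gX assms has_integral_inverse_square_halfline[OF assms(1), of C] in auto)
  also have "\<dots> = C / (1 + X)"
    using has_integral_inverse_square_halfline[OF assms(1), of C] by (rule integral_unique)
  finally show ?thesis .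
qed

lemma inverse_square_decay_limit:
  fixes g :: "real \<Rightarrow> 'a::euclidean_space"
  assumes "continuous_on {0..} g" "\<And>r. r \<ge> 0 \<Longrightarrow> norm (g r) \<le> C / (1 + r)\<^sup>2"
  shows "((\<lambda>X. integral {0..X} g) \<longlongrightarrow> integral {0..} g) at_top"
proof -
  have "((\<lambda>X. integral {0..X} g - integral {0..} g) \<longlongrightarrow> 0) at_top"
  proof (rule Lim_null_comparison)
    show "\<forall>\<^sub>F X in at_top. norm (integral {0..X} g - integral {0..} g) \<le> C / (1 + X)"
      using eventually_ge_at_top[of 0] by eventually_elim (use inverse_square_decay_tail assms in blast)
    show "((\<lambda>X. C / (1 + X)) \<longlongrightarrow> 0) at_top" by real_asymp
  qed
  then show ?thesis by (simp add: LIM_zero_iff)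
qed

text \<open>With \<open>d\<close> so small that \<open>M * d \<le> c\<close>, compare \<open>1 + r\<close> with \<open>exp (d * r)\<close> and take powers.\<close>

lemma power_times_exp_bounded:
  fixes c :: real
  assumes "c > 0"
  obtains C where "\<And>r. r \<ge> 0 \<Longrightarrow> (1 + r) ^ M * exp (- (c * r)) \<le> C" "C \<ge> 0"
proof -
  define d where "d = c / (real M + 1)"
  have d: "d > 0" "real M * d \<le> c" using assms by (auto simp: d_def field_simps)
  show ?thesis
  proof
    fix r :: real assume r: "r \<ge> 0"
    have "1 + r \<le> (1 + 1 / d) * (1 + d * r)"
      using d r by (simp add: field_simps)
    also have "\<dots> \<le> (1 + 1 / d) * exp (d * r)"
      using d by (intro mult_left_mono exp_ge_add_one_self) auto
    finally have "(1 + r) ^ M \<le> ((1 + 1 / d) * exp (d * r)) ^ M"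
      using r by (intro power_mono) auto
    also have "\<dots> = (1 + 1 / d) ^ M * exp (real M * d * r)"
      by (simp only: power_mult_distrib exp_of_nat_mult mult.assoc)
    also have "\<dots> \<le> (1 + 1 / d) ^ M * exp (c * r)"
      using d r by (intro mult_left_mono) (auto intro: mult_right_mono)
    finally show "(1 + r) ^ M * exp (- (c * r)) \<le> (1 + 1 / d) ^ M"
      by (simp add: exp_minus field_simps)
  qed (use d in auto)
qed

lemma exp_decay_inverse_square:
  fixes c :: real
  assumes "c > 0"
  obtains C' where "\<And>r. r \<ge> 0 \<Longrightarrow> C * (1 + r) ^ M * exp (- (c * r)) \<le> C' / (1 + r)\<^sup>2" "C' \<ge> 0"
proof -
  obtain D where D: "\<And>r. r \<ge> 0 \<Longrightarrow> (1 + r) ^ (M + 2) * exp (- (c * r)) \<le> D" "D \<ge> 0"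
    using power_times_exp_bounded[OF assms] by blast
  show ?thesis
  proof
    fix r :: real assume r: "r \<ge> 0"
    have "C * (1 + r) ^ M * exp (- (c * r)) * (1 + r)\<^sup>2 = C * ((1 + r) ^ (M + 2) * exp (- (c * r)))"
      by (simp only: power_add mult_ac)
    also have "\<dots> \<le> \<bar>C\<bar> * ((1 + r) ^ (M + 2) * exp (- (c * r)))"
      using r by (intro mult_right_mono) auto
    also have "\<dots> \<le> \<bar>C\<bar> * D" using D r by (intro mult_left_mono) auto
    finally show "C * (1 + r) ^ M * exp (- (c * r)) \<le> (\<bar>C\<bar> * D) / (1 + r)\<^sup>2"
      using r by (simp add: pos_le_divide_eq)
  qed (use D in auto)
qed

section \<open>Cauchy's formula on a sector\<close>

text \<open>The signed distance of \<open>z\<close> from the line through \<open>0\<close> and \<open>cis \<theta>\<close>. Sectors described by two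
  half-planes are visibly closed and convex, and their interior is known.\<close>

definition height_above :: "real \<Rightarrow> complex \<Rightarrow> real" where
  "height_above \<theta> z = Im (z * cis (- \<theta>))"

definition sector :: "real \<Rightarrow> real \<Rightarrow> complex set" where
  "sector a b = {z. 0 \<le> height_above a z \<and> height_above b z \<le> 0}"

lemma height_above_inner: "height_above \<theta> z = inner (Complex (- sin \<theta>) (cos \<theta>)) z"
  by (simp add: height_above_def inner_complex_def algebra_simps)

lemma height_above_polar: "height_above \<theta> (of_real r * cis \<phi>) = r * sin (\<phi> - \<theta>)"
  unfolding height_above_def by (simp only: mult.assoc cis_mult) simp

lemma height_above_le_dist: "\<bar>height_above \<theta> z\<bar> \<le> norm (of_real r * cis \<theta> - z)"
proof -
  have "\<bar>height_above \<theta> z\<bar> = \<bar>Im (of_real r - z * cis (- \<theta>))\<bar>"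
    by (simp add: height_above_def)
  also have "\<dots> \<le> norm (of_real r - z * cis (- \<theta>))" by (rule abs_Im_le_cmod)
  also have "\<dots> = norm ((of_real r * cis \<theta> - z) * cis (- \<theta>))"
    by (simp add: left_diff_distrib mult.assoc cis_mult)
  finally show ?thesis by (simp add: norm_mult)
qed

lemma convex_sector: "convex (sector a b)"
proof -
  have "sector a b = {z. inner (Complex (- sin a) (cos a)) z \<ge> 0} \<inter> {z. inner (Complex (- sin b) (cos b)) z \<le> 0}"
    unfolding sector_def height_above_inner by auto
  then show ?thesis by (simp add: convex_Int convex_halfspace_ge convex_halfspace_le)
qed

lemma interior_sector: "interior (sector a b) = {z. 0 < height_above a z \<and> height_above b z < 0}"
proof -
  have nz: "Complex (- sin \<theta>) (cos \<theta>) \<noteq> 0" for \<theta>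
    using sin_zero_abs_cos_one[of \<theta>] by (auto simp: complex_eq_iff)
  have "sector a b = {z. inner (Complex (- sin a) (cos a)) z \<ge> 0} \<inter> {z. inner (Complex (- sin b) (cos b)) z \<le> 0}"
    unfolding sector_def height_above_inner by auto
  then show ?thesis
    unfolding height_above_inner
    by (auto simp: interior_Int interior_halfspace_ge[OF nz] interior_halfspace_le[OF nz])
qed

lemma zero_in_sector: "0 \<in> sector a b"
  by (simp add: sector_def height_above_def)

lemma ray_in_sector:
  assumes "0 \<le> r" "a \<le> \<theta>" "\<theta> \<le> b" "b - a \<le> pi"
  shows "of_real r * cis \<theta> \<in> sector a b"
proof -
  have "sin (\<theta> - a) \<ge> 0" "sin (b - \<theta>) \<ge> 0" using assms by (auto intro!: sin_ge_zero)
  moreover have "sin (\<theta> - b) = - sin (b - \<theta>)" by (metis minus_diff_eq sin_minus)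
  ultimately show ?thesis
    unfolding sector_def mem_Collect_eq height_above_polar using assms by (simp add: mult_nonneg_nonpos)
qed

text \<open>The way back from half-planes to polar coordinates, in which the estimates on the sectors are
  made.\<close>

lemma sector_polar:
  assumes z: "z \<in> sector a b" and ab: "0 < b - a" "b - a < pi"
  obtains r \<theta> where "r \<ge> 0" "a \<le> \<theta>" "\<theta> \<le> b" "z = of_real r * cis \<theta>"
proof (cases "z = 0")
  case True
  then show ?thesis using ab that[of 0 a] by auto
next
  case False
  define w where "w = z * cis (- a)"
  define \<phi> where "\<phi> = Arg w"
  have w: "w \<noteq> 0" using False by (simp add: w_def)
  have "Im w \<ge> 0" using z by (simp only: sector_def w_def height_above_def mem_Collect_eq)
  then have \<phi>: "0 \<le> \<phi>" "\<phi> \<le> pi" using Arg_less_0[of w] Arg_le_pi[of w] by (auto simp: \<phi>_def)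
  have weq: "w = of_real (norm w) * cis \<phi>"
    unfolding \<phi>_def using w by (metis cis_Arg mult.commute nonzero_divide_eq_eq of_real_eq_0_iff norm_eq_zero sgn_eq)
  have zeq: "z = w * cis a" by (simp add: w_def mult.assoc cis_mult)
  have "z * cis (- b) = of_real (norm w) * cis (\<phi> - (b - a))"
    unfolding zeq by (subst weq) (simp add: mult.assoc cis_mult algebra_simps)
  then have "norm w * sin (\<phi> - (b - a)) = height_above b z" by (simp only: height_above_def) simp
  then have "norm w * sin (\<phi> - (b - a)) \<le> 0" using z by (simp add: sector_def)
  then have s: "sin (\<phi> - (b - a)) \<le> 0" using w by (simp add: mult_le_0_iff)
  have "\<phi> \<le> b - a"
  proof (rule ccontr)
    assume "\<not> ?thesis"
    then have "sin (\<phi> - (b - a)) > 0" using \<phi> ab by (intro sin_gt_zero) auto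
    with s show False by simp
  qed
  then show ?thesis
  proof (intro that[of "norm w" "\<phi> + a"])
    have "z = of_real (norm w) * cis \<phi> * cis a" using zeq weq by simp
    then show "z = of_real (norm w) * cis (\<phi> + a)" by (simp add: mult.assoc cis_mult)
  qed (use \<phi> in auto)
qed

lemma ray_decay_integrable:
  assumes cont: "continuous_on {0..} (\<lambda>r. h (of_real r * cis \<theta>))"
    and bd: "\<And>r. r \<ge> 0 \<Longrightarrow> norm (h (of_real r * cis \<theta>) :: complex) \<le> C * (1 + r) ^ M * exp (- (x * (r * sin \<theta>)))"
    and x: "x > 0" "sin \<theta> > 0"
  shows "(\<lambda>r. h (of_real r * cis \<theta>)) integrable_on {0..}"
    and "((\<lambda>R. integral {0..R} (\<lambda>r. h (of_real r * cis \<theta>) * cis \<theta>)) \<longlongrightarrow>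
          integral {0..} (\<lambda>r. h (of_real r * cis \<theta>) * cis \<theta>)) at_top"
proof -
  obtain C' where C': "\<And>r. r \<ge> 0 \<Longrightarrow> C * (1 + r) ^ M * exp (- (x * sin \<theta> * r)) \<le> C' / (1 + r)\<^sup>2"
    using exp_decay_inverse_square[of "x * sin \<theta>"] x by (metis mult_pos_pos)
  have bd': "norm (h (of_real r * cis \<theta>)) \<le> C' / (1 + r)\<^sup>2" if "r \<ge> 0" for r
    using order_trans[OF bd[OF that]] C'[OF that] by (simp add: mult_ac)
  show "(\<lambda>r. h (of_real r * cis \<theta>)) integrable_on {0..}"
    by (rule inverse_square_decay_integrable[of 0 _ C']) (use cont bd' in auto)
  show "((\<lambda>R. integral {0..R} (\<lambda>r. h (of_real r * cis \<theta>) * cis \<theta>)) \<longlongrightarrow>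
          integral {0..} (\<lambda>r. h (of_real r * cis \<theta>) * cis \<theta>)) at_top"
    by (rule inverse_square_decay_limit[of _ C'])
       (use bd' in \<open>auto simp: norm_mult intro!: continuous_intros cont\<close>)
qed

lemma contour_integral_ray:
  assumes cont: "continuous_on {0..R} (\<lambda>r. h (of_real r * cis \<theta>))" and R: "R > 0"
  shows "contour_integral (linepath 0 (of_real R * cis \<theta>)) h =
         integral {0..R} (\<lambda>r. h (of_real r * cis \<theta>) * cis \<theta>)"
proof -
  let ?F = "\<lambda>r. h (of_real r * cis \<theta>) * cis \<theta>"
  have "?F integrable_on {0..R}"
    by (intro integrable_continuous_interval continuous_intros cont)
  then have "(?F has_integral integral {0..R} ?F) (cbox 0 R)"
    by (simp only: box_real integrable_integral)
  from has_integral_affinity'[OF this R, of 0] R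
  have "((\<lambda>s. ?F (R * s)) has_integral (1 / R) *\<^sub>R integral {0..R} ?F) {0..1}"
    by (simp add: inverse_eq_divide)
  then have "((\<lambda>s. of_real R * ?F (R * s)) has_integral of_real R * ((1 / R) *\<^sub>R integral {0..R} ?F)) {0..1}"
    by (intro has_integral_mult_right) simp
  moreover have "of_real R * ((1 / R) *\<^sub>R integral {0..R} ?F) = integral {0..R} ?F"
    using R by (simp add: scaleR_conv_of_real)
  ultimately have "(h has_contour_integral (integral {0..R} ?F)) (linepath 0 (of_real R * cis \<theta>))"
    unfolding has_contour_integral_linepath
    by (simp add: linepath_def scaleR_conv_of_real mult_ac)
  then show ?thesis by (rule contour_integral_unique)
qed

text \<open>Apply Cauchy's formula to the triangle with vertices \<open>0\<close>, \<open>R * cis a\<close>, \<open>R * cis b\<close>. On the chord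
  \<open>Im z\<close> is at least \<open>R * min (sin a) (sin b)\<close>, so the exponential factor removes it as \<open>R\<close> grows.
  Only continuity is asked on the bounding rays, because the transforms to which the formula is
  applied are holomorphic in the open sector alone.\<close>

lemma cauchy_formula_sector:
  assumes ab: "0 < a" "a < b" "b < pi" and x: "x > 0"
    and cont: "continuous_on (sector a b) f"
    and holo: "f holomorphic_on interior (sector a b)"
    and bd: "\<And>z. z \<in> sector a b \<Longrightarrow> norm (f z) \<le> C * (1 + norm z) ^ M * exp (- (x * Im z))"
    and z0: "z0 \<in> interior (sector a b)"
  shows "integral {0..} (\<lambda>r. f (of_real r * cis a) / (of_real r * cis a - z0) * cis a)
       - integral {0..} (\<lambda>r. f (of_real r * cis b) / (of_real r * cis b - z0) * cis b)
       = 2 * of_real pi * \<i> * f z0"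
proof -
  define h where "h = (\<lambda>z. f z / (z - z0))"
  let ?I = "\<lambda>R \<theta>. integral {0..R} (\<lambda>r. h (of_real r * cis \<theta>) * cis \<theta>)"
  let ?J = "\<lambda>\<theta>. integral {0..} (\<lambda>r. h (of_real r * cis \<theta>) * cis \<theta>)"
  have ba: "b - a \<le> pi" "b - a < pi" "sin (b - a) > 0" using ab by (auto intro!: sin_gt_zero)
  have z0a: "height_above a z0 > 0" and z0b: "height_above b z0 < 0"
    using z0 by (auto simp: interior_sector)
  have C0: "C \<ge> 0"
    using order_trans[OF norm_ge_zero bd[of 0]] by (auto simp: zero_in_sector)
  have Sa: "of_real r * cis a \<in> sector a b" "of_real r * cis b \<in> sector a b" if "r \<ge> 0" for r
    using that ab ba by (auto intro!: ray_in_sector)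
  note dist = height_above_le_dist[of _ z0]
  have cf: "continuous_on {0..} (\<lambda>r. h (of_real r * cis \<theta>))"
    and limf: "((\<lambda>R. ?I R \<theta>) \<longlongrightarrow> ?J \<theta>) at_top"
    if th: "\<theta> \<in> {a, b}" for \<theta>
  proof -
    have d0: "\<bar>height_above \<theta> z0\<bar> > 0" using th z0a z0b by auto
    have nz: "of_real r * cis \<theta> - z0 \<noteq> 0" for r using dist[of \<theta> r] d0 by auto
    have S: "of_real r * cis \<theta> \<in> sector a b" if "r \<ge> 0" for r using Sa that th by auto
    show "continuous_on {0..} (\<lambda>r. h (of_real r * cis \<theta>))"
      unfolding h_def
      by (intro continuous_on_divide continuous_on_compose2[OF cont] continuous_intros)
         (use nz S in auto)
    then show "((\<lambda>R. ?I R \<theta>) \<longlongrightarrow> ?J \<theta>) at_top"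
    proof (rule ray_decay_integrable(2))
      show "norm (h (of_real r * cis \<theta>)) \<le> C / \<bar>height_above \<theta> z0\<bar> * (1 + r) ^ M * exp (- (x * (r * sin \<theta>)))"
        if "r \<ge> 0" for r
      proof -
        have "norm (h (of_real r * cis \<theta>)) = norm (f (of_real r * cis \<theta>)) / norm (of_real r * cis \<theta> - z0)"
          by (simp add: h_def norm_divide)
        also have "\<dots> \<le> (C * (1 + r) ^ M * exp (- (x * (r * sin \<theta>)))) / \<bar>height_above \<theta> z0\<bar>"
          using bd[OF S[OF that]] that d0 dist[of \<theta> r] C0
          by (intro frac_le) (auto simp: norm_mult)
        finally show ?thesis by simp
      qed
    qed (use x th ab in \<open>auto intro!: sin_gt_zero\<close>)
  qed
  \<comment> \<open>The coordinates of \<open>z\<close> with respect to \<open>cis a\<close> and \<open>cis b\<close>.\<close>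
  define s where "s z = - height_above b z / sin (b - a)" for z
  define t where "t z = height_above a z / sin (b - a)" for z
  have st: "z = of_real (s z) * cis a + of_real (t z) * cis b" for z
  proof -
    have "of_real (sin (b - a)) * z = - of_real (height_above b z) * cis a + of_real (height_above a z) * cis b"
    proof (rule complex_eqI)
      have "sin b * sin b = 1 - cos b * cos b" "sin a * sin a = 1 - cos a * cos a" 
        using sin_squared_eq[of a] sin_squared_eq[of b] by (auto simp: power2_eq_square)
      then show "Re (of_real (sin (b - a)) * z) = Re (- of_real (height_above b z) * cis a + of_real (height_above a z) * cis b)"
         "Im (of_real (sin (b - a)) * z) = Im (- of_real (height_above b z) * cis a + of_real (height_above a z) * cis b)"
        by (simp_all add: height_above_def sin_diff algebra_simps)
    qed
    then show ?thesis using ba(3) by (simp add: s_def t_def divide_simps) (simp add: algebra_simps)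
  qed
  define c where "c = min (sin a) (sin b)"
  have c: "c > 0" using ab by (auto simp: c_def intro!: sin_gt_zero)
  \<comment> \<open>\<open>R0\<close> puts \<open>z0\<close> inside the triangle, whose points satisfy \<open>s z + t z < R\<close>, and keeps the chord
      at distance at least \<open>1\<close> from \<open>z0\<close>.\<close>
  define R0 where "R0 = max 1 (max (s z0 + t z0 + 1) ((norm z0 + 1) / c))"
  have main: "norm (?I R a - ?I R b - 2 * of_real pi * \<i> * f z0)
      \<le> C * (1 + R) ^ M * exp (- (x * c * R)) * (2 * R)" if R: "R \<ge> R0" for R
  proof -
    have R1: "R \<ge> 1" "s z0 + t z0 < R" "norm z0 + 1 \<le> R * c"
      using R c by (auto simp: R0_def divide_le_eq)
    define A where "A = of_real R * cis a"
    define B where "B = of_real R * cis b"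
    define g where "g = linepath 0 A +++ linepath A B +++ linepath B 0"
    have Ain: "A \<in> sector a b" "B \<in> sector a b" "0 \<in> sector a b"
      using Sa[of R] R1 by (auto simp: A_def B_def zero_in_sector)
    have seg: "closed_segment A B \<subseteq> sector a b" "closed_segment 0 A \<subseteq> sector a b" "closed_segment B 0 \<subseteq> sector a b"
      by (intro closed_segment_subset Ain convex_sector)+
    have hull: "z0 \<in> interior (convex hull {0, A, B})"
    proof -
      let ?U = "{z. s z > 0} \<inter> {z. t z > 0} \<inter> {z. s z + t z < R}"
      have "open ?U"
        unfolding s_def t_def height_above_def using ba(3)
        by (intro open_Int open_Collect_less continuous_intros) auto
      moreover have "z0 \<in> ?U" using z0a z0b ba R1 by (auto simp: s_def t_def divide_neg_pos)
      moreover have "?U \<subseteq> convex hull {0, A, B}"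
      proof
        fix z assume z: "z \<in> ?U"
        have "z = (1 - s z / R - t z / R) *\<^sub>R 0 + (s z / R) *\<^sub>R A + (t z / R) *\<^sub>R B"
          using st[of z] R1 by (simp add: A_def B_def scaleR_conv_of_real)
        moreover have "(s z + t z) / R \<le> 1" using z R1 by (simp add: divide_le_eq)
        then have "1 - s z / R - t z / R \<ge> 0" by (simp add: add_divide_distrib)
        ultimately show "z \<in> convex hull {0, A, B}"
          unfolding convex_hull_3 using z R1
          by (intro CollectI exI[of _ "1 - s z / R - t z / R"] exI[of _ "s z / R"] exI[of _ "t z / R"]) auto
      qed
      ultimately show ?thesis by (meson interiorI)
    qed
    have chord: "Im z \<ge> R * c \<and> norm z \<le> R" if "z \<in> closed_segment A B" for z
    proof -
      from that obtain u where u: "0 \<le> u" "u \<le> 1" "z = (1 - u) *\<^sub>R A + u *\<^sub>R B"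
        by (auto simp: in_segment)
      have "Im z = R * ((1 - u) * sin a + u * sin b)"
        unfolding u(3) by (simp add: A_def B_def algebra_simps)
      moreover have "(1 - u) * sin a + u * sin b \<ge> (1 - u) * c + u * c"
        using u by (intro add_mono mult_left_mono) (auto simp: c_def)
      then have "(1 - u) * sin a + u * sin b \<ge> c" by (simp add: algebra_simps)
      ultimately have "Im z \<ge> R * c" using R1 by (auto intro: mult_left_mono)
      moreover have "norm z \<le> (1 - u) * R + u * R"
        unfolding u(3) by (rule order_trans[OF norm_triangle_ineq]) (use u R1 in \<open>auto simp: A_def B_def norm_mult\<close>)
      ultimately show ?thesis by (simp add: algebra_simps)
    qed
    have nz0: "z0 \<notin> closed_segment 0 A" "z0 \<notin> closed_segment B 0" "z0 \<notin> closed_segment A B"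
    proof -
      show "z0 \<notin> closed_segment 0 A"
      proof
        assume "z0 \<in> closed_segment 0 A"
        then obtain u where "z0 = u *\<^sub>R A" by (auto simp: in_segment)
        then have "z0 = of_real (u * R) * cis a"
          by (simp add: A_def scaleR_conv_of_real)
        with dist[of a "u * R"] z0a show False by auto
      qed
      show "z0 \<notin> closed_segment B 0"
      proof
        assume "z0 \<in> closed_segment B 0"
        then obtain u where "z0 = (1 - u) *\<^sub>R B" by (auto simp: in_segment)
        then have "z0 = of_real ((1 - u) * R) * cis b"
          by (simp add: B_def scaleR_conv_of_real)
        with dist[of b "(1 - u) * R"] z0b show False by auto
      qed
      show "z0 \<notin> closed_segment A B"
        using chord[of z0] R1 abs_Im_le_cmod[of z0] by auto
    qed
    have "(h has_contour_integral (of_real (2 * pi) * \<i> * winding_number g z0 * f z0)) g"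
      unfolding h_def
    proof (rule Cauchy_integral_formula_convex[OF convex_sector[of a b] finite.emptyI cont _ z0])
      show "path_image g \<subseteq> sector a b - {z0}"
        unfolding g_def using seg nz0 by (auto simp: path_image_join)
    qed (use holo in \<open>auto simp: g_def holomorphic_on_open field_differentiable_def\<close>)
    moreover have "winding_number g z0 = 1"
    proof -
      have "0 < Im ((A - 0) * cnj (A - z0))"
      proof -
        have "Im ((A - 0) * cnj (A - z0)) = R * height_above a z0"
          by (simp add: A_def height_above_def algebra_simps)
        then show ?thesis using z0a R1 by simp
      qed
      then show ?thesis unfolding g_def using winding_number_triangle[OF hull] by simp
    qed
    ultimately have tot: "contour_integral g h = 2 * of_real pi * \<i> * f z0"
      by (simp add: contour_integral_unique)
    have conth: "continuous_on (sector a b - {z0}) h"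
      unfolding h_def by (intro continuous_intros continuous_on_subset[OF cont]) auto
    have ci: "h contour_integrable_on linepath 0 A" "h contour_integrable_on linepath A B" "h contour_integrable_on linepath B 0"
      by (intro contour_integrable_continuous_linepath continuous_on_subset[OF conth]; use seg nz0 in blast)+
    have "contour_integral g h = contour_integral (linepath 0 A) h + contour_integral (linepath A B) h + contour_integral (linepath B 0) h"
      unfolding g_def using ci by (simp add: contour_integral_join contour_integrable_joinI)
    also have "contour_integral (linepath B 0) h = - contour_integral (linepath 0 B) h"
      by (rule contour_integral_reverse_linepath) (use conth seg nz0 in \<open>auto intro!: continuous_on_subset[OF conth]\<close>)
    also have "contour_integral (linepath 0 A) h = ?I R a"
      unfolding A_def by (rule contour_integral_ray) (use R1 in \<open>auto intro!: continuous_on_subset[OF cf[of a]]\<close>)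
    also have "contour_integral (linepath 0 B) h = ?I R b"
      unfolding B_def by (rule contour_integral_ray) (use R1 in \<open>auto intro!: continuous_on_subset[OF cf[of b]]\<close>)
    finally have "?I R a - ?I R b - 2 * of_real pi * \<i> * f z0 
       = - contour_integral (linepath A B) h"
      unfolding tot by (simp add: algebra_simps)
    moreover have "norm (contour_integral (linepath A B) h) \<le> C * (1 + R) ^ M * exp (- (x * c * R)) * norm (B - A)"
    proof (rule contour_integral_bound_linepath[OF ci(2)])
      show "0 \<le> C * (1 + R) ^ M * exp (- (x * c * R))" using C0 R1 by simp
      fix z assume z: "z \<in> closed_segment A B"
      have "norm (z - z0) \<ge> norm z - norm z0" by (rule norm_triangle_ineq2)
      then have ge1: "norm (z - z0) \<ge> 1"
        using chord[OF z] R1 abs_Im_le_cmod[of z] by linarith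
      have "norm (h z) = norm (f z) / norm (z - z0)" by (simp add: h_def norm_divide)
      also have "\<dots> \<le> norm (f z) / 1" using ge1 by (intro divide_left_mono) auto
      also have "\<dots> \<le> C * (1 + norm z) ^ M * exp (- (x * Im z))" using bd[of z] seg z by auto
      also have "\<dots> \<le> C * (1 + R) ^ M * exp (- (x * c * R))"
        using chord[OF z] C0 x R1 by (intro mult_mono power_mono) (auto simp: mult_ac)
      finally show "norm (h z) \<le> C * (1 + R) ^ M * exp (- (x * c * R))" .
    qed
    moreover have "norm (B - A) \<le> 2 * R"
      by (rule order_trans[OF norm_triangle_ineq4]) (use R1 in \<open>auto simp: A_def B_def norm_mult\<close>)
    ultimately show ?thesis
      using mult_left_mono[of "norm (B - A)" "2 * R" "C * (1 + R) ^ M * exp (- (x * c * R))"] C0 R1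
      by auto
  qed
  obtain C' where C': "\<And>r. r \<ge> 0 \<Longrightarrow> (2 * C) * (1 + r) ^ (M + 1) * exp (- (x * c * r)) \<le> C' / (1 + r)\<^sup>2"
    using exp_decay_inverse_square[of "x * c" "2 * C" "M + 1"] x c by (metis mult_pos_pos)
  have "((\<lambda>R. ?I R a - ?I R b - 2 * of_real pi * \<i> * f z0) \<longlongrightarrow> 0) at_top"
  proof (rule Lim_null_comparison)
    show "((\<lambda>R. C' / (1 + R)\<^sup>2) \<longlongrightarrow> 0) at_top" by real_asymp
    show "\<forall>\<^sub>F R in at_top. norm (?I R a - ?I R b - 2 * of_real pi * \<i> * f z0) \<le> C' / (1 + R)\<^sup>2"
      using eventually_ge_at_top[of R0] eventually_ge_at_top[of 0]
    proof eventually_elim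
      case (elim R)
      have "C * (1 + R) ^ M * exp (- (x * c * R)) * (2 * R) \<le> C * (1 + R) ^ M * exp (- (x * c * R)) * (2 * (1 + R))"
        using elim C0 by (intro mult_left_mono) auto
      also have "\<dots> = (2 * C) * (1 + R) ^ (M + 1) * exp (- (x * c * R))" by (simp add: mult_ac)
      finally show ?case using main[OF elim(1)] C'[OF elim(2)] by linarith
    qed
  qed
  moreover have "((\<lambda>R. ?I R a - ?I R b - 2 * of_real pi * \<i> * f z0) \<longlongrightarrow> ?J a - ?J b - 2 * of_real pi * \<i> * f z0) at_top"
    by (intro tendsto_intros limf) auto
  ultimately have "?J a - ?J b - 2 * of_real pi * \<i> * f z0 = 0"
    using tendsto_unique trivial_limit_at_top_linorder by blast
  then show ?thesis by (simp add: h_def)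
qed

text \<open>Cauchy's formula for \<open>h z * (z - z0)\<close>, which vanishes at the interior point \<open>z0\<close>.\<close>

lemma cauchy_theorem_sector:
  assumes ab: "0 < a" "a < b" "b < pi" and x: "x > 0"
    and cont: "continuous_on (sector a b) h"
    and holo: "h holomorphic_on interior (sector a b)"
    and bd: "\<And>z. z \<in> sector a b \<Longrightarrow> norm (h z) \<le> C * (1 + norm z) ^ M * exp (- (x * Im z))"
  shows "integral {0..} (\<lambda>r. h (of_real r * cis a) * cis a) = integral {0..} (\<lambda>r. h (of_real r * cis b) * cis b)"
proof -
  define z0 where "z0 = cis ((a + b) / 2)"
  have "sin (b / 2 - a / 2) > 0" using ab by (intro sin_gt_zero) auto
  moreover have "sin (a / 2 - b / 2) = - sin (b / 2 - a / 2)" by (metis minus_diff_eq sin_minus)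
  moreover have "sin ((a + b) / 2 - a) = sin (b / 2 - a / 2)" "sin ((a + b) / 2 - b) = sin (a / 2 - b / 2)"
    by (rule arg_cong[of _ _ sin], simp add: field_simps)+
  moreover have "height_above \<theta> z0 = sin ((a + b) / 2 - \<theta>)" for \<theta>
    using height_above_polar[of \<theta> 1 "(a + b) / 2"] by (simp add: z0_def)
  ultimately have z0: "z0 \<in> interior (sector a b)"
    unfolding interior_sector by (simp only: mem_Collect_eq neg_less_0_iff_less simp_thms)
  have ray: "of_real r * cis \<theta> - z0 \<noteq> 0" if "\<theta> \<in> {a, b}" for r \<theta>
  proof
    assume "of_real r * cis \<theta> - z0 = 0"
    then have "height_above \<theta> z0 = 0"
      using height_above_polar[of \<theta> r \<theta>] by simp
    with z0 that show False by (auto simp: interior_sector)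
  qed
  have C0: "C \<ge> 0"
    using order_trans[OF norm_ge_zero bd[of 0]] by (auto simp: zero_in_sector)
  have "integral {0..} (\<lambda>r. (h (of_real r * cis a) * (of_real r * cis a - z0)) / (of_real r * cis a - z0) * cis a)
       - integral {0..} (\<lambda>r. (h (of_real r * cis b) * (of_real r * cis b - z0)) / (of_real r * cis b - z0) * cis b)
       = 2 * of_real pi * \<i> * (h z0 * (z0 - z0))"
  proof (rule cauchy_formula_sector[OF ab x _ _ _ z0])
    show "continuous_on (sector a b) (\<lambda>z. h z * (z - z0))" by (intro continuous_intros cont)
    show "(\<lambda>z. h z * (z - z0)) holomorphic_on interior (sector a b)" by (intro holomorphic_intros holo)
    fix z assume z: "z \<in> sector a b"
    have "norm (h z * (z - z0)) \<le> (C * (1 + norm z) ^ M * exp (- (x * Im z))) * (1 + norm z)"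
      unfolding norm_mult
    proof (rule mult_mono[OF bd[OF z]])
      show "norm (z - z0) \<le> 1 + norm z" using norm_triangle_ineq4[of z z0] by (simp add: z0_def)
    qed (use C0 in auto)
    then show "norm (h z * (z - z0)) \<le> C * (1 + norm z) ^ (M + 1) * exp (- (x * Im z))"
      by (simp add: mult_ac)
  qed
  then show ?thesis using ray by simp
qed

section \<open>From the real line to the boundaries of the sectors\<close>

text \<open>From here on contours are compared through the values of one primitive at their end points,
  not by assembling closed paths.\<close>

lemma integral_primitive_along_path:
  fixes \<gamma> :: "real \<Rightarrow> complex"
  assumes prim: "\<And>z. z \<in> S \<Longrightarrow> (\<Phi> has_field_derivative h z) (at z within S)"
    and \<gamma>: "\<And>t. t \<in> {a..b} \<Longrightarrow> (\<gamma> has_vector_derivative \<gamma>' t) (at t within {a..b})"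
    and S: "\<And>t. t \<in> {a..b} \<Longrightarrow> \<gamma> t \<in> S" and ab: "a \<le> b"
  shows "((\<lambda>t. \<gamma>' t * h (\<gamma> t)) has_integral (\<Phi> (\<gamma> b) - \<Phi> (\<gamma> a))) {a..b}"
proof -
  have "((\<lambda>t. \<gamma>' t * h (\<gamma> t)) has_integral ((\<Phi> \<circ> \<gamma>) b - (\<Phi> \<circ> \<gamma>) a)) {a..b}"
  proof (rule fundamental_theorem_of_calculus[OF ab])
    fix t assume t: "t \<in> {a..b}"
    show "((\<Phi> \<circ> \<gamma>) has_vector_derivative \<gamma>' t * h (\<gamma> t)) (at t within {a..b})"
      by (rule field_vector_diff_chain_within[OF \<gamma>[OF t]])
         (rule DERIV_subset[OF prim], use S t in auto)
  qed
  then show ?thesis by simp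
qed

lemma integral_primitive_real:
  fixes \<Phi> h :: "complex \<Rightarrow> complex"
  assumes prim: "\<And>z. z \<in> S \<Longrightarrow> (\<Phi> has_field_derivative h z) (at z within S)"
    and S: "\<And>t. t \<in> {a..b} \<Longrightarrow> of_real t \<in> S" and ab: "a \<le> b"
  shows "((\<lambda>t. h (of_real t)) has_integral (\<Phi> (of_real b) - \<Phi> (of_real a))) {a..b}"
proof -
  have "(of_real has_vector_derivative (1::complex)) (at t within {a..b})" for t
    using has_vector_derivative_of_real[of "\<lambda>t. t" 1 "at t within {a..b}"] by simp
  then show ?thesis
    using integral_primitive_along_path[OF prim, of a b "\<lambda>t. of_real t" "\<lambda>_. 1"] ab S by simp
qed

lemma integral_primitive_ray:
  assumes prim: "\<And>z. z \<in> S \<Longrightarrow> (\<Phi> has_field_derivative h z) (at z within S)"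
    and S: "\<And>r. r \<in> {0..R} \<Longrightarrow> of_real r * cis \<theta> \<in> S" and R: "0 \<le> R"
  shows "((\<lambda>r. h (of_real r * cis \<theta>) * cis \<theta>) has_integral (\<Phi> (of_real R * cis \<theta>) - \<Phi> 0)) {0..R}"
proof -
  have "((\<lambda>r. cis \<theta> * h (of_real r * cis \<theta>)) has_integral (\<Phi> (of_real R * cis \<theta>) - \<Phi> (of_real 0 * cis \<theta>))) {0..R}"
    by (rule integral_primitive_along_path[OF prim _ S R])
       (auto intro!: derivative_eq_intros has_vector_derivative_real_field)
  then show ?thesis by (simp add: mult.commute)
qed

lemma integral_primitive_arc:
  assumes prim: "\<And>z. z \<in> S \<Longrightarrow> (\<Phi> has_field_derivative h z) (at z within S)"
    and S: "\<And>\<theta>. \<theta> \<in> {\<alpha>..\<beta>} \<Longrightarrow> of_real R * cis \<theta> \<in> S" and ab: "\<alpha> \<le> \<beta>"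
  shows "((\<lambda>\<theta>. \<i> * of_real R * cis \<theta> * h (of_real R * cis \<theta>)) has_integral
           (\<Phi> (of_real R * cis \<beta>) - \<Phi> (of_real R * cis \<alpha>))) {\<alpha>..\<beta>}"
proof (rule integral_primitive_along_path[OF prim _ S ab])
  fix t
  have "((\<lambda>t. of_real R * exp (\<i> * of_real t)) has_vector_derivative \<i> * of_real R * exp (\<i> * of_real t)) (at t within {\<alpha>..\<beta>})"
    by (rule has_vector_derivative_real_field) (auto intro!: derivative_eq_intros)
  then show "((\<lambda>\<theta>. of_real R * cis \<theta>) has_vector_derivative \<i> * of_real R * cis t) (at t within {\<alpha>..\<beta>})"
    by (simp add: cis_conv_exp)
qed

text \<open>Jordan's lemma: the integrand is at most \<open>1\<close> and tends to \<open>0\<close> except at the two end points.\<close>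

lemma jordan_integral_tendsto_0:
  assumes x: "(x::real) > 0"
  shows "((\<lambda>R. integral {0..pi} (\<lambda>\<theta>. exp (- (x * (R * sin \<theta>))))) \<longlongrightarrow> 0) at_top"
proof (rule tendsto_at_topI_sequentially)
  fix X :: "nat \<Rightarrow> real" assume X: "filterlim X at_top sequentially"
  let ?g = "\<lambda>\<theta>. if \<theta> \<in> {0, pi} then 1 else 0 :: real"
  have "(\<lambda>n. integral {0..pi} (\<lambda>\<theta>. exp (- (x * (max 0 (X n) * sin \<theta>))))) \<longlonglongrightarrow> integral {0..pi} ?g"
  proof (rule dominated_convergence(2)[where h = "\<lambda>_. 1"])
    show "(\<lambda>\<theta>. exp (- (x * (max 0 (X k) * sin \<theta>)))) integrable_on {0..pi}" for k
      by (intro integrable_continuous_interval continuous_intros)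
    show "norm (exp (- (x * (max 0 (X k) * sin \<theta>)))) \<le> 1" if "\<theta> \<in> {0..pi}" for k \<theta>
      using x that by (auto intro!: mult_nonneg_nonneg sin_ge_zero)
    fix \<theta> assume th: "\<theta> \<in> {0..pi}"
    show "(\<lambda>k. exp (- (x * (max 0 (X k) * sin \<theta>)))) \<longlonglongrightarrow> ?g \<theta>"
    proof (cases "\<theta> \<in> {0, pi}")
      case False
      then have s: "sin \<theta> > 0" using th by (intro sin_gt_zero) auto
      have "filterlim (\<lambda>k. X k * (x * sin \<theta>)) at_top sequentially"
        using s x by (intro filterlim_at_top_mult_tendsto_pos[OF tendsto_const _ X]) auto
      moreover have "\<forall>\<^sub>F k in sequentially. X k * (x * sin \<theta>) \<le> x * (max 0 (X k) * sin \<theta>)"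
        using s x by (intro always_eventually allI) (auto simp: mult_ac intro!: mult_left_mono)
      ultimately have "filterlim (\<lambda>k. x * (max 0 (X k) * sin \<theta>)) at_top sequentially"
        by (rule filterlim_at_top_mono)
      then have "(\<lambda>k. exp (- (x * (max 0 (X k) * sin \<theta>)))) \<longlonglongrightarrow> 0"
        by (intro filterlim_compose[OF exp_at_bot] filterlim_compose[OF filterlim_uminus_at_bot_at_top])
      then show ?thesis using False by auto
    qed auto
  qed (auto)
  moreover have "integral {0..pi} ?g = integral {0..pi} (\<lambda>_. 0)"
    by (rule integral_spike[of "{0, pi}"]) auto
  moreover have "\<forall>\<^sub>F n in sequentially. integral {0..pi} (\<lambda>\<theta>. exp (- (x * (max 0 (X n) * sin \<theta>))))
      = integral {0..pi} (\<lambda>\<theta>. exp (- (x * (X n * sin \<theta>))))"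
  proof -
    have "\<forall>\<^sub>F n in sequentially. 0 \<le> X n" using X by (simp add: filterlim_at_top)
    then show ?thesis by eventually_elim (simp only: max.absorb2)
  qed
  ultimately show "(\<lambda>n. integral {0..pi} (\<lambda>\<theta>. exp (- (x * (X n * sin \<theta>))))) \<longlonglongrightarrow> 0"
    by (simp add: tendsto_cong)
qed

text \<open>On an arc the part \<open>c / z\<close> of the integrand contributes exactly \<open>\<i> * (\<beta> - \<alpha>) * c\<close>. The rest
  vanishes in the limit: the term with \<open>E\<close> by Jordan's lemma, which needs the upper half-plane, and
  the term with \<open>D\<close> because the arc has length proportional to \<open>R\<close>.\<close>

lemma primitive_arc_limit:
  assumes prim: "\<And>z. z \<in> S \<Longrightarrow> (\<Phi> has_field_derivative h z) (at z within S)"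
    and S: "\<And>\<theta> R. \<theta> \<in> {\<alpha>..\<beta>} \<Longrightarrow> R \<ge> 1 \<Longrightarrow> of_real R * cis \<theta> \<in> S"
    and ab: "\<alpha> \<le> \<beta>" and x: "x > 0"
    and E: "E \<ge> 0" "E = 0 \<or> 0 \<le> \<alpha> \<and> \<beta> \<le> pi"
    and bd: "\<And>R \<theta>. R \<ge> 1 \<Longrightarrow> \<theta> \<in> {\<alpha>..\<beta>} \<Longrightarrow>
        norm (h (of_real R * cis \<theta>) - c / (of_real R * cis \<theta>)) \<le> E / R * exp (- (x * (R * sin \<theta>))) + D / R\<^sup>2"
  shows "((\<lambda>R. \<Phi> (of_real R * cis \<beta>) - \<Phi> (of_real R * cis \<alpha>)) \<longlongrightarrow> \<i> * of_real (\<beta> - \<alpha>) * c) at_top"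
proof -
  let ?E = "\<lambda>R \<theta>. exp (- (x * (R * sin \<theta>)))"
  let ?J = "\<lambda>R. integral {0..pi} (?E R)"
  have "((\<lambda>R. \<Phi> (of_real R * cis \<beta>) - \<Phi> (of_real R * cis \<alpha>) - \<i> * of_real (\<beta> - \<alpha>) * c) \<longlongrightarrow> 0) at_top"
  proof (rule Lim_null_comparison)
    have "((\<lambda>R. D / R * (\<beta> - \<alpha>)) \<longlongrightarrow> 0) at_top" by real_asymp
    with tendsto_mult_left[OF jordan_integral_tendsto_0[OF x], of E]
    have "((\<lambda>R. E * ?J R + D / R * (\<beta> - \<alpha>)) \<longlongrightarrow> E * 0 + 0) at_top" by (rule tendsto_add)
    then show "((\<lambda>R. E * ?J R + D / R * (\<beta> - \<alpha>)) \<longlongrightarrow> 0) at_top" by simp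
    show "\<forall>\<^sub>F R in at_top. norm (\<Phi> (of_real R * cis \<beta>) - \<Phi> (of_real R * cis \<alpha>) - \<i> * of_real (\<beta> - \<alpha>) * c)
        \<le> E * ?J R + D / R * (\<beta> - \<alpha>)"
      using eventually_ge_at_top[of 1]
    proof eventually_elim
      case (elim R)
      let ?z = "\<lambda>\<theta>. of_real R * cis \<theta> :: complex"
      have "((\<lambda>\<theta>. \<i> * of_real R * cis \<theta> * h (?z \<theta>)) has_integral (\<Phi> (?z \<beta>) - \<Phi> (?z \<alpha>))) {\<alpha>..\<beta>}"
        by (rule integral_primitive_arc[OF prim]) (use S elim ab in auto)
      moreover have "((\<lambda>\<theta>. \<i> * c) has_integral (\<beta> - \<alpha>) *\<^sub>R (\<i> * c)) {\<alpha>..\<beta>}"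
        using ab has_integral_const_real[of "\<i> * c" \<alpha> \<beta>] by (simp add: content_real_if)
      ultimately have I: "((\<lambda>\<theta>. \<i> * of_real R * cis \<theta> * h (?z \<theta>) - \<i> * c) has_integral
          (\<Phi> (?z \<beta>) - \<Phi> (?z \<alpha>) - (\<beta> - \<alpha>) *\<^sub>R (\<i> * c))) {\<alpha>..\<beta>}"
        by (rule has_integral_diff)
      have "norm (\<Phi> (?z \<beta>) - \<Phi> (?z \<alpha>) - (\<beta> - \<alpha>) *\<^sub>R (\<i> * c)) \<le> integral {\<alpha>..\<beta>} (\<lambda>\<theta>. E * ?E R \<theta> + D / R)"
        unfolding integral_unique[OF I, symmetric]
      proof (rule integral_norm_bound_integral)
        show "(\<lambda>\<theta>. E * ?E R \<theta> + D / R) integrable_on {\<alpha>..\<beta>}"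
          by (intro integrable_continuous_interval continuous_intros)
        fix \<theta> assume th: "\<theta> \<in> {\<alpha>..\<beta>}"
        have "\<i> * of_real R * cis \<theta> * h (?z \<theta>) - \<i> * c = \<i> * ?z \<theta> * (h (?z \<theta>) - c / ?z \<theta>)"
          using elim by (simp add: field_simps)
        then have "norm (\<i> * of_real R * cis \<theta> * h (?z \<theta>) - \<i> * c) = R * norm (h (?z \<theta>) - c / ?z \<theta>)"
          using elim by (simp add: norm_mult)
        also have "\<dots> \<le> R * (E / R * ?E R \<theta> + D / R\<^sup>2)"
          by (rule mult_left_mono[OF bd]) (use elim th in auto)
        also have "\<dots> = E * ?E R \<theta> + D / R" using elim by (simp add: field_simps power2_eq_square)
        finally show "norm (\<i> * of_real R * cis \<theta> * h (?z \<theta>) - \<i> * c) \<le> E * ?E R \<theta> + D / R" .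
      qed (use I in blast)
      also have "\<dots> = E * integral {\<alpha>..\<beta>} (?E R) + D / R * (\<beta> - \<alpha>)"
        using ab by (subst integral_add) (auto intro!: integrable_continuous_interval continuous_intros)
      also have "E * integral {\<alpha>..\<beta>} (?E R) \<le> E * ?J R"
      proof (cases "E = 0")
        case False
        then show ?thesis
          by (intro mult_left_mono integral_subset_le)
             (use E ab in \<open>auto intro!: integrable_continuous_interval continuous_intros\<close>)
      qed auto
      finally show ?case by (simp add: scaleR_conv_of_real mult_ac)
    qed
  qed
  then show ?thesis by (simp add: LIM_zero_iff)
qed

corollary jordan_arc:
  assumes prim: "\<And>z. z \<in> S \<Longrightarrow> (\<Phi> has_field_derivative h z) (at z within S)"
    and S: "\<And>\<theta> R. \<theta> \<in> {\<alpha>..\<beta>} \<Longrightarrow> R \<ge> 1 \<Longrightarrow> of_real R * cis \<theta> \<in> S"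
    and ab: "0 \<le> \<alpha>" "\<alpha> \<le> \<beta>" "\<beta> \<le> pi" and x: "x > 0"
    and bd: "\<And>R \<theta>. R \<ge> 1 \<Longrightarrow> \<theta> \<in> {\<alpha>..\<beta>} \<Longrightarrow> norm (h (of_real R * cis \<theta>)) \<le> C / R * exp (- (x * (R * sin \<theta>)))"
  shows "((\<lambda>R. \<Phi> (of_real R * cis \<beta>) - \<Phi> (of_real R * cis \<alpha>)) \<longlongrightarrow> 0) at_top"
proof -
  have "C \<ge> 0"
    using order_trans[OF norm_ge_zero bd[of 1 \<alpha>]] ab by (auto simp: zero_le_mult_iff)
  then show ?thesis
    using primitive_arc_limit[OF prim S ab(2) x, of C 0 0] ab bd by simp
qed

text \<open>Between two neighbouring sectors \<open>D\<^sub>2\<^sub>p\<^sup>+\<close> a primitive \<open>\<Phi>\<close> of \<open>h\<close> has, by Jordan's lemma, the same limit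
  \<open>L p\<close> along all directions. The integral over the boundary of \<open>D\<^sub>2\<^sub>p\<^sup>+\<close> is therefore
  \<open>L (p - 1) - L p\<close>, and the sum telescopes to \<open>L 0 - L j\<close>, the integral over the line.\<close>

lemma line_integral_eq_sector_integrals:
  fixes h :: "complex \<Rightarrow> complex"
  assumes holo: "h holomorphic_on UNIV" and x: "x > 0"
    and bd: "\<And>p R \<theta>. p \<le> j \<Longrightarrow> R \<ge> 1 \<Longrightarrow>
        2 * real p * pi / real (2 * j + 1) \<le> \<theta> \<Longrightarrow> \<theta> \<le> (2 * real p + 1) * pi / real (2 * j + 1) \<Longrightarrow>
        norm (h (of_real R * cis \<theta>)) \<le> C / R * exp (- (x * (R * sin \<theta>)))"
  shows "((\<lambda>k. h (of_real k)) has_integral (\<Sum>p=1..j. sector_integral j p h)) UNIV"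
proof -
  let ?I = "\<lambda>R \<theta>. integral {0..R} (\<lambda>r. h (of_real r * cis \<theta>) * cis \<theta>)"
  let ?J = "\<lambda>\<theta>. integral {0..} (\<lambda>r. h (of_real r * cis \<theta>) * cis \<theta>)"
  have hc: "continuous_on S h" for S
    using holo holomorphic_on_imp_continuous_on continuous_on_subset by blast
  obtain \<Phi> where \<Phi>: "\<And>z. z \<in> UNIV \<Longrightarrow> (\<Phi> has_field_derivative h z) (at z within UNIV)"
    using holomorphic_convex_primitive'[OF convex_UNIV open_UNIV holo] by blast
  define m where "m = real (2 * j + 1)"
  have m: "m > 0" "m \<ge> 1" by (auto simp: m_def)
  define lo where "lo p = 2 * real p * pi / m" for p :: nat
  define hi where "hi p = (2 * real p + 1) * pi / m" for p :: nat
  \<comment> \<open>Interior directions, where decay is exponential; the end directions may be the real axis.\<close>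
  define mid where "mid p = (2 * real p + 1 / 2) * pi / m" for p :: nat
  have angles: "0 \<le> lo p" "lo p < mid p" "mid p < hi p" "hi p \<le> pi" if "p \<le> j" for p
  proof -
    have "hi p \<le> (2 * real j + 1) * pi / m" unfolding hi_def
      using m that by (intro divide_right_mono mult_right_mono) auto
    also have "\<dots> = pi" using m by (simp add: m_def add.commute)
    finally show "hi p \<le> pi" .
    show "0 \<le> lo p" using m by (simp add: lo_def)
    show "lo p < mid p" "mid p < hi p" unfolding lo_def mid_def hi_def
      using m by (intro divide_strict_right_mono mult_strict_right_mono; simp)+
  qed
  have bd': "norm (h (of_real R * cis \<theta>)) \<le> C / R * exp (- (x * (R * sin \<theta>)))"
    if "p \<le> j" "R \<ge> 1" "\<theta> \<in> {lo p..hi p}" for p R \<theta>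
    using bd[OF that(1,2), of \<theta>] that(3) by (simp add: lo_def hi_def m_def)
  have C: "C \<ge> 0"
    using order_trans[OF norm_ge_zero bd'[of 0 1 "mid 0"]] angles[of 0] by (auto simp: zero_le_mult_iff)
  have ray: "((\<lambda>R. \<Phi> (of_real R * cis \<theta>)) \<longlongrightarrow> \<Phi> 0 + ?J \<theta>) at_top"
    if p: "p \<le> j" and th: "\<theta> \<in> {lo p..hi p}" and th': "0 < \<theta>" "\<theta> < pi" for p \<theta>
  proof -
    have s: "sin \<theta> > 0" using th' by (rule sin_gt_zero)
    have cont: "continuous_on T (\<lambda>r. h (of_real r * cis \<theta>))" for T
      by (intro continuous_on_compose2[OF hc[of UNIV]] continuous_intros) auto
    have "compact ((\<lambda>r. h (of_real r * cis \<theta>)) ` {0..1})"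
      by (intro compact_continuous_image cont) auto
    then obtain D where D: "\<And>r. r \<in> {0..1} \<Longrightarrow> norm (h (of_real r * cis \<theta>)) \<le> D"
      by (meson bounded_iff compact_imp_bounded imageI)
    define C1 where "C1 = max C (D * exp (x * sin \<theta>))"
    have "norm (h (of_real r * cis \<theta>)) \<le> C1 * (1 + r) ^ 0 * exp (- (x * (r * sin \<theta>)))" if r: "r \<ge> 0" for r
    proof (cases "r \<le> 1")
      case True
      have D0: "D \<ge> 0" using order_trans[OF norm_ge_zero D[of 0]] by auto
      have "norm (h (of_real r * cis \<theta>)) \<le> D * 1" using D True r by simp
      also have "\<dots> \<le> D * exp (x * sin \<theta> + - (x * (r * sin \<theta>)))"
        using D0 x s True by (intro mult_left_mono) auto
      also have "\<dots> = D * exp (x * sin \<theta>) * exp (- (x * (r * sin \<theta>)))" by (simp only: exp_add mult.assoc)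
      also have "\<dots> \<le> C1 * exp (- (x * (r * sin \<theta>)))" by (intro mult_right_mono) (auto simp: C1_def)
      finally show ?thesis by simp
    next
      case False
      have "norm (h (of_real r * cis \<theta>)) \<le> C / r * exp (- (x * (r * sin \<theta>)))"
        using bd'[OF p _ th] False by simp
      also have "\<dots> \<le> C1 * exp (- (x * (r * sin \<theta>)))"
        using C False by (intro mult_right_mono) (auto simp: C1_def divide_le_eq intro: order_trans[OF _ mult_left_mono[of 1 r]] max.coboundedI1)
      finally show ?thesis by simp
    qed
    then have "((\<lambda>R. ?I R \<theta>) \<longlongrightarrow> ?J \<theta>) at_top"
      by (intro ray_decay_integrable(2)[OF cont _ x s]) 
    then have "((\<lambda>R. \<Phi> 0 + ?I R \<theta>) \<longlongrightarrow> \<Phi> 0 + ?J \<theta>) at_top"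
      by (intro tendsto_intros)
    moreover have "\<forall>\<^sub>F R in at_top. \<Phi> 0 + ?I R \<theta> = \<Phi> (of_real R * cis \<theta>)"
      using eventually_ge_at_top[of 0]
    proof eventually_elim
      case (elim R)
      show ?case using integral_unique[OF integral_primitive_ray[OF \<Phi> _ elim, of \<theta>]] by simp
    qed
    ultimately show ?thesis by (rule Lim_transform_eventually)
  qed
  define L where "L p = \<Phi> 0 + ?J (mid p)" for p
  have Lmid: "((\<lambda>R. \<Phi> (of_real R * cis (mid p))) \<longlongrightarrow> L p) at_top" if "p \<le> j" for p
    unfolding L_def using ray[of p "mid p"] angles[OF that] that by auto
  have Llim: "((\<lambda>R. \<Phi> (of_real R * cis \<theta>)) \<longlongrightarrow> L p) at_top" if p: "p \<le> j" and th: "\<theta> \<in> {lo p..hi p}" for p \<theta>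
  proof (cases "\<theta> \<le> mid p")
    case True
    have "((\<lambda>R. \<Phi> (of_real R * cis (mid p)) - \<Phi> (of_real R * cis \<theta>)) \<longlongrightarrow> 0) at_top"
      by (rule jordan_arc[OF \<Phi> _ _ True _ x bd'[OF p]]) (use th angles[OF p] in auto)
    from tendsto_diff[OF Lmid[OF p] this] show ?thesis by simp
  next
    case False
    then have le: "mid p \<le> \<theta>" by simp
    have "((\<lambda>R. \<Phi> (of_real R * cis \<theta>) - \<Phi> (of_real R * cis (mid p))) \<longlongrightarrow> 0) at_top"
      by (rule jordan_arc[OF \<Phi> _ _ le _ x bd'[OF p]]) (use th angles[OF p] in auto)
    from tendsto_add[OF Lmid[OF p] this] show ?thesis by simp
  qed
  \<comment> \<open>The lower ray of \<open>D\<^sub>2\<^sub>p\<^sup>+\<close> bounds the preceding odd sector, the upper ray the following one.\<close>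
  have sect: "sector_integral j p h = L (p - 1) - L p" if p: "p \<in> {1..j}" for p
  proof -
    have e1: "arg_lo j p = hi (p - 1)" and e2: "arg_hi j p = lo p"
      using p by (auto simp: arg_lo_def arg_hi_def hi_def lo_def m_def of_nat_diff)
    have pj: "p - 1 \<le> j" "p \<le> j" using p by auto
    have "\<Phi> 0 + ?J (hi (p - 1)) = L (p - 1)"
    proof (rule tendsto_unique[OF trivial_limit_at_top_linorder ray[OF pj(1)] Llim[OF pj(1)]])
      have "hi (p - 1) < lo p" unfolding hi_def lo_def using p m
        by (intro divide_strict_right_mono mult_strict_right_mono) (auto simp: of_nat_diff)
      then show "0 < hi (p - 1)" "hi (p - 1) < pi" using angles[OF pj(1)] angles[OF pj(2)] by auto
    qed (use pj angles[OF pj(1)] in auto)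
    moreover have "\<Phi> 0 + ?J (lo p) = L p"
    proof (rule tendsto_unique[OF trivial_limit_at_top_linorder ray[OF pj(2)] Llim[OF pj(2)]])
      show "0 < lo p" "lo p < pi" using angles[OF pj(2)] p m by (auto simp: lo_def)
    qed (use pj angles[OF pj(2)] in auto)
    ultimately have "?J (hi (p - 1)) - 
       ?J (lo p) = L (p - 1) - L p"
      by (metis add_diff_cancel_left)
    then show ?thesis by (simp add: sector_integral_def e1 e2)
  qed
  have "(\<Sum>p=1..j. sector_integral j p h) = (\<Sum>p=1..j. L (p - 1) - L p)" by (rule sum.cong) (auto simp: sect)
  also have "\<dots> = L 0 - L j"
    by (induction j) auto
  finally have sum: "(\<Sum>p=1..j. sector_integral j p h) = (L 0 - \<Phi> 0) + (\<Phi> 0 - L j)" by simp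
  note FTC = integral_primitive_real[OF \<Phi> UNIV_I]
  show ?thesis unfolding sum
  proof (rule has_integral_UNIV_limits)
    show "(\<lambda>k. h (of_real k)) integrable_on {0..R}" "(\<lambda>k. h (of_real k)) integrable_on {-R..0}" for R
      by (intro integrable_continuous_interval continuous_on_compose2[OF hc[of UNIV]] continuous_intros; simp)+
    have "((\<lambda>R. \<Phi> (of_real R * cis 0) - \<Phi> 0) \<longlongrightarrow> L 0 - \<Phi> 0) at_top"
      by (intro tendsto_intros Llim) (use angles[of 0] in \<open>auto simp: lo_def\<close>)
    then show "((\<lambda>R. integral {0..R} (\<lambda>k. h (of_real k))) \<longlongrightarrow> L 0 - \<Phi> 0) at_top"
      by (rule Lim_transform_eventually)
         (use eventually_ge_at_top[of 0] in \<open>eventually_elim, simp add: integral_unique[OF FTC]\<close>)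
    have "((\<lambda>R. \<Phi> 0 - \<Phi> (of_real R * cis pi)) \<longlongrightarrow> \<Phi> 0 - L j) at_top"
    proof (intro tendsto_intros Llim)
      have "hi j = pi" using m by (simp add: hi_def m_def add.commute)
      then show "pi \<in> {lo j..hi j}" using angles[of j] by simp
    qed simp
    then show "((\<lambda>R. integral {-R..0} (\<lambda>k. h (of_real k))) \<longlongrightarrow> \<Phi> 0 - L j) at_top"
    proof (rule Lim_transform_eventually)
      show "\<forall>\<^sub>F R in at_top. \<Phi> 0 - \<Phi> (of_real R * cis pi) = integral {-R..0} (\<lambda>k. h (of_real k))"
        using eventually_ge_at_top[of 0]
      proof eventually_elim
        case (elim R)
        then show ?case using integral_unique[OF FTC[of "-R" 0]] by simp
      qed
    qed
  qed
qed

section \<open>The half-line Fourier transform\<close>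

lemma holomorphic_exp_integral:
  fixes w g :: "real \<Rightarrow> complex"
  assumes w: "continuous_on {a..b} w" and g: "continuous_on {a..b} g"
  shows "(\<lambda>k. integral {a..b} (\<lambda>y. exp (k * w y) * g y)) holomorphic_on UNIV"
proof -
  have "(\<lambda>k. integral (cbox a b) (\<lambda>y. exp (k * w y) * g y)) holomorphic_on UNIV"
  proof (rule leibniz_rule_holomorphic[where fx = "\<lambda>k y. w y * exp (k * w y) * g y"])
    show "((\<lambda>x. exp (x * w t) * g t) has_field_derivative w t * exp (x * w t) * g t) (at x within UNIV)" for x t
      by (auto intro!: derivative_eq_intros)
    show "(\<lambda>y. exp (x * w y) * g y) integrable_on cbox a b" for x
      by (intro integrable_continuous continuous_intros) (use w g in auto)
    have "continuous_on (UNIV \<times> cbox a b) (\<lambda>p. w (snd p) * exp (fst p * w (snd p)) * g (snd p))"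
      by (intro continuous_intros continuous_on_compose2[OF w] continuous_on_compose2[OF g]) auto
    then show "continuous_on (UNIV \<times> cbox a b) (\<lambda>(x, t). w t * exp (x * w t) * g t)"
      by (simp add: case_prod_unfold)
  qed auto
  then show ?thesis by simp
qed

lemma norm_fourier_kernel: "norm (exp (- \<i> * k * of_real y)) = exp (y * Im k)"
  by (simp add: norm_exp_eq_Re mult.commute)

lemma norm_fourier_kernel_le_1: "Im k \<le> 0 \<Longrightarrow> y \<ge> 0 \<Longrightarrow> norm (exp (- \<i> * k * of_real y)) \<le> 1"
  unfolding norm_fourier_kernel by (simp add: mult_nonneg_nonpos)

locale half_line_decay =
  fixes g :: "real \<Rightarrow> complex" and C :: real
  assumes cont: "continuous_on {0..} g"
    and decay: "\<And>y. y \<ge> 0 \<Longrightarrow> norm (g y) \<le> C / (1 + y)\<^sup>2"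
begin

lemma C_nonneg: "C \<ge> 0"
  using order_trans[OF norm_ge_zero decay[of 0]] by simp

lemma kernel_cont: "continuous_on {0..} (\<lambda>y. exp (- \<i> * k * of_real y) * g y)"
  by (intro continuous_intros cont)

lemma kernel_decay:
  assumes "Im k \<le> 0" "y \<ge> 0"
  shows "norm (exp (- \<i> * k * of_real y) * g y) \<le> C / (1 + y)\<^sup>2"
proof -
  have "norm (exp (- \<i> * k * of_real y) * g y) \<le> 1 * (C / (1 + y)\<^sup>2)"
    unfolding norm_mult
    by (rule mult_mono[OF norm_fourier_kernel_le_1[OF assms] decay[OF assms(2)]]) auto
  then show ?thesis by simp
qed

lemma half_fourier_tail:
  assumes "Im k \<le> 0" "X \<ge> 0"
  shows "norm (integral {0..X} (\<lambda>y. exp (- \<i> * k * of_real y) * g y) - half_fourier g k) \<le> C / (1 + X)"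
  unfolding half_fourier_def
  by (rule inverse_square_decay_tail[OF assms(2) kernel_cont kernel_decay[OF assms(1)]])

lemma half_fourier_limit:
  assumes "Im k \<le> 0"
  shows "((\<lambda>X. integral {0..X} (\<lambda>y. exp (- \<i> * k * of_real y) * g y)) \<longlongrightarrow> half_fourier g k) at_top"
  unfolding half_fourier_def
  by (rule inverse_square_decay_limit[OF kernel_cont kernel_decay[OF assms]])

lemma half_fourier_bounded: "Im k \<le> 0 \<Longrightarrow> norm (half_fourier g k) \<le> C"
  using half_fourier_tail[of k 0] by simp

lemma holomorphic_truncation: "(\<lambda>k. integral {0..X} (\<lambda>y. exp (- \<i> * k * of_real y) * g y)) holomorphic_on UNIV"
proof -
  have "continuous_on {0..X} g" by (rule continuous_on_subset[OF cont]) auto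
  then have "(\<lambda>k. integral {0..X} (\<lambda>y. exp (k * (- \<i> * of_real y)) * g y)) holomorphic_on UNIV"
    by (intro holomorphic_exp_integral continuous_intros)
  then show ?thesis by (simp add: mult_ac)
qed

lemma uniform_limit_truncation:
  "uniform_limit {k. Im k \<le> 0} (\<lambda>n k. integral {0..real n} (\<lambda>y. exp (- \<i> * k * of_real y) * g y))
     (half_fourier g) sequentially"
proof (rule uniform_limitI)
  fix e :: real assume e: "e > 0"
  have "((\<lambda>n. C / (1 + real n)) \<longlongrightarrow> 0) sequentially" by real_asymp
  then have "\<forall>\<^sub>F n in sequentially. C / (1 + real n) < e" using e by (simp add: order_tendsto_iff)
  then show "\<forall>\<^sub>F n in sequentially. \<forall>k\<in>{k. Im k \<le> 0}.
      dist (integral {0..real n} (\<lambda>y. exp (- \<i> * k * of_real y) * g y)) (half_fourier g k) < e"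
  proof eventually_elim
    case (elim n)
    show ?case
    proof
      fix k :: complex assume "k \<in> {k. Im k \<le> 0}"
      then have "norm (integral {0..real n} (\<lambda>y. exp (- \<i> * k * of_real y) * g y) - half_fourier g k) \<le> C / (1 + real n)"
        by (intro half_fourier_tail) auto
      with elim show "dist (integral {0..real n} (\<lambda>y. exp (- \<i> * k * of_real y) * g y)) (half_fourier g k) < e"
        unfolding dist_norm by (rule order.strict_trans1[rotated])
    qed
  qed
qed

lemma continuous_on_half_fourier: "continuous_on {k. Im k \<le> 0} (half_fourier g)"
proof (rule uniform_limit_theorem[OF _ uniform_limit_truncation])
  show "\<forall>\<^sub>F n in sequentially. continuous_on {k. Im k \<le> 0} (\<lambda>k. integral {0..real n} (\<lambda>y. exp (- \<i> * k * of_real y) * g y))"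
    by (intro always_eventually allI continuous_on_subset[OF holomorphic_on_imp_continuous_on[OF holomorphic_truncation]]) simp
qed simp

lemma holomorphic_half_fourier: "half_fourier g holomorphic_on {k. Im k < 0}"
proof (rule holomorphic_uniform_sequence)
  show "open {k. Im k < 0}" by (rule open_halfspace_Im_lt)
  show "(\<lambda>k. integral {0..real n} (\<lambda>y. exp (- \<i> * k * of_real y) * g y)) holomorphic_on {k. Im k < 0}" for n
    by (rule holomorphic_on_subset[OF holomorphic_truncation]) auto
  fix k :: complex assume "k \<in> {k. Im k < 0}"
  then obtain d where d: "d > 0" "cball k d \<subseteq> {k. Im k < 0}"
    using open_contains_cball[of "{k. Im k < 0}"] open_halfspace_Im_lt by blast
  then show "\<exists>d>0. cball k d \<subseteq> {k. Im k < 0} \<and>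
      uniform_limit (cball k d) (\<lambda>n k. integral {0..real n} (\<lambda>y. exp (- \<i> * k * of_real y) * g y)) (half_fourier g) sequentially"
    by (intro exI[of _ d] conjI uniform_limit_on_subset[OF uniform_limit_truncation]) auto
qed

lemma shifted_decay: "x \<ge> 0 \<Longrightarrow> half_line_decay (\<lambda>y. g (x + y)) C"
proof
  assume x: "x \<ge> 0"
  show "continuous_on {0..} (\<lambda>y. g (x + y))"
    by (intro continuous_on_compose2[OF cont] continuous_intros) (use x in auto)
  fix y :: real assume y: "y \<ge> 0"
  have "norm (g (x + y)) \<le> C / (1 + (x + y))\<^sup>2" using x y by (intro decay) auto
  also have "\<dots> \<le> C / (1 + y)\<^sup>2"
    using x y C_nonneg by (intro divide_left_mono power_mono) auto
  finally show "norm (g (x + y)) \<le> C / (1 + y)\<^sup>2" .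
qed

text \<open>Cutting at \<open>x\<close> separates an entire function, which is bounded in the upper half-plane, from the
  transform of a translate of \<open>g\<close>, which is bounded in the lower half-plane.\<close>

lemma half_fourier_split:
  assumes k: "Im k \<le> 0" and x: "x \<ge> 0"
  shows "exp (\<i> * k * of_real x) * half_fourier g k =
     exp (\<i> * k * of_real x) * integral {0..x} (\<lambda>y. exp (- \<i> * k * of_real y) * g y) + half_fourier (\<lambda>y. g (x + y)) k"
proof -
  interpret s: half_line_decay "\<lambda>y. g (x + y)" C by (rule shifted_decay[OF x])
  let ?f = "\<lambda>y. exp (- \<i> * k * of_real y) * g y"
  have int: "?f integrable_on {a..b}" if "a \<ge> 0" for a b
    by (rule integrable_continuous_interval) (rule continuous_on_subset[OF kernel_cont], use that in auto)
  have "((\<lambda>R. integral {0..x} ?f + exp (- \<i> * k * of_real x) * integral {0..R} (\<lambda>y. exp (- \<i> * k * of_real y) * g (x + y))) \<longlongrightarrow>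
      integral {0..x} ?f + exp (- \<i> * k * of_real x) * half_fourier (\<lambda>y. g (x + y)) k) at_top"
    by (intro tendsto_intros s.half_fourier_limit k)
  moreover have "\<forall>\<^sub>F R in at_top. integral {0..x} ?f + exp (- \<i> * k * of_real x) * integral {0..R} (\<lambda>y. exp (- \<i> * k * of_real y) * g (x + y))
      = integral {0..x + R} ?f"
    using eventually_ge_at_top[of 0]
  proof eventually_elim
    case (elim R)
    have "(?f has_integral integral {x..x+R} ?f) (cbox x (x + R))" using int[of x "x + R"] x by (simp add: integrable_integral del: integral_mult_right integral_mult_left)
    from has_integral_affinity'[OF this, of 1 x]
    have "((\<lambda>y. ?f (y + x)) has_integral integral {x..x+R} ?f) {0..R}" by simp
    then have "integral {x..x+R} ?f = integral {0..R} (\<lambda>y. ?f (y + x))" by (simp add: integral_unique)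
    also have "\<dots> = integral {0..R} (\<lambda>y. exp (- \<i> * k * of_real x) * (exp (- \<i> * k * of_real y) * g (x + y)))"
    proof (rule integral_cong)
      fix y :: real
      have "- \<i> * k * of_real (y + x) = - \<i> * k * of_real x + - \<i> * k * of_real y" by (simp add: algebra_simps)
      then have "exp (- \<i> * k * of_real (y + x)) = exp (- \<i> * k * of_real x) * exp (- \<i> * k * of_real y)"
        by (simp only: exp_add)
      then show "?f (y + x) = exp (- \<i> * k * of_real x) * (exp (- \<i> * k * of_real y) * g (x + y))"
        by (simp only: mult.assoc add.commute)
    qed
    also have "\<dots> = exp (- \<i> * k * of_real x) * integral {0..R} (\<lambda>y. exp (- \<i> * k * of_real y) * g (x + y))"
      by (rule integral_mult_right)
    finally show ?case
      using Henstock_Kurzweil_Integration.integral_combine[of 0 x "x + R" ?f] x elim int[of 0 "x + R"] by simp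
  qed
  ultimately have "((\<lambda>R. integral {0..x + R} ?f) \<longlongrightarrow>
      integral {0..x} ?f + exp (- \<i> * k * of_real x) * half_fourier (\<lambda>y. g (x + y)) k) at_top"
    by (rule Lim_transform_eventually)
  moreover have "((\<lambda>R. integral {0..x + R} ?f) \<longlongrightarrow> half_fourier g k) at_top"
    by (rule filterlim_compose[OF half_fourier_limit[OF k]]) real_asymp
  ultimately have "half_fourier g k = integral {0..x} ?f + exp (- \<i> * k * of_real x) * half_fourier (\<lambda>y. g (x + y)) k"
    using tendsto_unique trivial_limit_at_top_linorder by blast
  then show ?thesis by (simp add: algebra_simps exp_minus)
qed

end

text \<open>Integration by parts without division, so that it also holds at \<open>k = 0\<close>.\<close>

lemma fourier_integral_of_derivative:
  fixes g g' :: "real \<Rightarrow> complex"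
  assumes d: "\<And>y. y \<in> {a..b} \<Longrightarrow> (g has_vector_derivative g' y) (at y within {a..b})"
    and c: "continuous_on {a..b} g'" and ab: "a \<le> b"
  shows "integral {a..b} (\<lambda>y. exp (- \<i> * k * of_real y) * g' y) =
     exp (- \<i> * k * of_real b) * g b - exp (- \<i> * k * of_real a) * g a
       + \<i> * k * integral {a..b} (\<lambda>y. exp (- \<i> * k * of_real y) * g y)"
proof -
  let ?e = "\<lambda>y. exp (- \<i> * k * of_real y)"
  have gc: "continuous_on {a..b} g"
    by (rule continuous_on_vector_derivative[OF d])
  have "((\<lambda>y. - \<i> * k * ?e y * g y + ?e y * g' y) has_integral (?e b * g b - ?e a * g a)) {a..b}"
  proof (rule fundamental_theorem_of_calculus[OF ab])
    fix y assume y: "y \<in> {a..b}"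
    have "(?e has_vector_derivative (- \<i> * k * ?e y)) (at y within {a..b})"
      by (rule has_vector_derivative_real_field) (auto intro!: derivative_eq_intros)
    from has_vector_derivative_mult[OF this d[OF y]]
    show "((\<lambda>y. ?e y * g y) has_vector_derivative (- \<i> * k * ?e y * g y + ?e y * g' y)) (at y within {a..b})"
      by (simp add: algebra_simps)
  qed
  moreover have "(\<lambda>y. ?e y * g y) integrable_on {a..b}" "(\<lambda>y. ?e y * g' y) integrable_on {a..b}"
    by (intro integrable_continuous_interval continuous_intros gc c)+
  then have "((\<lambda>y. - \<i> * k * (?e y * g y) + ?e y * g' y) has_integral
      (- \<i> * k * integral {a..b} (\<lambda>y. ?e y * g y) + integral {a..b} (\<lambda>y. ?e y * g' y))) {a..b}"
    by (intro has_integral_add has_integral_mult_right integrable_integral)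
  ultimately have "?e b * g b - ?e a * g a = - \<i> * k * integral {a..b} (\<lambda>y. ?e y * g y) + integral {a..b} (\<lambda>y. ?e y * g' y)"
    by (simp add: mult.assoc has_integral_unique del: integral_mult_left integral_mult_right)
  then show ?thesis by (simp add: algebra_simps del: integral_mult_left integral_mult_right)
qed

corollary fourier_integral_by_parts:
  fixes g g' :: "real \<Rightarrow> complex"
  assumes "\<And>y. y \<in> {a..b} \<Longrightarrow> (g has_vector_derivative g' y) (at y within {a..b})"
    and "continuous_on {a..b} g'" and "k \<noteq> 0" and "a \<le> b"
  shows "integral {a..b} (\<lambda>y. exp (- \<i> * k * of_real y) * g y) =
     (exp (- \<i> * k * of_real a) * g a - exp (- \<i> * k * of_real b) * g b
       + integral {a..b} (\<lambda>y. exp (- \<i> * k * of_real y) * g' y)) / (\<i> * k)"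
  using fourier_integral_of_derivative[OF assms(1,2,4), of k] assms(3)
  by (simp add: field_simps del: integral_mult_left integral_mult_right)

lemma half_fourier_by_parts:
  assumes g: "half_line_decay g C" and g': "half_line_decay g' C"
    and d: "\<And>y. y \<ge> 0 \<Longrightarrow> (g has_vector_derivative g' y) (at y within {0..})"
    and k: "Im k \<le> 0" "k \<noteq> 0"
  shows "half_fourier g k = (g 0 + half_fourier g' k) / (\<i> * k)"
proof -
  interpret g: half_line_decay g C by fact
  interpret g': half_line_decay g' C by fact
  let ?e = "\<lambda>y. exp (- \<i> * k * of_real y)"
  have "((\<lambda>X. (g 0 - ?e X * g X + integral {0..X} (\<lambda>y. ?e y * g' y)) / (\<i> * k)) \<longlongrightarrow> (g 0 - 0 + half_fourier g' k) / (\<i> * k)) at_top"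
  proof (intro tendsto_intros g'.half_fourier_limit k(1))
    show "((\<lambda>X. ?e X * g X) \<longlongrightarrow> 0) at_top"
    proof (rule Lim_null_comparison)
      show "\<forall>\<^sub>F X in at_top. norm (?e X * g X) \<le> C / (1 + X)\<^sup>2"
        using eventually_ge_at_top[of 0] by eventually_elim (rule g.kernel_decay[OF k(1)])
      show "((\<lambda>X. C / (1 + X)\<^sup>2) \<longlongrightarrow> 0) at_top" by real_asymp
    qed
  qed (use k in auto)
  moreover have "\<forall>\<^sub>F X in at_top. (g 0 - ?e X * g X + integral {0..X} (\<lambda>y. ?e y * g' y)) / (\<i> * k) = integral {0..X} (\<lambda>y. ?e y * g y)"
    using eventually_ge_at_top[of 0]
  proof eventually_elim
    case (elim X)
    have "integral {0..X} (\<lambda>y. ?e y * g y) = (?e 0 * g 0 - ?e X * g X + integral {0..X} (\<lambda>y. ?e y * g' y)) / (\<i> * k)"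
      by (rule fourier_integral_by_parts[OF _ _ k(2) elim])
         (auto intro: has_vector_derivative_within_subset[OF d] continuous_on_subset[OF g'.cont])
    then show ?case by simp
  qed
  ultimately have "((\<lambda>X. integral {0..X} (\<lambda>y. ?e y * g y)) \<longlongrightarrow> (g 0 - 0 + half_fourier g' k) / (\<i> * k)) at_top"
    by (rule Lim_transform_eventually)
  with g.half_fourier_limit[OF k(1)] show ?thesis
    using tendsto_unique trivial_limit_at_top_linorder by fastforce
qed

text \<open>Two integrations by parts; the second derivative is needed for a remainder \<open>O(k\<^sup>-\<^sup>2)\<close>.\<close>

lemma half_fourier_asymptotics:
  assumes g: "half_line_decay g C" and g': "half_line_decay g' C" and g'': "half_line_decay g'' C"
    and d: "\<And>y. y \<ge> 0 \<Longrightarrow> (g has_vector_derivative g' y) (at y within {0..})"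
    and d': "\<And>y. y \<ge> 0 \<Longrightarrow> (g' has_vector_derivative g'' y) (at y within {0..})"
    and k: "Im k \<le> 0" "k \<noteq> 0"
  shows "norm (half_fourier g k - g 0 / (\<i> * k)) \<le> 2 * C / (norm k)\<^sup>2"
proof -
  interpret g': half_line_decay g' C by fact
  interpret g'': half_line_decay g'' C by fact
  have "half_fourier g k - g 0 / (\<i> * k) = half_fourier g' k / (\<i> * k)"
    by (subst half_fourier_by_parts[OF g g' d k]) (simp_all add: add_divide_distrib)
  also have "half_fourier g' k = (g' 0 + half_fourier g'' k) / (\<i> * k)"
    by (rule half_fourier_by_parts[OF g' g'' d' k])
  finally have "norm (half_fourier g k - g 0 / (\<i> * k)) = norm (g' 0 + half_fourier g'' k) / (norm k)\<^sup>2"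
    by (simp add: norm_divide norm_mult power2_eq_square)
  also have "norm (g' 0 + half_fourier g'' k) \<le> C + C"
    by (rule order_trans[OF norm_triangle_ineq]) (use g'.decay[of 0] g''.half_fourier_bounded[OF k(1)] in auto)
  finally show ?thesis using k by (simp add: divide_right_mono)
qed

text \<open>By the asymptotics the integrand differs by \<open>O(k\<^sup>-\<^sup>2)\<close> from \<open>g 0 * exp (\<i> * k * x) / (\<i> * k)\<close>,
  hence from the derivative \<open>U'\<close> of a function \<open>U\<close> that tends to \<open>0\<close>. The denominator \<open>1 + k\<close>
  in \<open>U\<close> replaces \<open>k\<close> to avoid the singularity at the origin.\<close>

lemma one_sided_fourier_integral_converges:
  assumes g: "half_line_decay g C" and g': "half_line_decay g' C" and g'': "half_line_decay g'' C"
    and d: "\<And>y. y \<ge> 0 \<Longrightarrow> (g has_vector_derivative g' y) (at y within {0..})"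
    and d': "\<And>y. y \<ge> 0 \<Longrightarrow> (g' has_vector_derivative g'' y) (at y within {0..})"
    and x: "x > 0"
  shows "\<exists>I. ((\<lambda>R. integral {0..R} (\<lambda>k. exp (\<i> * of_real k * of_real x) * half_fourier g (of_real k))) \<longlongrightarrow> I) at_top"
proof -
  interpret g: half_line_decay g C by fact
  let ?e = "\<lambda>k::real. exp (\<i> * of_real k * of_real x)"
  define F where "F k = ?e k * half_fourier g (of_real k)" for k :: real
  define U where "U k = - (g 0 / of_real x) * (?e k / of_real (1 + k))" for k :: real
  define U' where "U' k = ?e k * (g 0 / (\<i> * of_real (1 + k)) + g 0 / of_real (x * (1 + k)\<^sup>2))" for k :: real
  have ne: "norm (?e k) = 1" for k by (simp add: norm_exp_eq_Re)
  have Fc: "continuous_on {0..} F" unfolding F_def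
    by (intro continuous_intros continuous_on_compose2[OF g.continuous_on_half_fourier]) auto
  have U'c: "continuous_on {0..} U'" unfolding U'_def
    by (intro continuous_intros) (use x in \<open>auto simp: complex_eq_iff\<close>)
  \<comment> \<open>The constant is crude: \<open>2 * C / k\<^sup>2\<close> costs \<open>8 * C\<close> for \<open>k \<ge> 1\<close>, passing from \<open>1 / k\<close> to \<open>1 / (1 + k)\<close>
      costs \<open>2 * C\<close>, and the remaining part of \<open>U'\<close> costs \<open>C / x\<close>; for \<open>k < 1\<close> all terms are bounded.\<close>
  have bound: "norm (F k - U' k) \<le> (10 * C + C / x) / (1 + k)\<^sup>2" if k: "k \<ge> 0" for k
  proof -
    have g0: "norm (g 0) \<le> C" using g.decay[of 0] by simp
    have "F k - U' k = ?e k * (half_fourier g (of_real k) - g 0 / (\<i> * of_real (1 + k)) - g 0 / of_real (x * (1 + k)\<^sup>2))"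
      by (simp add: F_def U'_def algebra_simps)
    then have "norm (F k - U' k) \<le> norm (half_fourier g (of_real k) - g 0 / (\<i> * of_real (1 + k))) + norm (g 0 / of_real (x * (1 + k)\<^sup>2))"
      by (simp only: norm_mult ne mult_1 norm_triangle_ineq4)
    also have "norm (g 0 / of_real (x * (1 + k)\<^sup>2)) \<le> C / x / (1 + k)\<^sup>2"
      using g0 x k by (simp add: norm_divide norm_mult divide_right_mono norm_power flip: of_real_add of_real_power)
    also have "norm (half_fourier g (of_real k) - g 0 / (\<i> * of_real (1 + k))) \<le> 10 * C / (1 + k)\<^sup>2"
    proof (cases "k \<ge> 1")
      case True
      have "norm (half_fourier g (of_real k) - g 0 / (\<i> * of_real (1 + k))) =
        norm ((half_fourier g (of_real k) - g 0 / (\<i> * of_real k)) + (g 0 / (\<i> * of_real k) - g 0 / (\<i> * of_real (1 + k))))"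
        by simp
      also have "\<dots> \<le> 2 * C / k\<^sup>2 + C / (k * (1 + k))"
      proof (rule norm_triangle_mono)
        show "norm (half_fourier g (of_real k) - g 0 / (\<i> * of_real k)) \<le> 2 * C / k\<^sup>2"
          using half_fourier_asymptotics[OF g g' g'' d d', of "of_real k"] True by simp
        have "g 0 / (\<i> * of_real k) - g 0 / (\<i> * of_real (1 + k)) = g 0 / (\<i> * of_real (k * (1 + k)))"
        proof -
          have "(of_real k :: complex) \<noteq> 0" "(of_real (1 + k) :: complex) \<noteq> 0" 
            using True by (simp_all only: of_real_eq_0_iff)
          then show ?thesis by (simp add: divide_simps) (simp add: algebra_simps)
        qed
        then have "norm (g 0 / (\<i> * of_real k) - g 0 / (\<i> * of_real (1 + k))) = norm (g 0) / (k * (1 + k))"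
          using True by (simp add: norm_divide norm_mult flip: of_real_add)
        then show "norm (g 0 / (\<i> * of_real k) - g 0 / (\<i> * of_real (1 + k))) \<le> C / (k * (1 + k))"
          using g0 True by (simp add: divide_right_mono)
      qed
      also have "2 * C / k\<^sup>2 \<le> 8 * C / (1 + k)\<^sup>2"
      proof -
        have "(1 + k)\<^sup>2 \<le> (2 * k)\<^sup>2" using True by (intro power_mono) auto
        then have "8 * C / (2 * k)\<^sup>2 \<le> 8 * C / (1 + k)\<^sup>2"
          using g.C_nonneg True by (intro divide_left_mono) auto
        then show ?thesis by (simp add: power_mult_distrib)
      qed
      also have "C / (k * (1 + k)) \<le> 2 * C / (1 + k)\<^sup>2"
      proof -
        have "(1 + k)\<^sup>2 \<le> 2 * (k * (1 + k))" using True mult_mono[of 1 k 1 k] by (simp add: power2_eq_square algebra_simps)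
        then have "2 * C / (2 * (k * (1 + k))) \<le> 2 * C / (1 + k)\<^sup>2"
          using g.C_nonneg True by (intro divide_left_mono) auto
        then show ?thesis by simp
      qed
      finally show ?thesis by (simp add: add_divide_distrib[symmetric])
    next
      case False
      have "norm (half_fourier g (of_real k) - g 0 / (\<i> * of_real (1 + k))) \<le> C + C"
      proof (rule order_trans[OF norm_triangle_ineq4 add_mono])
        show "norm (half_fourier g (of_real k)) \<le> C" by (rule g.half_fourier_bounded) simp
        have "norm (g 0 / (\<i> * of_real (1 + k))) = norm (g 0) / (1 + k)"
          using k by (simp add: norm_divide norm_mult flip: of_real_add)
        also have "\<dots> \<le> norm (g 0) / 1" using k by (intro divide_left_mono) auto
        finally show "norm (g 0 / (\<i> * of_real (1 + k))) \<le> C" using g0 by simp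
      qed
      also have "(2 * C) * (1 + k)\<^sup>2 \<le> (2 * C) * 2\<^sup>2"
        using False k g.C_nonneg by (intro mult_left_mono power_mono) auto
      then have "C + C \<le> 10 * C / (1 + k)\<^sup>2"
        using k g.C_nonneg by (simp add: pos_le_divide_eq)
      finally show ?thesis .
    qed
    finally show ?thesis by (simp add: add_divide_distrib)
  qed
  have "((\<lambda>R. integral {0..R} (\<lambda>k. F k - U' k)) \<longlongrightarrow> integral {0..} (\<lambda>k. F k - U' k)) at_top"
    by (rule inverse_square_decay_limit[OF _ bound]) (intro continuous_intros Fc U'c)
  moreover have "(U \<longlongrightarrow> 0) at_top"
  proof (rule Lim_null_comparison)
    show "\<forall>\<^sub>F k in at_top. norm (U k) \<le> norm (g 0 / of_real x) / (1 + k)"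
      using eventually_ge_at_top[of 0]
      by eventually_elim (simp add: U_def norm_mult norm_divide ne flip: of_real_add)
    show "((\<lambda>k. norm (g 0 / of_real x) / (1 + k)) \<longlongrightarrow> 0) at_top" by real_asymp
  qed
  ultimately have "((\<lambda>R. integral {0..R} (\<lambda>k. F k - U' k) + (U R - U 0)) \<longlongrightarrow> integral {0..} (\<lambda>k. F k - U' k) + (0 - U 0)) at_top"
    by (intro tendsto_intros)
  moreover have "\<forall>\<^sub>F R in at_top. integral {0..R} (\<lambda>k. F k - U' k) + (U R - U 0) = integral {0..R} F"
    using eventually_ge_at_top[of 0]
  proof eventually_elim
    case (elim R)
    have "(U' has_integral (U R - U 0)) {0..R}"
    proof (rule fundamental_theorem_of_calculus[OF elim])
      fix k assume k: "k \<in> {0..R}"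
      have nz: "1 + of_real k \<noteq> (0::complex)" using k by (simp add: complex_eq_iff)
      have "((\<lambda>z. - (g 0 / of_real x) * (exp (\<i> * z * of_real x) / (1 + z))) has_field_derivative U' k) (at (of_real k))"
        by (rule derivative_eq_intros refl nz)+
           (use nz x in \<open>simp add: U'_def divide_simps power2_eq_square\<close>, simp add: algebra_simps)
      then have "((\<lambda>k. - (g 0 / of_real x) * (exp (\<i> * of_real k * of_real x) / (1 + of_real k))) has_vector_derivative U' k) (at k within {0..R})"
        by (rule has_vector_derivative_real_field)
      then show "(U has_vector_derivative U' k) (at k within {0..R})"
        by (simp add: U_def[abs_def])
    qed
    moreover have "((\<lambda>k. F k - U' k) has_integral integral {0..R} (\<lambda>k. F k - U' k)) {0..R}"
      by (intro integrable_integral integrable_continuous_interval continuous_intros continuous_on_subset[OF Fc] continuous_on_subset[OF U'c]) auto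
    ultimately have "((\<lambda>k. (F k - U' k) + U' k) has_integral (integral {0..R} (\<lambda>k. F k - U' k) + (U R - U 0))) {0..R}"
      by (rule has_integral_add[rotated])
    then show ?case by (simp add: integral_unique)
  qed
  ultimately have "((\<lambda>R. integral {0..R} F) \<longlongrightarrow> integral {0..} (\<lambda>k. F k - U' k) + (0 - U 0)) at_top"
    by (rule Lim_transform_eventually)
  then show ?thesis unfolding F_def by blast
qed

lemma ray_in_upper_half_plane:
  assumes "0 \<le> \<theta>" "\<theta> \<le> pi" "0 \<le> r"
  shows "Im (of_real r * cis \<theta>) \<ge> 0"
  using assms by (auto intro!: mult_nonneg_nonneg sin_ge_zero)

lemma has_vector_derivative_shift:
  fixes g :: "real \<Rightarrow> 'a::real_normed_vector"
  assumes "(g has_vector_derivative D) (at (x + y) within {0..})" "0 \<le> x"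
  shows "((\<lambda>y. g (x + y)) has_vector_derivative D) (at y within {0..})"
proof -
  have "((+) x has_vector_derivative 1) (at y within {0..})"
    by (auto intro!: derivative_eq_intros)
  moreover have "(g has_vector_derivative D) (at (x + y) within (+) x ` {0..})"
    by (rule has_vector_derivative_within_subset[OF assms(1)]) (use assms(2) in auto)
  ultimately have "(g \<circ> (+) x has_vector_derivative 1 *\<^sub>R D) (at y within {0..})"
    by (rule vector_diff_chain_within)
  then show ?thesis by (simp add: o_def)
qed

text \<open>Split \<open>exp (\<i> * k * x) * half_fourier g k = A k + B k\<close> at the point \<open>x\<close>. To leading order, and
  up to a term that Jordan's lemma removes, \<open>A\<close> is \<open>- g x / (\<i> * k)\<close> in the upper half-plane and \<open>B\<close> is \<open>g x / (\<i> * k)\<close> in the lower one.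
  Closing the contour of \<open>A\<close> upwards and that of \<open>B\<close> downwards, each half circle yields \<open>pi * g x\<close>.
  This gives the symmetric limit, and one-sided convergence upgrades it to an integral over
  the line.\<close>

theorem half_line_fourier_inversion:
  assumes g: "half_line_decay g C" and g': "half_line_decay g' C" and g'': "half_line_decay g'' C"
    and d: "\<And>y. y \<ge> 0 \<Longrightarrow> (g has_vector_derivative g' y) (at y within {0..})"
    and d': "\<And>y. y \<ge> 0 \<Longrightarrow> (g' has_vector_derivative g'' y) (at y within {0..})"
    and x: "x > 0"
  shows "((\<lambda>k. exp (\<i> * of_real k * of_real x) * half_fourier g (of_real k)) has_integral (2 * of_real pi * g x)) UNIV"
proof -
  interpret g: half_line_decay g C by fact
  interpret g': half_line_decay g' C by fact
  interpret g'': half_line_decay g'' C by fact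
  interpret s: half_line_decay "\<lambda>y. g (x + y)" C using x by (intro g.shifted_decay) auto
  have s': "half_line_decay (\<lambda>y. g' (x + y)) C" and s'': "half_line_decay (\<lambda>y. g'' (x + y)) C"
    using x by (auto intro: g'.shifted_decay g''.shifted_decay)
  let ?I = "\<lambda>q k. integral {0..x} (\<lambda>y. exp (- \<i> * k * of_real y) * q y)"
  define A where "A k = exp (\<i> * k * of_real x) * ?I g k" for k
  define B where "B = half_fourier (\<lambda>y. g (x + y))"
  define F where "F k = exp (\<i> * of_real k * of_real x) * half_fourier g (of_real k)" for k :: real
  have F: "F k = A (of_real k) + B (of_real k)" for k
    using g.half_fourier_split[of "of_real k" x] x by (simp add: F_def A_def B_def)
  have "A holomorphic_on UNIV" unfolding A_def
    by (intro holomorphic_intros g.holomorphic_truncation)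
  then obtain \<Phi> where \<Phi>: "\<And>z. z \<in> UNIV \<Longrightarrow> (\<Phi> has_field_derivative A z) (at z within UNIV)"
    using holomorphic_convex_primitive'[OF convex_UNIV open_UNIV] by blast
  have "interior {k. Im k \<le> 0} = {k. Im k < 0}"
    using interior_halfspace_le[of \<i> 0] by (simp add: inner_complex_def)
  then have "B field_differentiable at z" if "z \<in> interior {k. Im k \<le> 0} - {}" for z
    using s.holomorphic_half_fourier that open_halfspace_Im_lt unfolding B_def
    by (auto intro: holomorphic_on_imp_differentiable_at)
  then obtain \<Psi> where \<Psi>: "\<And>z. z \<in> {k. Im k \<le> 0} \<Longrightarrow> (\<Psi> has_field_derivative B z) (at z within {k. Im k \<le> 0})"
    using holomorphic_convex_primitive[OF convex_halfspace_Im_le finite.emptyI s.continuous_on_half_fourier] 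
    unfolding B_def by blast
  have g0: "norm (g 0) \<le> C" and g'0: "norm (g' 0) \<le> C" using g.decay[of 0] g'.decay[of 0] by auto
  have g'x: "norm (g' x) \<le> C"
  proof -
    have "norm (g' x) \<le> C / (1 + x)\<^sup>2" using x by (intro g'.decay) auto
    also have "\<dots> \<le> C / 1" using x g.C_nonneg by (intro divide_left_mono) auto
    finally show ?thesis by simp
  qed
  have Abd: "norm (A k - (\<i> * g x) / k) \<le> C / norm k * exp (- (x * Im k)) + (2 * C + C * x) / (norm k)\<^sup>2"
    if k: "Im k \<ge> 0" "k \<noteq> 0" for k
  proof -
    let ?e = "exp (\<i> * k * of_real x)"
    have ee: "?e * exp (- \<i> * k * of_real x) = 1" by (simp add: exp_minus)
    have ne: "norm ?e = exp (- (x * Im k))" by (simp add: norm_exp_eq_Re mult.commute)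
    have ne1: "norm ?e \<le> 1" unfolding ne using x k by simp
    have p: "?I g k = (g 0 - exp (- \<i> * k * of_real x) * g x + ?I g' k) / (\<i> * k)"
    proof -
      have "(g has_vector_derivative g' y) (at y within {0..x})" if "y \<in> {0..x}" for y
        by (rule has_vector_derivative_within_subset[OF d]) (use that in auto)
      moreover have "continuous_on {0..x} g'" by (rule continuous_on_subset[OF g'.cont]) auto
      ultimately show ?thesis using fourier_integral_by_parts[of 0 x g g' k] x k by simp
    qed
    have p': "?I g' k = (g' 0 - exp (- \<i> * k * of_real x) * g' x + ?I g'' k) / (\<i> * k)"
    proof -
      have "(g' has_vector_derivative g'' y) (at y within {0..x})" if "y \<in> {0..x}" for y
        by (rule has_vector_derivative_within_subset[OF d']) (use that in auto)
      moreover have "continuous_on {0..x} g''" by (rule continuous_on_subset[OF g''.cont]) auto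
      ultimately show ?thesis using fourier_integral_by_parts[of 0 x g' g'' k] x k by simp
    qed
    have "A k - (\<i> * g x) / k = ?e * g 0 / (\<i> * k) + (?e * ?I g' k) / (\<i> * k)"
    proof -
      have "A k = (?e * g 0 - (?e * exp (- \<i> * k * of_real x)) * g x + ?e * ?I g' k) / (\<i> * k)"
        unfolding A_def p by (simp only: times_divide_eq_right ring_distribs mult.assoc)
      moreover have "g x / (\<i> * k) = - (\<i> * g x / k)" by (simp add: divide_simps)
      ultimately show ?thesis unfolding ee by (simp only: add_divide_distrib diff_divide_distrib mult_1_left) simp
    qed
    also have "?e * ?I g' k = (?e * g' 0 - (?e * exp (- \<i> * k * of_real x)) * g' x + ?e * ?I g'' k) / (\<i> * k)"
      unfolding p' by (simp only: times_divide_eq_right ring_distribs mult.assoc)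
    finally have "A k - (\<i> * g x) / k = ?e * g 0 / (\<i> * k) + (?e * g' 0 - g' x + ?e * ?I g'' k) / (\<i> * k)\<^sup>2"
      unfolding ee by (simp add: power2_eq_square)
    also have "norm \<dots> \<le> C / norm k * exp (- (x * Im k)) + (2 * C + C * x) / (norm k)\<^sup>2"
    proof (rule norm_triangle_mono)
      show "norm (?e * g 0 / (\<i> * k)) \<le> C / norm k * exp (- (x * Im k))"
        using mult_left_mono[OF g0, of "exp (- (x * Im k))"] by (simp add: norm_mult norm_divide ne divide_right_mono mult.commute)
      have "?e * ?I g'' k = integral {0..x} (\<lambda>y. ?e * (exp (- \<i> * k * of_real y) * g'' y))"
        by (rule integral_mult_right[symmetric])
      also have "norm \<dots> \<le> C * (x - 0)"
      proof (rule integral_bound)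
        show "continuous_on {0..x} (\<lambda>y. ?e * (exp (- \<i> * k * of_real y) * g'' y))"
          by (intro continuous_intros continuous_on_subset[OF g''.cont]) auto
        fix y assume y: "y \<in> {0..x}"
        have "norm (?e * (exp (- \<i> * k * of_real y) * g'' y)) = exp (- (x * Im k)) * exp (y * Im k) * norm (g'' y)"
          unfolding norm_mult ne norm_fourier_kernel by simp
        also have "\<dots> = exp (- ((x - y) * Im k)) * norm (g'' y)" by (simp add: exp_add[symmetric] algebra_simps)
        also have "\<dots> \<le> 1 * C"
        proof (rule mult_mono)
          have "norm (g'' y) \<le> C / (1 + y)\<^sup>2" using y by (intro g''.decay) auto
          also have "\<dots> \<le> C / 1" using y g.C_nonneg by (intro divide_left_mono) auto
          finally show "norm (g'' y) \<le> C" by simp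
        qed (use y k in auto)
        finally show "norm (?e * (exp (- \<i> * k * of_real y) * g'' y)) \<le> C" by simp
      qed (use x in auto)
      finally have I: "norm (?e * ?I g'' k) \<le> C * x" by simp
      have "norm (?e * g' 0) \<le> 1 * C" unfolding norm_mult using ne1 g'0 by (intro mult_mono) auto
      then have "norm (?e * g' 0 - g' x + ?e * ?I g'' k) \<le> (C + C) + C * x"
        using I g'x by (intro norm_triangle_mono norm_triangle_le_diff) auto
      then show "norm ((?e * g' 0 - g' x + ?e * ?I g'' k) / (\<i> * k)\<^sup>2) \<le> (2 * C + C * x) / (norm k)\<^sup>2"
        by (simp add: norm_divide norm_mult norm_power divide_right_mono)
    qed
    finally show ?thesis .
  qed
  have "((\<lambda>R. \<Phi> (of_real R * cis pi) - \<Phi> (of_real R * cis 0)) \<longlongrightarrow> \<i> * of_real (pi - 0) * (\<i> * g x)) at_top"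
  proof (rule primitive_arc_limit[OF \<Phi> _ _ x g.C_nonneg])
    fix R \<theta> :: real assume "1 \<le> R" "\<theta> \<in> {0..pi}"
    then show "norm (A (of_real R * cis \<theta>) - \<i> * g x / (of_real R * cis \<theta>)) \<le> C / R * exp (- (x * (R * sin \<theta>))) + (2 * C + C * x) / R\<^sup>2"
      using Abd[of "of_real R * cis \<theta>"] ray_in_upper_half_plane[of \<theta> R] by (simp add: norm_mult)
  qed auto
  moreover have "\<i> * of_real (pi - 0) * (\<i> * g x) = (\<i> * \<i>) * (of_real pi * g x)"
    by (simp only: mult_ac) simp
  ultimately have "((\<lambda>R. - (\<Phi> (of_real R * cis pi) - \<Phi> (of_real R * cis 0))) \<longlongrightarrow> - ((\<i> * \<i>) * (of_real pi * g x))) at_top"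
    by (metis tendsto_minus)
  then have lim1: "((\<lambda>R. \<Phi> (of_real R) - \<Phi> (of_real (- R))) \<longlongrightarrow> of_real pi * g x) at_top"
    by simp
  have "((\<lambda>R. \<Psi> (of_real R * cis 0) - \<Psi> (of_real R * cis (- pi))) \<longlongrightarrow> \<i> * of_real (0 - - pi) * (g x / \<i>)) at_top"
  proof (rule primitive_arc_limit[OF \<Psi> _ _ x order_refl])
    fix R \<theta> :: real assume R: "1 \<le> R" and th: "\<theta> \<in> {- pi..0}"
    have Im: "Im (of_real R * cis \<theta>) \<le> 0"
      using ray_in_upper_half_plane[of "- \<theta>" R] R th by auto
    have "norm (B (of_real R * cis \<theta>) - g (x + 0) / (\<i> * (of_real R * cis \<theta>))) \<le> 2 * C / (norm (of_real R * cis \<theta>))\<^sup>2"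
      unfolding B_def
    proof (rule half_fourier_asymptotics[OF s.half_line_decay_axioms s' s'' _ _ Im])
      fix y :: real assume y: "y \<ge> 0"
      show "((\<lambda>y. g (x + y)) has_vector_derivative g' (x + y)) (at y within {0..})"
        using x y by (intro has_vector_derivative_shift d) auto
      show "((\<lambda>y. g' (x + y)) has_vector_derivative g'' (x + y)) (at y within {0..})"
        using x y by (intro has_vector_derivative_shift d') auto
    qed (use R in auto)
    then show "norm (B (of_real R * cis \<theta>) - g x / \<i> / (of_real R * cis \<theta>)) \<le> 0 / R * exp (- (x * (R * sin \<theta>))) + 2 * C / R\<^sup>2"
      unfolding divide_divide_eq_left using R by (simp add: norm_mult)
  next
    fix R \<theta> :: real assume R: "1 \<le> R" and th: "\<theta> \<in> {- pi..0}"
    then show "of_real R * cis \<theta> \<in> {k. Im k \<le> 0}"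
      using ray_in_upper_half_plane[of "- \<theta>" R] by auto
  qed auto
  moreover have "\<i> * of_real (0 - - pi) * (g x / \<i>) = of_real pi * g x"
    using nonzero_mult_div_cancel_left[of \<i> "of_real pi * g x"] by (simp only: times_divide_eq_right mult.assoc) simp
  moreover have "cis (- pi) = - 1" by (simp add: complex_eq_iff)
  ultimately have lim2: "((\<lambda>R. \<Psi> (of_real R) - \<Psi> (of_real (- R))) \<longlongrightarrow> of_real pi * g x) at_top"
    by (simp only: mult_minus1_right of_real_minus cis_zero mult_1_right)
  have Fc: "continuous_on T F" for T unfolding F_def
    by (intro continuous_intros continuous_on_compose2[OF g.continuous_on_half_fourier]) auto
  have Fint: "F integrable_on {a..b}" for a b by (intro integrable_continuous_interval Fc)
  have sym: "((\<lambda>R. integral {-R..R} F) \<longlongrightarrow> 2 * of_real pi * g x) at_top"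
  proof -
    have "((\<lambda>R. (\<Phi> (of_real R) - \<Phi> (of_real (- R))) + (\<Psi> (of_real R) - \<Psi> (of_real (- R)))) \<longlongrightarrow> of_real pi * g x + of_real pi * g x) at_top"
      by (rule tendsto_add[OF lim1 lim2])
    moreover have "\<forall>\<^sub>F R in at_top. (\<Phi> (of_real R) - \<Phi> (of_real (- R))) + (\<Psi> (of_real R) - \<Psi> (of_real (- R))) = integral {-R..R} F"
      using eventually_ge_at_top[of 0]
    proof eventually_elim
      case (elim R)
      have "((\<lambda>k. A (of_real k) + B (of_real k)) has_integral
          ((\<Phi> (of_real R) - \<Phi> (of_real (- R))) + (\<Psi> (of_real R) - \<Psi> (of_real (- R))))) {-R..R}"
        by (intro has_integral_add integral_primitive_real[OF \<Phi>] integral_primitive_real[OF \<Psi>]) (use elim in auto)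
      then show ?case unfolding F[symmetric] by (rule integral_unique[symmetric])
    qed
    ultimately have "((\<lambda>R. integral {-R..R} F) \<longlongrightarrow> of_real pi * g x + of_real pi * g x) at_top"
      by (rule Lim_transform_eventually)
    then show ?thesis by (simp add: mult.assoc)
  qed
  obtain I where I: "((\<lambda>R. integral {0..R} F) \<longlongrightarrow> I) at_top"
    using one_sided_fourier_integral_converges[OF g g' g'' d d' x] unfolding F_def by blast
  have "(F has_integral (I + (2 * of_real pi * g x - I))) UNIV"
  proof (rule has_integral_UNIV_limits[OF Fint Fint I])
    have "\<forall>\<^sub>F R in at_top. integral {-R..R} F - integral {0..R} F = integral {-R..0} F"
      using eventually_ge_at_top[of 0]
    proof eventually_elim
      case (elim R)
      then show ?case
        using Henstock_Kurzweil_Integration.integral_combine[OF _ _ Fint, of "-R" 0 R] by (simp add: algebra_simps)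
    qed
    then show "((\<lambda>R. integral {-R..0} F) \<longlongrightarrow> 2 * of_real pi * g x - I) at_top"
      by (rule Lim_transform_eventually[OF tendsto_diff[OF sym I]])
  qed
  then show ?thesis by (simp add: F_def[abs_def])
qed

section \<open>The global relation\<close>

lemma Ck_strip_continuous: "Ck_strip M T v \<Longrightarrow> continuous_on ({0..T} \<times> {0..}) (\<lambda>(t, x). v t x)"
  by (cases M) auto

lemma Ck_strip_Suc_0: "Ck_strip (Suc M) T v \<Longrightarrow> Ck_strip (Suc 0) T v"
  by (auto simp: Ck_strip_continuous)

lemma Ck_strip_Dx_funpow: "Ck_strip (n + M) T v \<Longrightarrow> Ck_strip M T ((Dx ^^ n) v)"
proof (induction n arbitrary: M)
  case (Suc n)
  then have "Ck_strip (Suc M) T ((Dx ^^ n) v)"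
    using Suc.IH[of "Suc M"] by (simp del: Ck_strip.simps)
  then show ?case by simp
qed simp

lemma Ck_strip_has_Dx:
  assumes "Ck_strip (Suc M) T v" "t \<in> {0..T}" "x \<ge> 0"
  shows "(v t has_vector_derivative Dx v t x) (at x within {0..})"
  using assms unfolding Dx_def deriv_within_def
  by (auto simp: differentiable_on_def vector_derivative_works[symmetric])

lemma Ck_strip_has_Dt:
  assumes "Ck_strip (Suc M) T v" "t \<in> {0..T}" "x \<ge> 0"
  shows "((\<lambda>s. v s x) has_vector_derivative Dt T v t x) (at t within {0..T})"
  using assms unfolding Dt_def deriv_within_def
  by (auto simp: differentiable_on_def vector_derivative_works[symmetric])

lemma continuous_on_strip_slices:
  fixes v :: "real \<Rightarrow> real \<Rightarrow> complex"
  assumes "continuous_on ({0..T} \<times> {0..}) (\<lambda>(t, x). v t x)"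
  shows "t \<in> {0..T} \<Longrightarrow> continuous_on {0..} (v t)"
    and "x \<ge> 0 \<Longrightarrow> continuous_on {0..T} (\<lambda>t. v t x)"
proof -
  show "continuous_on {0..} (v t)" if "t \<in> {0..T}"
  proof -
    have "continuous_on {0..} (\<lambda>x. (\<lambda>(t, x). v t x) (t, x))"
      by (rule continuous_on_compose2[OF assms]) (use that in \<open>auto intro: continuous_intros\<close>)
    then show ?thesis by simp
  qed
  show "continuous_on {0..T} (\<lambda>t. v t x)" if "x \<ge> 0"
  proof -
    have "continuous_on {0..T} (\<lambda>t. (\<lambda>(t, x). v t x) (t, x))"
      by (rule continuous_on_compose2[OF assms]) (use that in \<open>auto intro: continuous_intros\<close>)
    then show ?thesis by simp
  qed
qed

lemma polynomial_decay_imp_inverse_square: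
  fixes z :: complex
  assumes "(1 + x) ^ N * norm z \<le> C" "x \<ge> 0" "N \<ge> 2"
  shows "norm z \<le> C / (1 + x)\<^sup>2"
proof -
  have "(1 + x)\<^sup>2 * norm z \<le> (1 + x) ^ N * norm z"
    using assms by (intro mult_right_mono power_increasing) auto
  with assms show ?thesis by (simp add: pos_le_divide_eq mult.commute)
qed

lemma fourier_integral_of_iterated_derivative:
  fixes w :: "nat \<Rightarrow> real \<Rightarrow> complex"
  assumes d: "\<And>l y. l < n \<Longrightarrow> y \<in> {0..X} \<Longrightarrow> (w l has_vector_derivative w (Suc l) y) (at y within {0..X})"
    and c: "\<And>l. l \<le> n \<Longrightarrow> continuous_on {0..X} (w l)" and X: "0 \<le> X"
  shows "integral {0..X} (\<lambda>y. exp (- \<i> * k * of_real y) * w n y) =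
     (\<i> * k) ^ n * integral {0..X} (\<lambda>y. exp (- \<i> * k * of_real y) * w 0 y)
     + (\<Sum>l<n. (\<i> * k) ^ (n - 1 - l) * (exp (- \<i> * k * of_real X) * w l X - w l 0))"
  using d c
proof (induction n)
  case (Suc n)
  let ?I = "\<lambda>l. integral {0..X} (\<lambda>y. exp (- \<i> * k * of_real y) * w l y)"
  have IH: "?I n = (\<i> * k) ^ n * ?I 0 + (\<Sum>l<n. (\<i> * k) ^ (n - 1 - l) * (exp (- \<i> * k * of_real X) * w l X - w l 0))"
    using Suc by simp
  have "?I (Suc n) = exp (- \<i> * k * of_real X) * w n X - exp (- \<i> * k * of_real 0) * w n 0 + \<i> * k * ?I n"
    by (rule fourier_integral_of_derivative) (use Suc.prems X in auto)
  also have "\<i> * k * ?I n = (\<i> * k) ^ Suc n * ?I 0 + (\<Sum>l<n. (\<i> * k) ^ (n - l) * (exp (- \<i> * k * of_real X) * w l X - w l 0))"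
  proof -
    have "\<i> * k * (\<Sum>l<n. (\<i> * k) ^ (n - 1 - l) * (exp (- \<i> * k * of_real X) * w l X - w l 0))
      = (\<Sum>l<n. (\<i> * k) ^ (n - l) * (exp (- \<i> * k * of_real X) * w l X - w l 0))"
      unfolding sum_distrib_left
    proof (rule sum.cong[OF refl])
      fix l assume "l \<in> {..<n}"
      then have "n - l = Suc (n - 1 - l)" by auto
      then show "\<i> * k * ((\<i> * k) ^ (n - 1 - l) * (exp (- \<i> * k * of_real X) * w l X - w l 0))
         = (\<i> * k) ^ (n - l) * (exp (- \<i> * k * of_real X) * w l X - w l 0)"
        by (simp only: power_Suc mult.assoc)
    qed
    then show ?thesis unfolding IH by (simp only: distrib_left power_Suc mult.assoc)
  qed
  finally show ?case by (simp add: algebra_simps)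
qed simp

text \<open>What the argument uses of a solution. A single constant \<open>C\<close> bounds the solution, its space
  derivatives and the forcing, so that all truncation errors are uniform in time.\<close>

locale dispersive_solution =
  fixes j :: nat and T :: real and f u :: "real \<Rightarrow> real \<Rightarrow> complex" and C :: real
  assumes T_pos: "T > 0"
    and u_smooth: "Ck_strip (2 * j + 3) T u"
    and f_cont: "continuous_on ({0..T} \<times> {0..}) (\<lambda>(t, x). f t x)"
    and u_decay: "\<And>n t x. n \<le> 2 * j + 3 \<Longrightarrow> t \<in> {0..T} \<Longrightarrow> x \<ge> 0 \<Longrightarrow> norm ((Dx ^^ n) u t x) \<le> C / (1 + x)\<^sup>2"
    and f_decay: "\<And>t x. t \<in> {0..T} \<Longrightarrow> x \<ge> 0 \<Longrightarrow> norm (f t x) \<le> C / (1 + x)\<^sup>2"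
    and pde: "\<And>t x. t \<in> {0<..<T} \<Longrightarrow> x > 0 \<Longrightarrow> Dt T u t x + (-1) ^ (j + 1) * (Dx ^^ (2 * j + 1)) u t x = f t x"
begin

lemma Dx_smooth: "n \<le> 2 * j + 2 \<Longrightarrow> Ck_strip (Suc 0) T ((Dx ^^ n) u)"
proof -
  assume "n \<le> 2 * j + 2"
  then have "n + Suc (2 * j + 2 - n) = 2 * j + 3" by simp
  then have "Ck_strip (n + Suc (2 * j + 2 - n)) T u" using u_smooth by (simp only:)
  then have "Ck_strip (Suc (2 * j + 2 - n)) T ((Dx ^^ n) u)" by (rule Ck_strip_Dx_funpow)
  then show ?thesis by (rule Ck_strip_Suc_0)
qed

lemma Dx_cont: "n \<le> 2 * j + 2 \<Longrightarrow> continuous_on ({0..T} \<times> {0..}) (\<lambda>(t, x). (Dx ^^ n) u t x)"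
  using Dx_smooth Ck_strip_continuous by blast

lemma Dx_has_Dx:
  assumes "n \<le> 2 * j + 2" "t \<in> {0..T}" "x \<ge> 0"
  shows "((Dx ^^ n) u t has_vector_derivative (Dx ^^ Suc n) u t x) (at x within {0..})"
  using Ck_strip_has_Dx[OF Dx_smooth[OF assms(1)] assms(2,3)] by simp

lemma u_decays: "n \<le> 2 * j + 2 \<Longrightarrow> t \<in> {0..T} \<Longrightarrow> half_line_decay ((Dx ^^ n) u t) C"
  by unfold_locales (auto intro: continuous_on_strip_slices(1)[OF Dx_cont] u_decay)

lemma f_decays: "t \<in> {0..T} \<Longrightarrow> half_line_decay (f t) C"
  by unfold_locales (auto intro: continuous_on_strip_slices(1)[OF f_cont] f_decay)

abbreviation boundary_transform :: "nat \<Rightarrow> real \<Rightarrow> complex \<Rightarrow> complex" where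
  "boundary_transform l \<equiv> time_transform (\<lambda>\<tau>. (Dx ^^ l) u \<tau> 0)"

text \<open>The contribution of the boundary \<open>x = 0\<close> to the global relation.\<close>

definition boundary_form :: "real \<Rightarrow> complex \<Rightarrow> complex" where
  "boundary_form s k = (-1) ^ (j + 1) *
     (\<Sum>l\<le>2 * j. (\<i> * k) ^ (2 * j - l) * boundary_transform l s (k ^ (2 * j + 1)))"

text \<open>Integrating the dispersive term by parts produces \<open>(-1) ^ (j + 1) * (\<i> * k) ^ (2 * j + 1)\<close>, which
  equals \<open>- \<i> * k ^ (2 * j + 1)\<close>. Together with the term \<open>\<i> * k ^ (2 * j + 1) * u\<close> from the
  integrating factor it cancels, leaving only the forcing and the boundary values.\<close>

lemma spatial_identity:
  assumes t: "\<tau> \<in> {0<..<T}" and X: "X \<ge> 0"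
  shows "integral {0..X} (\<lambda>x. exp (- \<i> * k * of_real x) * (Dt T u \<tau> x - \<i> * k ^ (2 * j + 1) * u \<tau> x)) =
    integral {0..X} (\<lambda>x. exp (- \<i> * k * of_real x) * f \<tau> x)
    - (-1) ^ (j + 1) * (\<Sum>l\<le>2 * j. (\<i> * k) ^ (2 * j - l) * (exp (- \<i> * k * of_real X) * (Dx ^^ l) u \<tau> X - (Dx ^^ l) u \<tau> 0))"
proof -
  let ?E = "\<lambda>x. exp (- \<i> * k * of_real x)"
  have tT: "\<tau> \<in> {0..T}" using t by auto
  have cu: "continuous_on {0..X} ((Dx ^^ n) u \<tau>)" if "n \<le> 2 * j + 2" for n
    by (rule continuous_on_subset[OF continuous_on_strip_slices(1)[OF Dx_cont[OF that] tT]]) auto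
  have cf: "continuous_on {0..X} (f \<tau>)"
    by (rule continuous_on_subset[OF continuous_on_strip_slices(1)[OF f_cont tT]]) auto
  have sgn: "(-1) ^ (j + 1) * (\<i> * k) ^ (2 * j + 1) = - \<i> * k ^ (2 * j + 1)"
  proof -
    have "\<i> ^ (2 * j + 1) = (-1) ^ j * \<i>" by (simp add: power_mult)
    moreover have "(-1::complex) ^ (j + 1) * (-1) ^ j = -1"
      by (simp add: minus_one_power_iff)
    ultimately show ?thesis unfolding power_mult_distrib by (metis mult.assoc mult_minus1)
  qed
  have "integral {0..X} (\<lambda>x. ?E x * (Dt T u \<tau> x - \<i> * k ^ (2 * j + 1) * u \<tau> x))
     = integral {0..X} (\<lambda>x. ?E x * f \<tau> x - (-1) ^ (j + 1) * (?E x * (Dx ^^ (2 * j + 1)) u \<tau> x) - \<i> * k ^ (2 * j + 1) * (?E x * u \<tau> x))"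
  proof (rule integral_spike[of "{0}"])
    fix x assume x: "x \<in> {0..X} - {0}"
    then have "Dt T u \<tau> x = f \<tau> x - (-1) ^ (j + 1) * (Dx ^^ (2 * j + 1)) u \<tau> x"
      using pde[OF t, of x] by (simp add: eq_diff_eq del: power_Suc funpow.simps)
    then show "?E x * f \<tau> x - (-1) ^ (j + 1) * (?E x * (Dx ^^ (2 * j + 1)) u \<tau> x) - \<i> * k ^ (2 * j + 1) * (?E x * u \<tau> x)
       = ?E x * (Dt T u \<tau> x - \<i> * k ^ (2 * j + 1) * u \<tau> x)"
      by (simp only:) (simp add: algebra_simps del: power_Suc funpow.simps)
  qed auto
  also have "\<dots> = integral {0..X} (\<lambda>x. ?E x * f \<tau> x) - (-1) ^ (j + 1) * integral {0..X} (\<lambda>x. ?E x * (Dx ^^ (2 * j + 1)) u \<tau> x)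
     - \<i> * k ^ (2 * j + 1) * integral {0..X} (\<lambda>x. ?E x * u \<tau> x)"
  proof (rule integral_unique)
    have "(\<lambda>x. ?E x * f \<tau> x) integrable_on {0..X}" "(\<lambda>x. ?E x * (Dx ^^ (2 * j + 1)) u \<tau> x) integrable_on {0..X}"
      "(\<lambda>x. ?E x * (Dx ^^ 0) u \<tau> x) integrable_on {0..X}"
      by (intro integrable_continuous_interval continuous_intros cf cu; simp)+
    then show "((\<lambda>x. ?E x * f \<tau> x - (-1) ^ (j + 1) * (?E x * (Dx ^^ (2 * j + 1)) u \<tau> x) - \<i> * k ^ (2 * j + 1) * (?E x * u \<tau> x))
      has_integral (integral {0..X} (\<lambda>x. ?E x * f \<tau> x) - (-1) ^ (j + 1) * integral {0..X} (\<lambda>x. ?E x * (Dx ^^ (2 * j + 1)) u \<tau> x)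
     - \<i> * k ^ (2 * j + 1) * integral {0..X} (\<lambda>x. ?E x * u \<tau> x))) {0..X}"
      by (intro has_integral_diff has_integral_mult_right integrable_integral) simp_all
  qed
  also have "integral {0..X} (\<lambda>x. ?E x * (Dx ^^ (2 * j + 1)) u \<tau> x) = (\<i> * k) ^ (2 * j + 1) * integral {0..X} (\<lambda>x. ?E x * (Dx ^^ 0) u \<tau> x)
      + (\<Sum>l<2 * j + 1. (\<i> * k) ^ (2 * j + 1 - 1 - l) * (?E X * (Dx ^^ l) u \<tau> X - (Dx ^^ l) u \<tau> 0))"
  proof (rule fourier_integral_of_iterated_derivative[OF _ _ X])
    show "((Dx ^^ l) u \<tau> has_vector_derivative (Dx ^^ Suc l) u \<tau> y) (at y within {0..X})"
      if "l < 2 * j + 1" "y \<in> {0..X}" for l y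
      by (rule has_vector_derivative_within_subset[OF Dx_has_Dx[OF _ tT]]) (use that in auto)
  qed (rule cu, simp)
  also have "(\<Sum>l<2 * j + 1. (\<i> * k) ^ (2 * j + 1 - 1 - l) * (?E X * (Dx ^^ l) u \<tau> X - (Dx ^^ l) u \<tau> 0))
     = (\<Sum>l\<le>2 * j. (\<i> * k) ^ (2 * j - l) * (?E X * (Dx ^^ l) u \<tau> X - (Dx ^^ l) u \<tau> 0))"
    by (rule sum.cong) auto
  finally show ?thesis
    unfolding distrib_left mult.assoc[symmetric, of "(-1) ^ (j + 1)" "(\<i> * k) ^ (2 * j + 1)"] sgn by simp
qed

text \<open>Truncation in space permits Fubini's theorem on a compact rectangle, so no derivative has to be
  taken under an improper integral.\<close>

lemma truncated_global_relation:
  assumes t: "t \<in> {0..T}" and X: "X \<ge> 0"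
  shows "exp (- \<i> * k ^ (2 * j + 1) * of_real t) * integral {0..X} (\<lambda>x. exp (- \<i> * k * of_real x) * u t x)
      - integral {0..X} (\<lambda>x. exp (- \<i> * k * of_real x) * u 0 x) =
    integral {0..t} (\<lambda>\<tau>. exp (- \<i> * k ^ (2 * j + 1) * of_real \<tau>) * integral {0..X} (\<lambda>x. exp (- \<i> * k * of_real x) * f \<tau> x))
    - (-1) ^ (j + 1) * (\<Sum>l\<le>2 * j. (\<i> * k) ^ (2 * j - l) *
        integral {0..t} (\<lambda>\<tau>. exp (- \<i> * k ^ (2 * j + 1) * of_real \<tau>) * (exp (- \<i> * k * of_real X) * (Dx ^^ l) u \<tau> X)))
    + boundary_form t k"
proof -
  define E where "E x = exp (- \<i> * k * of_real x)" for x :: real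
  define P where "P \<tau> = exp (- \<i> * k ^ (2 * j + 1) * of_real \<tau>)" for \<tau> :: real
  define m where "m = 2 * j + 1"
  define V where "V \<tau> x = Dt T u \<tau> x - \<i> * k ^ m * u \<tau> x" for \<tau> x
  have cE: "continuous_on A E" and cP: "continuous_on A P" for A
    unfolding E_def P_def by (intro continuous_intros)+
  have cDt: "continuous_on ({0..T} \<times> {0..}) (\<lambda>(t, x). Dt T u t x)"
  proof -
    have "2 * j + 3 = Suc (2 * j + 2)" by simp
    then have "Ck_strip (2 * j + 2) T (Dt T u)" using u_smooth by (simp only: Ck_strip.simps) 
    then show ?thesis by (rule Ck_strip_continuous)
  qed
  have cu: "continuous_on ({0..T} \<times> {0..}) (\<lambda>(t, x). u t x)" using Dx_cont[of 0] by simp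
  have sub: "{0..t} \<times> {0..X} \<subseteq> {0..T} \<times> {0..}" using t by auto
  have FTC: "((\<lambda>\<tau>. P \<tau> * V \<tau> x) has_integral (P t * u t x - u 0 x)) {0..t}" if x: "x \<ge> 0" for x
  proof -
    have "((\<lambda>\<tau>. P \<tau> * V \<tau> x) has_integral (P t * u t x - P 0 * u 0 x)) {0..t}"
    proof (rule fundamental_theorem_of_calculus)
      fix \<tau> assume \<tau>: "\<tau> \<in> {0..t}"
      have 1: "(P has_vector_derivative (- \<i> * k ^ m * P \<tau>)) (at \<tau> within {0..t})"
        unfolding P_def m_def by (rule has_vector_derivative_real_field) (auto intro!: derivative_eq_intros)
      have "Ck_strip (Suc (2 * j + 2)) T u" using u_smooth by (simp add: eval_nat_numeral del: Ck_strip.simps)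
      then have "((\<lambda>s. u s x) has_vector_derivative Dt T u \<tau> x) (at \<tau> within {0..T})"
        by (rule Ck_strip_has_Dt) (use \<tau> t x in auto)
      then have 2: "((\<lambda>s. u s x) has_vector_derivative Dt T u \<tau> x) (at \<tau> within {0..t})"
        by (rule has_vector_derivative_within_subset) (use t in auto)
      show "((\<lambda>\<tau>. P \<tau> * u \<tau> x) has_vector_derivative P \<tau> * V \<tau> x) (at \<tau> within {0..t})"
        using has_vector_derivative_mult[OF 1 2] by (simp add: V_def algebra_simps)
    qed (use t in auto)
    then show ?thesis by (simp add: P_def)
  qed
  have int_slice: "(\<lambda>x. E x * u s x) integrable_on {0..X}" if "s \<in> {0..T}" for s
    by (intro integrable_continuous_interval continuous_intros cE continuous_on_subset[OF continuous_on_strip_slices(1)[OF cu that]]) auto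
  have "P t * integral {0..X} (\<lambda>x. E x * u t x) - integral {0..X} (\<lambda>x. E x * u 0 x)
     = integral {0..X} (\<lambda>x. P t * (E x * u t x) - E x * u 0 x)"
    using int_slice[of t] int_slice[of 0] t
    by (intro integral_unique[symmetric] has_integral_diff has_integral_mult_right integrable_integral) auto
  also have "\<dots> = integral {0..X} (\<lambda>x. integral {0..t} (\<lambda>\<tau>. E x * (P \<tau> * V \<tau> x)))"
  proof (rule integral_cong)
    fix x assume x: "x \<in> {0..X}"
    have "((\<lambda>\<tau>. E x * (P \<tau> * V \<tau> x)) has_integral E x * (P t * u t x - u 0 x)) {0..t}"
      by (rule has_integral_mult_right[OF FTC]) (use x in auto)
    then show "P t * (E x * u t x) - E x * u 0 x = integral {0..t} (\<lambda>\<tau>. E x * (P \<tau> * V \<tau> x))"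
      by (simp add: integral_unique algebra_simps del: integral_mult_right)
  qed
  also have "\<dots> = integral {0..t} (\<lambda>\<tau>. integral {0..X} (\<lambda>x. E x * (P \<tau> * V \<tau> x)))"
  proof -
    have "continuous_on (cbox (0, 0) (X, t)) (\<lambda>p. E (fst p) * (P (snd p) * V (snd p) (fst p)))"
    proof -
      have c1: "continuous_on (cbox (0, 0) (X, t)) (\<lambda>p. (\<lambda>(t, x). Dt T u t x) (snd p, fst p))"
        by (rule continuous_on_compose2[OF cDt]) (use t in \<open>auto intro!: continuous_intros simp: cbox_Pair_eq\<close>)
      have c2: "continuous_on (cbox (0, 0) (X, t)) (\<lambda>p. (\<lambda>(t, x). u t x) (snd p, fst p))"
        by (rule continuous_on_compose2[OF cu]) (use t in \<open>auto intro!: continuous_intros simp: cbox_Pair_eq\<close>)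
      show ?thesis unfolding V_def
        by (intro continuous_intros continuous_on_compose2[OF cE[of UNIV]] continuous_on_compose2[OF cP[of UNIV]])
           (use c1 c2 in auto)
    qed
    then show ?thesis
      using integral_swap_continuous[of 0 0 X t "\<lambda>x \<tau>. E x * (P \<tau> * V \<tau> x)"] by (simp add: case_prod_unfold)
  qed
  also have "\<dots> = integral {0..t} (\<lambda>\<tau>. P \<tau> * integral {0..X} (\<lambda>x. E x * f \<tau> x)
       - (-1) ^ (j + 1) * (\<Sum>l\<le>2 * j. (\<i> * k) ^ (2 * j - l) * (P \<tau> * (E X * (Dx ^^ l) u \<tau> X)))
       + (-1) ^ (j + 1) * (\<Sum>l\<le>2 * j. (\<i> * k) ^ (2 * j - l) * (P \<tau> * (Dx ^^ l) u \<tau> 0)))"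
  proof (rule integral_spike[of "{0, T}"])
    fix \<tau> assume "\<tau> \<in> {0..t} - {0, T}"
    then have \<tau>: "\<tau> \<in> {0<..<T}" using t by auto
    have "integral {0..X} (\<lambda>x. E x * (P \<tau> * V \<tau> x)) = integral {0..X} (\<lambda>x. P \<tau> * (E x * V \<tau> x))"
      by (simp add: mult_ac del: integral_mult_right integral_mult_left)
    also have "\<dots> = P \<tau> * integral {0..X} (\<lambda>x. E x * V \<tau> x)" by (rule integral_mult_right)
    also have "integral {0..X} (\<lambda>x. E x * V \<tau> x) = integral {0..X} (\<lambda>x. E x * f \<tau> x)
    - (-1) ^ (j + 1) * (\<Sum>l\<le>2 * j. (\<i> * k) ^ (2 * j - l) * (E X * (Dx ^^ l) u \<tau> X - (Dx ^^ l) u \<tau> 0))"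
      unfolding E_def V_def m_def by (rule spatial_identity[OF \<tau> X])
    finally show "P \<tau> * integral {0..X} (\<lambda>x. E x * f \<tau> x)
       - (-1) ^ (j + 1) * (\<Sum>l\<le>2 * j. (\<i> * k) ^ (2 * j - l) * (P \<tau> * (E X * (Dx ^^ l) u \<tau> X)))
       + (-1) ^ (j + 1) * (\<Sum>l\<le>2 * j. (\<i> * k) ^ (2 * j - l) * (P \<tau> * (Dx ^^ l) u \<tau> 0))
       = integral {0..X} (\<lambda>x. E x * (P \<tau> * V \<tau> x))"
      by (simp add: algebra_simps sum_distrib_left sum_subtractf del: integral_mult_right integral_mult_left power_Suc)
  qed auto
  also have "\<dots> = integral {0..t} (\<lambda>\<tau>. P \<tau> * integral {0..X} (\<lambda>x. E x * f \<tau> x))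
    - (-1) ^ (j + 1) * (\<Sum>l\<le>2 * j. (\<i> * k) ^ (2 * j - l) * integral {0..t} (\<lambda>\<tau>. P \<tau> * (E X * (Dx ^^ l) u \<tau> X)))
    + (-1) ^ (j + 1) * (\<Sum>l\<le>2 * j. (\<i> * k) ^ (2 * j - l) * integral {0..t} (\<lambda>\<tau>. P \<tau> * (Dx ^^ l) u \<tau> 0))"
  proof (rule integral_unique, intro has_integral_add has_integral_diff has_integral_mult_right has_integral_sum integrable_integral)
    have "continuous_on {0..t} (\<lambda>\<tau>. integral (cbox 0 X) (\<lambda>x. E x * f \<tau> x))"
    proof (rule integral_continuous_on_param)
      have "continuous_on ({0..t} \<times> cbox 0 X) (\<lambda>p. E (snd p) * (\<lambda>(t, x). f t x) p)"
        by (intro continuous_intros continuous_on_compose2[OF cE[of UNIV]] continuous_on_subset[OF f_cont]) (use sub in auto)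
      then show "continuous_on ({0..t} \<times> cbox 0 X) (\<lambda>(\<tau>, x). E x * f \<tau> x)"
        by (simp add: case_prod_unfold)
    qed
    then show "(\<lambda>\<tau>. P \<tau> * integral {0..X} (\<lambda>x. E x * f \<tau> x)) integrable_on {0..t}"
      by (intro integrable_continuous_interval continuous_intros cP) simp
    fix l assume "l \<in> {..2 * j}"
    then have "continuous_on {0..T} (\<lambda>\<tau>. (Dx ^^ l) u \<tau> X)" "continuous_on {0..T} (\<lambda>\<tau>. (Dx ^^ l) u \<tau> 0)"
      using X by (auto intro!: continuous_on_strip_slices(2) Dx_cont)
    then have "continuous_on {0..t} (\<lambda>\<tau>. (Dx ^^ l) u \<tau> X)" "continuous_on {0..t} (\<lambda>\<tau>. (Dx ^^ l) u \<tau> 0)"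
      using t by (auto elim!: continuous_on_subset)
    then show "(\<lambda>\<tau>. P \<tau> * (E X * (Dx ^^ l) u \<tau> X)) integrable_on {0..t}" "(\<lambda>\<tau>. P \<tau> * (Dx ^^ l) u \<tau> 0) integrable_on {0..t}"
      by (intro integrable_continuous_interval continuous_intros cP; simp)+
  qed auto
  finally show ?thesis
    unfolding boundary_form_def time_transform_def E_def P_def .
qed

end

context dispersive_solution
begin

lemma forcing_truncation_limit:
  fixes P :: "real \<Rightarrow> complex"
  assumes t: "t \<in> {0..T}" and k: "Im k \<le> 0" and P: "continuous_on {0..t} P"
  shows "(\<lambda>n. integral {0..t} (\<lambda>\<tau>. P \<tau> * integral {0..real n} (\<lambda>x. exp (- \<i> * k * of_real x) * f \<tau> x)))
     \<longlonglongrightarrow> integral {0..t} (\<lambda>\<tau>. P \<tau> * half_fourier (f \<tau>) k)"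
proof -
  have "compact (P ` {0..t})" by (intro compact_continuous_image P) auto
  then obtain D where D: "\<And>\<tau>. \<tau> \<in> {0..t} \<Longrightarrow> norm (P \<tau>) \<le> D"
    by (meson bounded_iff compact_imp_bounded imageI)
  let ?F = "\<lambda>n \<tau>. integral {0..real n} (\<lambda>x. exp (- \<i> * k * of_real x) * f \<tau> x)"
  show ?thesis
  proof (rule dominated_convergence(2)[where h = "\<lambda>_. D * (2 * C)"])
    fix n
    have "continuous_on {0..t} (\<lambda>\<tau>. integral (cbox 0 (real n)) (\<lambda>x. exp (- \<i> * k * of_real x) * f \<tau> x))"
    proof (rule integral_continuous_on_param)
      have "continuous_on ({0..t} \<times> cbox 0 (real n)) (\<lambda>p. exp (- \<i> * k * of_real (snd p)) * (\<lambda>(t, x). f t x) p)"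
        by (intro continuous_intros continuous_on_subset[OF f_cont]) (use t in auto)
      then show "continuous_on ({0..t} \<times> cbox 0 (real n)) (\<lambda>(\<tau>, x). exp (- \<i> * k * of_real x) * f \<tau> x)"
        by (simp add: case_prod_unfold)
    qed
    then show "(\<lambda>\<tau>. P \<tau> * ?F n \<tau>) integrable_on {0..t}"
      by (intro integrable_continuous_interval continuous_intros P) simp
  next
    fix n \<tau> assume \<tau>: "\<tau> \<in> {0..t}"
    interpret f: half_line_decay "f \<tau>" C by (rule f_decays) (use \<tau> t in auto)
    have "norm (?F n \<tau>) \<le> norm (?F n \<tau> - half_fourier (f \<tau>) k) + norm (half_fourier (f \<tau>) k)"
      using norm_triangle_ineq[of "?F n \<tau> - half_fourier (f \<tau>) k" "half_fourier (f \<tau>) k"] by (simp only: diff_add_cancel)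
    also have "\<dots> \<le> C / (1 + real n) + C"
      using f.half_fourier_tail[OF k, of "real n"] f.half_fourier_bounded[OF k] by (intro add_mono) auto
    also have "C / (1 + real n) \<le> C / 1" using f.C_nonneg by (intro divide_left_mono) auto
    finally have "norm (?F n \<tau>) \<le> 2 * C" by simp
    then show "norm (P \<tau> * ?F n \<tau>) \<le> D * (2 * C)"
      unfolding norm_mult
      by (intro mult_mono D \<tau> norm_ge_zero order_trans[OF norm_ge_zero D[OF \<tau>]])
  next
    fix \<tau> assume \<tau>: "\<tau> \<in> {0..t}"
    interpret f: half_line_decay "f \<tau>" C by (rule f_decays) (use \<tau> t in auto)
    show "(\<lambda>n. P \<tau> * ?F n \<tau>) \<longlonglongrightarrow> P \<tau> * half_fourier (f \<tau>) k"
      by (intro tendsto_intros filterlim_compose[OF f.half_fourier_limit[OF k] filterlim_real_sequentially])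
  qed auto
qed

lemma far_boundary_vanishes:
  fixes P :: "real \<Rightarrow> complex"
  assumes t: "t \<in> {0..T}" and k: "Im k \<le> 0" and P: "continuous_on {0..t} P" and l: "l \<le> 2 * j"
  shows "(\<lambda>n. integral {0..t} (\<lambda>\<tau>. P \<tau> * (exp (- \<i> * k * of_real (real n)) * (Dx ^^ l) u \<tau> (real n)))) \<longlonglongrightarrow> 0"
proof -
  have "compact (P ` {0..t})" by (intro compact_continuous_image P) auto
  then obtain D where D: "\<And>\<tau>. \<tau> \<in> {0..t} \<Longrightarrow> norm (P \<tau>) \<le> D"
    by (meson bounded_iff compact_imp_bounded imageI)
  show ?thesis
  proof (rule Lim_null_comparison)
    show "(\<lambda>n. D * (C / (1 + real n)\<^sup>2) * (t - 0)) \<longlonglongrightarrow> 0" by real_asymp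
    show "\<forall>\<^sub>F n in sequentially. norm (integral {0..t} (\<lambda>\<tau>. P \<tau> * (exp (- \<i> * k * of_real (real n)) * (Dx ^^ l) u \<tau> (real n))))
        \<le> D * (C / (1 + real n)\<^sup>2) * (t - 0)"
    proof (intro always_eventually allI integral_bound)
      fix n
      have "continuous_on {0..t} (\<lambda>\<tau>. (Dx ^^ l) u \<tau> (real n))"
        by (rule continuous_on_subset[OF continuous_on_strip_slices(2)[OF Dx_cont]]) (use t l in auto)
      then show "continuous_on {0..t} (\<lambda>\<tau>. P \<tau> * (exp (- \<i> * k * of_real (real n)) * (Dx ^^ l) u \<tau> (real n)))"
        by (intro continuous_intros P)
      fix \<tau> assume \<tau>: "\<tau> \<in> {0..t}"
      interpret u: half_line_decay "(Dx ^^ l) u \<tau>" C by (rule u_decays) (use \<tau> t l in auto)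
      show "norm (P \<tau> * (exp (- \<i> * k * of_real (real n)) * (Dx ^^ l) u \<tau> (real n))) \<le> D * (C / (1 + real n)\<^sup>2)"
        unfolding norm_mult[of "P \<tau>"]
        by (intro mult_mono D \<tau> u.kernel_decay k norm_ge_zero order_trans[OF norm_ge_zero D[OF \<tau>]] of_nat_0_le_iff)
    qed (use t in auto)
  qed
qed

theorem global_relation:
  assumes t: "t \<in> {0..T}" and k: "Im k \<le> 0"
  shows "exp (- \<i> * k ^ (2 * j + 1) * of_real t) * half_fourier (u t) k =
    half_fourier (u 0) k + forcing_transform j f t k + boundary_form t k"
proof -
  let ?E = "\<lambda>x. exp (- \<i> * k * of_real x)"
  define P where "P \<tau> = exp (- \<i> * k ^ (2 * j + 1) * of_real \<tau>)" for \<tau> :: real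
  have cP: "continuous_on {0..t} P" unfolding P_def by (intro continuous_intros)
  interpret ut: half_line_decay "u t" C using u_decays[of 0 t] t by simp
  interpret u0: half_line_decay "u 0" C using u_decays[of 0 0] T_pos by simp
  have "(\<lambda>n. P t * integral {0..real n} (\<lambda>x. ?E x * u t x) - integral {0..real n} (\<lambda>x. ?E x * u 0 x))
     \<longlonglongrightarrow> P t * half_fourier (u t) k - half_fourier (u 0) k"
    by (intro tendsto_intros filterlim_compose[OF ut.half_fourier_limit[OF k] filterlim_real_sequentially]
        filterlim_compose[OF u0.half_fourier_limit[OF k] filterlim_real_sequentially])
  moreover have "(\<lambda>n. integral {0..t} (\<lambda>\<tau>. P \<tau> * integral {0..real n} (\<lambda>x. ?E x * f \<tau> x))
    - (-1) ^ (j + 1) * (\<Sum>l\<le>2 * j. (\<i> * k) ^ (2 * j - l) *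
        integral {0..t} (\<lambda>\<tau>. P \<tau> * (?E (real n) * (Dx ^^ l) u \<tau> (real n)))) + boundary_form t k)
     \<longlonglongrightarrow> integral {0..t} (\<lambda>\<tau>. P \<tau> * half_fourier (f \<tau>) k)
       - (-1) ^ (j + 1) * (\<Sum>l\<le>2 * j. (\<i> * k) ^ (2 * j - l) * 0) + boundary_form t k"
    by (intro tendsto_intros forcing_truncation_limit[OF t k cP] far_boundary_vanishes[OF t k cP]) simp
  ultimately have "P t * half_fourier (u t) k - half_fourier (u 0) k = integral {0..t} (\<lambda>\<tau>. P \<tau> * half_fourier (f \<tau>) k)
       - (-1) ^ (j + 1) * (\<Sum>l\<le>2 * j. (\<i> * k) ^ (2 * j - l) * 0) + boundary_form t k"
    unfolding P_def by (subst (asm) truncated_global_relation[OF t]) (auto intro: LIMSEQ_unique)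
  then show ?thesis by (simp add: forcing_transform_def P_def algebra_simps del: power_Suc)
qed

lemma boundary_value_cont: "l \<le> 2 * j \<Longrightarrow> continuous_on {0..T} (\<lambda>\<tau>. (Dx ^^ l) u \<tau> 0)"
  by (rule continuous_on_strip_slices(2)[OF Dx_cont]) auto

lemma boundary_value_bounded: "l \<le> 2 * j \<Longrightarrow> \<tau> \<in> {0..T} \<Longrightarrow> norm ((Dx ^^ l) u \<tau> 0) \<le> C"
  using u_decay[of l \<tau> 0] by simp

lemma holomorphic_boundary_transform:
  assumes s: "s \<in> {0..T}" and l: "l \<le> 2 * j"
  shows "(\<lambda>k. boundary_transform l s (k ^ (2 * j + 1))) holomorphic_on UNIV"
proof -
  have "(\<lambda>\<zeta>. integral {0..s} (\<lambda>\<tau>. exp (\<zeta> * (- \<i> * of_real \<tau>)) * (Dx ^^ l) u \<tau> 0)) holomorphic_on UNIV"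
    by (intro holomorphic_exp_integral continuous_intros continuous_on_subset[OF boundary_value_cont[OF l]]) (use s in auto)
  then have "boundary_transform l s holomorphic_on UNIV"
    unfolding time_transform_def[abs_def] by (simp add: mult_ac)
  then have "(boundary_transform l s \<circ> (\<lambda>k. k ^ (2 * j + 1))) holomorphic_on UNIV"
    by (rule holomorphic_on_compose_gen[rotated]) (auto intro!: holomorphic_intros)
  then show ?thesis by (simp only: o_def)
qed

lemma holomorphic_boundary_form: "s \<in> {0..T} \<Longrightarrow> boundary_form s holomorphic_on UNIV"
  unfolding boundary_form_def[abs_def] by (intro holomorphic_intros holomorphic_boundary_transform) auto

lemma boundary_transform_bounded:
  assumes l: "l \<le> 2 * j" and z: "Im \<zeta> \<le> 0"
  shows "norm (boundary_transform l T \<zeta>) \<le> C * T"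
proof -
  have "norm (integral {0..T} (\<lambda>\<tau>. exp (- \<i> * \<zeta> * of_real \<tau>) * (Dx ^^ l) u \<tau> 0)) \<le> C * (T - 0)"
  proof (rule integral_bound)
    show "continuous_on {0..T} (\<lambda>\<tau>. exp (- \<i> * \<zeta> * of_real \<tau>) * (Dx ^^ l) u \<tau> 0)"
      by (intro continuous_intros boundary_value_cont l)
    fix \<tau> assume \<tau>: "\<tau> \<in> {0..T}"
    have "norm (exp (- \<i> * \<zeta> * of_real \<tau>) * (Dx ^^ l) u \<tau> 0) \<le> 1 * C"
      unfolding norm_mult
      by (intro mult_mono norm_fourier_kernel_le_1 boundary_value_bounded z l \<tau>) (use \<tau> in auto)
    then show "norm (exp (- \<i> * \<zeta> * of_real \<tau>) * (Dx ^^ l) u \<tau> 0) \<le> C" by simp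
  qed (use T_pos in auto)
  then show ?thesis by (simp add: time_transform_def)
qed

text \<open>Integration by parts in time gains \<open>k ^ (2 * j + 1)\<close> in the denominator, one power more than the
  highest coefficient \<open>k ^ (2 * j)\<close> of the form. The exponentials that appear carry
  the times \<open>t - \<tau> \<ge> 0\<close> and are bounded by \<open>1\<close>.\<close>

lemma boundary_form_decay:
  assumes t: "t \<in> {0..T}"
  obtains D where "\<And>k. norm k \<ge> 1 \<Longrightarrow> Im (k ^ (2 * j + 1)) \<ge> 0 \<Longrightarrow>
      norm (exp (\<i> * k ^ (2 * j + 1) * of_real t) * boundary_form t k) \<le> D / norm k"
proof -
  have Dtc: "continuous_on {0..T} (\<lambda>\<tau>. Dt T ((Dx ^^ l) u) \<tau> 0)" if "l \<le> 2 * j" for l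
  proof -
    have "Ck_strip (Suc 0) T ((Dx ^^ l) u)" using Dx_smooth that by simp
    then have "continuous_on ({0..T} \<times> {0..}) (\<lambda>(t, x). Dt T ((Dx ^^ l) u) t x)" by simp
    then show ?thesis by (rule continuous_on_strip_slices(2)) simp
  qed
  have "\<exists>B. \<forall>\<tau>\<in>{0..T}. norm (Dt T ((Dx ^^ l) u) \<tau> 0) \<le> B" if "l \<le> 2 * j" for l
  proof -
    have "compact ((\<lambda>\<tau>. Dt T ((Dx ^^ l) u) \<tau> 0) ` {0..T})" by (intro compact_continuous_image Dtc that) auto
    then show ?thesis by (meson bounded_iff compact_imp_bounded imageI)
  qed
  then obtain B where B: "\<And>l \<tau>. l \<le> 2 * j \<Longrightarrow> \<tau> \<in> {0..T} \<Longrightarrow> norm (Dt T ((Dx ^^ l) u) \<tau> 0) \<le> B l" by metis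
  show ?thesis
  proof (rule that[of "\<Sum>l\<le>2 * j. C + C + B l * t"])
    fix k :: complex assume k1: "norm k \<ge> 1" and Im: "Im (k ^ (2 * j + 1)) \<ge> 0"
    define \<zeta> where "\<zeta> = k ^ (2 * j + 1)"
    have z: "\<zeta> \<noteq> 0" "norm \<zeta> = norm k ^ (2 * j + 1)" "Im \<zeta> \<ge> 0"
      unfolding \<zeta>_def using k1 Im by (auto simp only: norm_power power_eq_0_iff norm_zero)
    let ?e = "\<lambda>s. exp (\<i> * \<zeta> * of_real s)"
    have e1: "norm (?e s) \<le> 1" if "s \<ge> 0" for s
      using z that by (simp add: norm_exp_eq_Re mult_nonneg_nonneg)
    have ee: "?e t * exp (- \<i> * \<zeta> * of_real s) = ?e (t - s)" for s
    proof -
      have "\<i> * \<zeta> * of_real t + - \<i> * \<zeta> * of_real s = \<i> * \<zeta> * of_real (t - s)" by (simp add: algebra_simps)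
      then show ?thesis by (metis exp_add)
    qed
    have one: "norm (?e t * boundary_transform l t \<zeta>) \<le> (C + C + B l * t) / norm \<zeta>" if l: "l \<le> 2 * j" for l
    proof -
      let ?g = "\<lambda>\<tau>. (Dx ^^ l) u \<tau> 0" and ?g' = "\<lambda>\<tau>. Dt T ((Dx ^^ l) u) \<tau> 0"
      have dg: "(?g has_vector_derivative ?g' \<tau>) (at \<tau> within {0..t})" if "\<tau> \<in> {0..t}" for \<tau>
        by (rule has_vector_derivative_within_subset[OF Ck_strip_has_Dt[OF Dx_smooth]]) (use that t l in auto)
      have cg: "continuous_on {0..t} ?g'" by (rule continuous_on_subset[OF Dtc[OF l]]) (use t in auto)
      have "time_transform ?g t \<zeta> = (exp (- \<i> * \<zeta> * of_real 0) * ?g 0 - exp (- \<i> * \<zeta> * of_real t) * ?g t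
          + integral {0..t} (\<lambda>\<tau>. exp (- \<i> * \<zeta> * of_real \<tau>) * ?g' \<tau>)) / (\<i> * \<zeta>)"
        unfolding time_transform_def by (rule fourier_integral_by_parts[OF dg cg z(1)]) (use t in auto)
      then have "?e t * time_transform ?g t \<zeta> = (?e (t - 0) * ?g 0 - ?e (t - t) * ?g t
          + ?e t * integral {0..t} (\<lambda>\<tau>. exp (- \<i> * \<zeta> * of_real \<tau>) * ?g' \<tau>)) / (\<i> * \<zeta>)"
        unfolding ee[symmetric] by (simp only: times_divide_eq_right ring_distribs mult.assoc)
      also have "?e t * integral {0..t} (\<lambda>\<tau>. exp (- \<i> * \<zeta> * of_real \<tau>) * ?g' \<tau>) = integral {0..t} (\<lambda>\<tau>. ?e (t - \<tau>) * ?g' \<tau>)"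
      proof -
        have "integral {0..t} (\<lambda>\<tau>. ?e (t - \<tau>) * ?g' \<tau>) = integral {0..t} (\<lambda>\<tau>. ?e t * (exp (- \<i> * \<zeta> * of_real \<tau>) * ?g' \<tau>))"
          by (rule integral_cong, subst ee[symmetric], rule mult.assoc)
        also have "\<dots> = ?e t * integral {0..t} (\<lambda>\<tau>. exp (- \<i> * \<zeta> * of_real \<tau>) * ?g' \<tau>)"
          by (rule integral_mult_right)
        finally show ?thesis by (rule sym)
      qed
      finally have "norm (?e t * time_transform ?g t \<zeta>) = norm (?e (t - 0) * ?g 0 - ?e (t - t) * ?g t
          + integral {0..t} (\<lambda>\<tau>. ?e (t - \<tau>) * ?g' \<tau>)) / norm \<zeta>"
        by (simp only: norm_divide norm_mult norm_ii mult_1)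
      also have "\<dots> \<le> (C + C + B l * t) / norm \<zeta>"
      proof (intro divide_right_mono norm_triangle_mono norm_triangle_le_diff)
        have *: "norm (?e (t - s) * w) \<le> W" if "s \<le> t" "norm w \<le> W" for s w W
          using mult_mono[OF e1[of "t - s"] that(2)] that by (simp add: norm_mult)
        have "norm (?e (t - 0) * ?g 0) \<le> C" "norm (?e (t - t) * ?g t) \<le> C"
          by (rule *; use t l boundary_value_bounded in auto)+
        then show "norm (?e (t - 0) * ?g 0) + norm (?e (t - t) * ?g t) \<le> C + C" by (rule add_mono)
        have "norm (integral {0..t} (\<lambda>\<tau>. ?e (t - \<tau>) * ?g' \<tau>)) \<le> B l * (t - 0)"
        proof (rule integral_bound)
          show "continuous_on {0..t} (\<lambda>\<tau>. ?e (t - \<tau>) * ?g' \<tau>)" by (intro continuous_intros cg)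
          show "norm (?e (t - \<tau>) * ?g' \<tau>) \<le> B l" if "\<tau> \<in> {0..t}" for \<tau>
            by (rule *) (use B[OF l, of \<tau>] that t in auto)
        qed (use t in auto)
        then show "norm (integral {0..t} (\<lambda>\<tau>. ?e (t - \<tau>) * ?g' \<tau>)) \<le> B l * t" by simp
      qed auto
      finally show ?thesis .
    qed
    have "exp (\<i> * k ^ (2 * j + 1) * of_real t) * boundary_form t k
       = (-1) ^ (j + 1) * (\<Sum>l\<le>2 * j. (\<i> * k) ^ (2 * j - l) * (?e t * boundary_transform l t \<zeta>))"
      unfolding boundary_form_def \<zeta>_def[symmetric] by (simp add: sum_distrib_left mult_ac del: power_Suc)
    then have "norm (exp (\<i> * k ^ (2 * j + 1) * of_real t) * boundary_form t k)
       = norm (\<Sum>l\<le>2 * j. (\<i> * k) ^ (2 * j - l) * (?e t * boundary_transform l t \<zeta>))"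
      by (simp only: norm_mult norm_power norm_minus_cancel norm_one power_one mult_1)
    also have "\<dots> \<le> (\<Sum>l\<le>2 * j. (C + C + B l * t) / norm k)"
    proof (rule sum_norm_le)
      fix l assume l: "l \<in> {..2 * j}"
      have nonneg: "0 \<le> C + C + B l * t"
        using order_trans[OF norm_ge_zero boundary_value_bounded[of l t]] order_trans[OF norm_ge_zero B[of l t]] l t by auto
      have "norm ((\<i> * k) ^ (2 * j - l) * (?e t * boundary_transform l t \<zeta>))
         = norm k ^ (2 * j - l) * norm (?e t * boundary_transform l t \<zeta>)"
        by (simp only: norm_mult norm_power norm_ii mult_1)
      also have "\<dots> \<le> norm k ^ (2 * j) * ((C + C + B l * t) / norm \<zeta>)"
        using k1 l one[of l] by (intro mult_mono power_increasing) auto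
      also have "\<dots> = (C + C + B l * t) / norm k" using k1 by (auto simp: z(2))
      finally show "norm ((\<i> * k) ^ (2 * j - l) * (?e t * boundary_transform l t \<zeta>)) \<le> (C + C + B l * t) / norm k" .
    qed
    also have "\<dots> = (\<Sum>l\<le>2 * j. C + C + B l * t) / norm k" by (simp add: sum_divide_distrib)
    finally show "norm (exp (\<i> * k ^ (2 * j + 1) * of_real t) * boundary_form t k) \<le> (\<Sum>l\<le>2 * j. C + C + B l * t) / norm k" .
  qed
qed

text \<open>The difference only contains times \<open>\<tau> \<ge> t\<close>, for which \<open>exp (\<i> * k ^ (2 * j + 1) * (t - \<tau>))\<close> is
  bounded by \<open>1\<close> when \<open>Im (k ^ (2 * j + 1)) \<le> 0\<close>, the condition opposite to that of the decay estimate.\<close>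

lemma boundary_form_difference_bounded:
  assumes t: "t \<in> {0..T}" and Im: "Im (k ^ (2 * j + 1)) \<le> 0"
  shows "norm (exp (\<i> * k ^ (2 * j + 1) * of_real t) * (boundary_form T k - boundary_form t k))
     \<le> (2 * real j + 1) * (C * T) * (1 + norm k) ^ (2 * j)"
proof -
  define \<zeta> where "\<zeta> = k ^ (2 * j + 1)"
  have z: "Im \<zeta> \<le> 0" using Im by (simp add: \<zeta>_def)
  have C0: "C \<ge> 0" using order_trans[OF norm_ge_zero boundary_value_bounded[of 0 0]] T_pos by auto
  let ?e = "\<lambda>s. exp (\<i> * \<zeta> * of_real s)"
  have one: "norm (?e t * (boundary_transform l T \<zeta> - boundary_transform l t \<zeta>)) \<le> C * T"
    if l: "l \<le> 2 * j" for l
  proof -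
    let ?g = "\<lambda>\<tau>. (Dx ^^ l) u \<tau> 0"
    let ?h = "\<lambda>\<tau>. exp (- \<i> * \<zeta> * of_real \<tau>) * ?g \<tau>"
    have hc: "continuous_on {0..T} ?h" by (intro continuous_intros boundary_value_cont l)
    have "integral {0..t} ?h + integral {t..T} ?h = integral {0..T} ?h"
      using t by (intro Henstock_Kurzweil_Integration.integral_combine integrable_continuous_interval hc) auto
    then have "integral {0..T} ?h - integral {0..t} ?h = integral {t..T} ?h"
      by (simp only: diff_eq_eq add.commute)
    then have "?e t * (time_transform ?g T \<zeta> - time_transform ?g t \<zeta>) = ?e t * integral {t..T} ?h"
      unfolding time_transform_def by (rule arg_cong)
    also have "\<dots> = integral {t..T} (\<lambda>\<tau>. ?e t * ?h \<tau>)" by (rule integral_mult_right[symmetric])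
    also have "norm \<dots> \<le> C * (T - t)"
    proof (rule integral_bound)
      show "continuous_on {t..T} (\<lambda>\<tau>. ?e t * ?h \<tau>)"
        by (intro continuous_on_mult continuous_on_const continuous_on_subset[OF hc]) (use t in auto)
      fix \<tau> assume \<tau>: "\<tau> \<in> {t..T}"
      have "?e t * ?h \<tau> = exp (\<i> * \<zeta> * of_real t + - \<i> * \<zeta> * of_real \<tau>) * ?g \<tau>" by (simp only: exp_add mult.assoc)
      also have "\<i> * \<zeta> * of_real t + - \<i> * \<zeta> * of_real \<tau> = \<i> * \<zeta> * of_real (t - \<tau>)" by (simp add: algebra_simps)
      finally have "?e t * ?h \<tau> = ?e (t - \<tau>) * ?g \<tau>" .
      moreover have "norm (?e (t - \<tau>)) \<le> 1"
        using z \<tau> by (simp add: norm_exp_eq_Re) (simp add: mult_nonpos_nonpos)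
      moreover have "norm (?g \<tau>) \<le> C" using boundary_value_bounded[OF l] \<tau> t by simp
      ultimately show "norm (?e t * ?h \<tau>) \<le> C"
        using mult_mono[of "norm (?e (t - \<tau>))" 1 "norm (?g \<tau>)" C] by (simp only: norm_mult)  simp
    qed (use t in auto)
    also have "\<dots> \<le> C * T" using C0 t by (intro mult_left_mono) auto
    finally show ?thesis .
  qed
  have "exp (\<i> * k ^ (2 * j + 1) * of_real t) * (boundary_form T k - boundary_form t k)
       = (-1) ^ (j + 1) * (\<Sum>l\<le>2 * j. (\<i> * k) ^ (2 * j - l) * (?e t * (boundary_transform l T \<zeta> - boundary_transform l t \<zeta>)))"
    unfolding boundary_form_def \<zeta>_def[symmetric]
    by (simp add: sum_distrib_left right_diff_distrib sum_subtractf mult_ac del: power_Suc)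
  then have "norm (exp (\<i> * k ^ (2 * j + 1) * of_real t) * (boundary_form T k - boundary_form t k))
       = norm (\<Sum>l\<le>2 * j. (\<i> * k) ^ (2 * j - l) * (?e t * (boundary_transform l T \<zeta> - boundary_transform l t \<zeta>)))"
    by (simp only: norm_mult norm_power norm_minus_cancel norm_one power_one mult_1)
  also have "\<dots> \<le> (\<Sum>l\<le>2 * j. (1 + norm k) ^ (2 * j) * (C * T))"
  proof (rule sum_norm_le)
    fix l assume l: "l \<in> {..2 * j}"
    have "norm k ^ (2 * j - l) \<le> (1 + norm k) ^ (2 * j - l)" by (intro power_mono) auto
    also have "\<dots> \<le> (1 + norm k) ^ (2 * j)" by (intro power_increasing) auto
    finally show "norm ((\<i> * k) ^ (2 * j - l) * (?e t * (boundary_transform l T \<zeta> - boundary_transform l t \<zeta>))) \<le> (1 + norm k) ^ (2 * j) * (C * T)"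
      unfolding norm_mult[of "(\<i> * k) ^ (2 * j - l)"] norm_power norm_mult[of \<i> k] norm_ii mult_1
      by (rule mult_mono) (use one l in auto)
  qed
  also have "\<dots> = (2 * real j + 1) * (C * T) * (1 + norm k) ^ (2 * j)" by (simp add: algebra_simps)
  finally show ?thesis .
qed

end

section \<open>Elimination of the unknown boundary values\<close>

text \<open>The interpolating polynomial and \<open>V\<close> agree at \<open>card I\<close> points and have smaller degree.\<close>

lemma lagrange_interpolation:
  fixes a :: "'i \<Rightarrow> complex"
  assumes I: "finite I" "inj_on a I" and deg: "degree V < card I"
  shows "poly V z = (\<Sum>n\<in>I. (\<Prod>m\<in>I - {n}. (z - a m) / (a n - a m)) * poly V (a n))"
proof -
  define c where "c n = poly V (a n) / (\<Prod>m\<in>I - {n}. a n - a m)" for n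
  define W where "W = (\<Sum>n\<in>I. smult (c n) (\<Prod>m\<in>I - {n}. [:- a m, 1:]))"
  have W: "poly W w = (\<Sum>n\<in>I. (\<Prod>m\<in>I - {n}. (w - a m) / (a n - a m)) * poly V (a n))" for w
    unfolding W_def c_def by (simp add: poly_sum poly_prod prod_dividef mult_ac)
  have degW: "degree W < card I"
  proof -
    have "degree (smult (c n) (\<Prod>m\<in>I - {n}. [:- a m, 1:])) \<le> card I - 1" if "n \<in> I" for n
    proof -
      have "degree (\<Prod>m\<in>I - {n}. [:- a m, 1:]) \<le> (\<Sum>m\<in>I - {n}. degree [:- a m, 1:])"
        by (rule degree_prod_sum_le[unfolded o_def]) (use I in auto)
      also have "\<dots> = card I - 1" using that I by simp
      finally show ?thesis by (meson degree_smult_le order_trans)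
    qed
    then have "degree W \<le> card I - 1" unfolding W_def using I by (intro degree_sum_le) auto
    then show ?thesis using deg by linarith
  qed
  have at: "poly W (a n) = poly V (a n)" if n: "n \<in> I" for n
  proof -
    have "(\<Prod>m\<in>I - {i}. (a n - a m) / (a i - a m)) = (if i = n then 1 else 0)" if i: "i \<in> I" for i
    proof (cases "i = n")
      case True
      have "a n \<noteq> a m" if "m \<in> I - {n}" for m using I(2) n that by (auto dest: inj_onD)
      then show ?thesis using True by (auto intro!: prod.neutral)
    next
      case False
      then show ?thesis using I n by (auto intro!: prod_zero)
    qed
    then have "poly W (a n) = (\<Sum>i\<in>I. (if i = n then 1 else 0) * poly V (a i))"
      unfolding W by (intro sum.cong) auto
    then show ?thesis using I n by (simp add: sum.delta if_distrib[of "\<lambda>x. x * _"] cong: if_cong)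
  qed
  have "V = W"
  proof (rule poly_eqI_degree)
    show "poly V x = poly W x" if "x \<in> a ` I" for x using that at by fastforce
    show "degree V < card (a ` I)" "degree W < card (a ` I)"
      unfolding card_image[OF I(2)] by (rule deg degW)+
  qed
  then have "poly V z = poly W z" by (rule arg_cong)
  also note W
  finally show ?thesis .
qed

lemma alpha_exp: "alpha j p n = exp (2 * of_real pi * \<i> * of_nat (j - p + n) / of_nat (2 * j + 1))"
  unfolding alpha_def omega_def exp_of_nat_mult[symmetric] by (simp add: field_simps)

lemma alpha_cis: "alpha j p n = cis (2 * pi * real (j - p + n) / real (2 * j + 1))"
  unfolding alpha_exp cis_conv_exp by (simp add: mult_ac)

lemma alpha_power: "alpha j p n ^ (2 * j + 1) = 1"
proof -
  have "omega j ^ (2 * j + 1) = 1"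
    unfolding omega_def exp_of_nat_mult[symmetric] by (simp add: exp_eq_1 mult_ac del: of_nat_Suc of_nat_add)
  then show ?thesis unfolding alpha_def by (metis power_commutes power_mult mult.commute power_one)
qed

lemma alpha_inj:
  assumes "p \<in> {1..j}" shows "inj_on (alpha j p) {1..j+1}"
proof (rule inj_onI)
  fix n n' assume n: "n \<in> {1..j+1}" "n' \<in> {1..j+1}" and eq: "alpha j p n = alpha j p n'"
  have "(j - p + n) mod (2 * j + 1) = (j - p + n') mod (2 * j + 1)"
    using complex_root_unity_eq[of "2 * j + 1" "j - p + n" "j - p + n'"] eq unfolding alpha_exp by (simp add: cong_def)
  moreover have "j - p + n < 2 * j + 1" "j - p + n' < 2 * j + 1" using n assms by auto
  ultimately show "n = n'" by (metis mod_less add_left_cancel)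
qed

lemma Qpoly_root: "n \<in> {1..j+1} \<Longrightarrow> poly (Qpoly j p) (alpha j p n) = 0"
  unfolding Qpoly_def poly_prod by (rule prod_zero) (auto intro!: bexI[of _ n])

lemma degree_Qpoly: "degree (Qpoly j p) = j + 1"
  unfolding Qpoly_def by (subst degree_prod_sum_eq) auto

lemma poly_pderiv_Qpoly:
  assumes n: "n \<in> {1..j+1}"
  shows "poly (pderiv (Qpoly j p)) (alpha j p n) = (\<Prod>m\<in>{1..j+1} - {n}. alpha j p n - alpha j p m)"
proof -
  have "Qpoly j p = [:- alpha j p n, 1:] * (\<Prod>m\<in>{1..j+1} - {n}. [:- alpha j p m, 1:])"
    unfolding Qpoly_def using n by (subst prod.remove[of _ n]) auto
  then have "pderiv (Qpoly j p) = [:- alpha j p n, 1:] * pderiv (\<Prod>m\<in>{1..j+1} - {n}. [:- alpha j p m, 1:])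
      + (\<Prod>m\<in>{1..j+1} - {n}. [:- alpha j p m, 1:]) * pderiv [:- alpha j p n, 1:]"
    by (simp only: pderiv_mult)
  then show ?thesis by (simp add: pderiv_pCons poly_prod)
qed

lemma Lfun_at_1:
  assumes p: "p \<in> {1..j}" and n: "n \<in> {1..j+1}"
  shows "Lfun j p n 1 * (1 - alpha j p n) = poly (Qpoly j p) 1 / poly (pderiv (Qpoly j p)) (alpha j p n)"
proof -
  have "poly (Qpoly j p) 1 = (1 - alpha j p n) * (\<Prod>m\<in>{1..j+1} - {n}. 1 - alpha j p m)"
    unfolding Qpoly_def poly_prod using n by (subst prod.remove[of _ n]) auto
  then show ?thesis unfolding poly_pderiv_Qpoly[OF n] Lfun_def prod_dividef by simp
qed

text \<open>The form in which the coefficient arises from interpolation: a Lagrange basis polynomial at \<open>1\<close>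
  times the quotient of the multipliers \<open>\<i> * k * z + \<gamma>\<close> at \<open>z = alpha j p n\<close> and at \<open>z = 1\<close>.\<close>

lemma Pfun_eq:
  assumes p: "p \<in> {1..j}" and n: "n \<in> {1..j+1}" and k: "k \<noteq> \<i> * of_real \<gamma>"
  shows "Pfun j \<gamma> p n k = Lfun j p n 1 * (k * alpha j p n - \<i> * of_real \<gamma>) / (k - \<i> * of_real \<gamma>)"
proof -
  have "(if \<gamma> = 0 then 1 else k / (k - \<i> * of_real \<gamma>)) = k / (k - \<i> * of_real \<gamma>)"
    using k by (cases "\<gamma> = 0") auto
  then have "Pfun j \<gamma> p n k = Lfun j p n 1 - Lfun j p n 1 * (1 - alpha j p n) * (k / (k - \<i> * of_real \<gamma>))"
    unfolding Pfun_def Lfun_at_1[OF p n] by simp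
  also have "\<dots> = Lfun j p n 1 * (k * alpha j p n - \<i> * of_real \<gamma>) / (k - \<i> * of_real \<gamma>)"
    using k by (simp add: field_simps)
  finally show ?thesis .
qed


text \<open>Multiplication by \<open>y + \<gamma>\<close> combines neighbouring coefficients into \<open>h l + \<gamma> * h (l - 1)\<close>, which
  is how the boundary condition couples neighbouring boundary values.\<close>

lemma shifted_form_identity:
  fixes y \<gamma> :: complex and h :: "nat \<Rightarrow> complex"
  shows "(y + \<gamma>) * (\<Sum>l\<le>n. y ^ (n - l) * h l) =
    y ^ (n + 1) * h 0 + \<gamma> * h n + (\<Sum>l=1..n. y ^ (n + 1 - l) * (h l + \<gamma> * h (l - 1)))"
proof (induction n)
  case (Suc n)
  have 1: "(\<Sum>l\<le>Suc n. y ^ (Suc n - l) * h l) = y * (\<Sum>l\<le>n. y ^ (n - l) * h l) + h (Suc n)"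
    by (simp add: sum_distrib_left Suc_diff_le mult_ac)
  have 2: "(\<Sum>l=1..Suc n. y ^ (Suc n + 1 - l) * (h l + \<gamma> * h (l - 1))) =
      y * (\<Sum>l=1..n. y ^ (n + 1 - l) * (h l + \<gamma> * h (l - 1))) + y * (h (Suc n) + \<gamma> * h n)"
    by (simp add: sum_distrib_left Suc_diff_le mult_ac)
  have "(y + \<gamma>) * (\<Sum>l\<le>Suc n. y ^ (Suc n - l) * h l) = y * ((y + \<gamma>) * (\<Sum>l\<le>n. y ^ (n - l) * h l)) + (y + \<gamma>) * h (Suc n)"
    unfolding 1 by (simp add: algebra_simps)
  also have "\<dots> = y ^ (Suc n + 1) * h 0 + \<gamma> * h (Suc n) + (\<Sum>l=1..Suc n. y ^ (Suc n + 1 - l) * (h l + \<gamma> * h (l - 1)))"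
    unfolding Suc.IH 2 by (simp add: algebra_simps)
  finally show ?case .
qed (simp add: algebra_simps)

text \<open>For an \<open>m\<close>-th root of unity \<open>z\<close> the multiplied form is a polynomial in \<open>z\<close>: the term with \<open>h 0\<close>
  becomes constant since \<open>z ^ m = 1\<close>, the unknown combinations \<open>h l + \<gamma> * h (l - 1)\<close> with \<open>l > j\<close>
  have degree at most \<open>j\<close>, and the known ones are reduced modulo the node polynomial, which changes
  nothing at the nodes. The reduced polynomial \<open>V\<close> is interpolated at \<open>z = 1\<close>; the reduction
  costs the quotient \<open>Spoly\<close> there.\<close>

lemma elimination_identity:
  fixes h :: "nat \<Rightarrow> complex" and k :: complex
  assumes p: "p \<in> {1..j}"
  defines "G \<equiv> \<lambda>z. \<Sum>l\<le>2 * j. (\<i> * (z * k)) ^ (2 * j - l) * h l"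
  shows "(\<i> * k + of_real \<gamma>) * G 1 =
    (\<Sum>n=1..j+1. Lfun j p n 1 * (\<i> * (alpha j p n * k) + of_real \<gamma>) * G (alpha j p n))
    + (\<Sum>l=1..j. (\<i> * k) ^ (2 * j + 1 - l) * (h l + of_real \<gamma> * h (l - 1)) * (poly (Qpoly j p) 1 * poly (Spoly j p l) 1))"
proof -
  define m where "m = 2 * j + 1"
  define \<phi> where "\<phi> l = (\<i> * k) ^ (m - l) * (h l + of_real \<gamma> * h (l - 1))" for l
  define Q where "Q = Qpoly j p"
  \<comment> \<open>The reductions modulo the node polynomial, which are the \<open>E\<close> of the Euclidean division.\<close>
  define R where "R l = monom 1 (m - l) mod Q" for l :: nat
  define V where "V = [:(\<i> * k) ^ m * h 0 + of_real \<gamma> * h (2 * j):] + (\<Sum>l=j+1..2*j. smult (\<phi> l) (monom 1 (m - l)))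
     + (\<Sum>l=1..j. smult (\<phi> l) (R l))"
  have split: "{1..2 * j} = {1..j} \<union> {j+1..2*j}" by auto
  have full: "(\<i> * (z * k) + of_real \<gamma>) * G z = (\<i> * k) ^ m * h 0 + of_real \<gamma> * h (2 * j) + (\<Sum>l=j+1..2*j. \<phi> l * z ^ (m - l))
      + (\<Sum>l=1..j. \<phi> l * z ^ (m - l))" if z: "z ^ m = 1" for z
  proof -
    have pw: "(\<i> * (z * k)) ^ i = z ^ i * (\<i> * k) ^ i" for i by (simp add: power_mult_distrib mult_ac)
    have "(\<i> * (z * k) + of_real \<gamma>) * G z = (\<i> * (z * k)) ^ m * h 0 + of_real \<gamma> * h (2 * j)
        + (\<Sum>l=1..2*j. (\<i> * (z * k)) ^ (m - l) * (h l + of_real \<gamma> * h (l - 1)))"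
      unfolding G_def m_def by (rule shifted_form_identity)
    also have "\<dots> = (\<i> * k) ^ m * h 0 + of_real \<gamma> * h (2 * j) + (\<Sum>l=1..2*j. \<phi> l * z ^ (m - l))"
      unfolding pw z \<phi>_def by (simp add: mult_ac)
    also have "(\<Sum>l=1..2*j. \<phi> l * z ^ (m - l)) = (\<Sum>l=1..j. \<phi> l * z ^ (m - l)) + (\<Sum>l=j+1..2*j. \<phi> l * z ^ (m - l))"
      unfolding split by (rule sum.union_disjoint) auto
    finally show ?thesis by (simp add: add_ac)
  qed
  have pV: "poly V z = (\<i> * k) ^ m * h 0 + of_real \<gamma> * h (2 * j) + (\<Sum>l=j+1..2*j. \<phi> l * z ^ (m - l))
      + (\<Sum>l=1..j. \<phi> l * poly (R l) z)" for z
    unfolding V_def by (simp add: poly_sum poly_monom)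
  have Q0: "Q \<noteq> 0" using degree_Qpoly[of j p] by (auto simp: Q_def)
  have div: "z ^ (m - l) = poly Q z * poly (Spoly j p l) z + poly (R l) z" for z l
  proof -
    have "monom 1 (m - l) = Q * Spoly j p l + R l"
      unfolding R_def Spoly_def Q_def m_def by (simp add: mult_div_mod_eq)
    then have "poly (monom 1 (m - l)) z = poly (Q * Spoly j p l + R l) z" by (rule arg_cong)
    then show ?thesis by (simp add: poly_monom)
  qed
  have degV: "degree V < card {1..j+1}"
  proof -
    have "degree V \<le> j"
      unfolding V_def
    proof (intro degree_add_le degree_sum_le)
      show "degree (smult (\<phi> l) (monom 1 (m - l))) \<le> j" if "l \<in> {j + 1..2 * j}" for l
        using that by (intro order_trans[OF degree_smult_le] order_trans[OF degree_monom_le]) (auto simp: m_def)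
      show "degree (smult (\<phi> l) (R l)) \<le> j" for l
      proof -
        have "degree (R l) < j + 1"
          using degree_mod_less[OF Q0, of "monom 1 (m - l)"] degree_Qpoly[of j p] unfolding R_def Q_def by auto
        then show ?thesis using degree_smult_le[of "\<phi> l" "R l"] by linarith
      qed
    qed auto
    then show ?thesis by simp
  qed
  have "poly V 1 = (\<Sum>n=1..j+1. Lfun j p n 1 * poly V (alpha j p n))"
    unfolding Lfun_def by (rule lagrange_interpolation[OF _ alpha_inj[OF p] degV]) auto
  also have "\<dots> = (\<Sum>n=1..j+1. Lfun j p n 1 * (\<i> * (alpha j p n * k) + of_real \<gamma>) * G (alpha j p n))"
  proof (rule sum.cong[OF refl])
    fix n assume n: "n \<in> {1..j+1}"
    have "poly (R l) (alpha j p n) = alpha j p n ^ (m - l)" for l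
      using div[of "alpha j p n" l] Qpoly_root[OF n, of p] by (simp add: Q_def)
    then have "poly V (alpha j p n) = (\<i> * (alpha j p n * k) + of_real \<gamma>) * G (alpha j p n)"
      unfolding pV using full[of "alpha j p n"] alpha_power[of j p n] by (simp only: m_def)
    then show "Lfun j p n 1 * poly V (alpha j p n) = Lfun j p n 1 * (\<i> * (alpha j p n * k) + of_real \<gamma>) * G (alpha j p n)"
      by (simp only: mult.assoc)
  qed
  finally have V1: "poly V 1 = (\<Sum>n=1..j+1. Lfun j p n 1 * (\<i> * (alpha j p n * k) + of_real \<gamma>) * G (alpha j p n))" .
  have "(\<i> * k + of_real \<gamma>) * G 1 = poly V 1 + (\<Sum>l=1..j. \<phi> l * (poly Q 1 * poly (Spoly j p l) 1))"
  proof -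
    have "1 = poly Q 1 * poly (Spoly j p l) 1 + poly (R l) 1" for l using div[of 1 l] by simp
    then have "(\<Sum>l=1..j. \<phi> l * 1 ^ (m - l)) = (\<Sum>l=1..j. \<phi> l * (poly Q 1 * poly (Spoly j p l) 1 + poly (R l) 1))"
      by simp
    also have "\<dots> = (\<Sum>l=1..j. \<phi> l * (poly Q 1 * poly (Spoly j p l) 1)) + (\<Sum>l=1..j. \<phi> l * poly (R l) 1)"
      by (simp only: distrib_left sum.distrib)
    finally show ?thesis using full[of 1] unfolding pV by simp
  qed
  then show ?thesis unfolding V1 \<phi>_def m_def Q_def .
qed

lemma ccoef_factor:
  assumes "l \<in> {1..j}"
  shows "(-1) ^ (j + 1) * (\<i> * k) ^ (2 * j + 1 - l) * (poly (Qpoly j p) 1 * poly (Spoly j p l) 1) = \<i> * (ccoef j p l * k ^ (2 * j + 1 - l))"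
proof -
  have "2 * j + 1 - l = Suc (2 * j - l)" using assms by auto
  then have "\<i> ^ (2 * j + 1 - l) = \<i> * \<i> ^ (2 * j - l)" by (simp only: power_Suc)
  then show ?thesis unfolding ccoef_def power_mult_distrib by (simp only: mult_ac)
qed

lemma boundary_form_identity:
  fixes h :: "nat \<Rightarrow> complex" and k :: complex
  assumes p: "p \<in> {1..j}"
  defines "B \<equiv> \<lambda>w. (-1) ^ (j + 1) * (\<Sum>l\<le>2 * j. (\<i> * w) ^ (2 * j - l) * h l)"
  shows "(\<i> * k + of_real \<gamma>) * B k =
    (\<Sum>n=1..j+1. Lfun j p n 1 * (\<i> * (alpha j p n * k) + of_real \<gamma>) * B (alpha j p n * k))
    + (\<Sum>l=1..j. \<i> * (ccoef j p l * k ^ (2 * j + 1 - l)) * (h l + of_real \<gamma> * h (l - 1)))"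
proof -
  define s where "s = (-1 :: complex) ^ (j + 1)"
  define G where "G z = (\<Sum>l\<le>2 * j. (\<i> * (z * k)) ^ (2 * j - l) * h l)" for z
  have B: "B (z * k) = s * G z" for z by (simp only: B_def G_def s_def)
  have "(\<i> * k + of_real \<gamma>) * B k = s * ((\<i> * k + of_real \<gamma>) * G 1)"
    using B[of 1] by simp
  also have "\<dots> = s * (\<Sum>n=1..j+1. Lfun j p n 1 * (\<i> * (alpha j p n * k) + of_real \<gamma>) * G (alpha j p n))
    + s * (\<Sum>l=1..j. (\<i> * k) ^ (2 * j + 1 - l) * (h l + of_real \<gamma> * h (l - 1)) * (poly (Qpoly j p) 1 * poly (Spoly j p l) 1))"
    unfolding G_def elimination_identity[OF p] by (rule distrib_left)
  also have "s * (\<Sum>n=1..j+1. Lfun j p n 1 * (\<i> * (alpha j p n * k) + of_real \<gamma>) * G (alpha j p n))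
     = (\<Sum>n=1..j+1. Lfun j p n 1 * (\<i> * (alpha j p n * k) + of_real \<gamma>) * B (alpha j p n * k))"
    unfolding sum_distrib_left B by (rule sum.cong[OF refl]) (rule mult.left_commute)
  also have "s * (\<Sum>l=1..j. (\<i> * k) ^ (2 * j + 1 - l) * (h l + of_real \<gamma> * h (l - 1)) * (poly (Qpoly j p) 1 * poly (Spoly j p l) 1))
     = (\<Sum>l=1..j. \<i> * (ccoef j p l * k ^ (2 * j + 1 - l)) * (h l + of_real \<gamma> * h (l - 1)))"
    unfolding sum_distrib_left s_def
  proof (rule sum.cong[OF refl])
    fix l assume "l \<in> {1..j}"
    have "a * (b * d * e) = (a * b * e) * d" for a b d e :: complex by (simp only: mult_ac)
    then show "(-1) ^ (j + 1) * ((\<i> * k) ^ (2 * j + 1 - l) * (h l + of_real \<gamma> * h (l - 1)) * (poly (Qpoly j p) 1 * poly (Spoly j p l) 1))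
       = \<i> * (ccoef j p l * k ^ (2 * j + 1 - l)) * (h l + of_real \<gamma> * h (l - 1))"
      by (simp only: ccoef_factor[OF \<open>l \<in> {1..j}\<close>])
  qed
  finally show ?thesis .
qed

text \<open>Away from the pole the multiplier \<open>\<i> * k + \<gamma>\<close> on the left can be divided out.\<close>

lemma boundary_form_elimination:
  fixes h :: "nat \<Rightarrow> complex" and k :: complex
  assumes p: "p \<in> {1..j}" and k: "k \<noteq> \<i> * of_real \<gamma>"
  defines "B \<equiv> \<lambda>w. (-1) ^ (j + 1) * (\<Sum>l\<le>2 * j. (\<i> * w) ^ (2 * j - l) * h l)"
  shows "B k = (\<Sum>n=1..j+1. Pfun j \<gamma> p n k * B (alpha j p n * k))
    + (\<Sum>l=1..j. ccoef j p l * (boundary_symbol j \<gamma> l k * (h l + of_real \<gamma> * h (l - 1))))"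
proof -
  define q where "q = k - \<i> * of_real \<gamma>"
  have q: "q \<noteq> 0" using k by (simp add: q_def)
  have iq: "\<i> * k + of_real \<gamma> = \<i> * q" by (simp add: q_def algebra_simps)
  have "\<i> * q * B k = (\<Sum>n=1..j+1. Lfun j p n 1 * (\<i> * (alpha j p n * k) + of_real \<gamma>) * B (alpha j p n * k))
    + (\<Sum>l=1..j. \<i> * (ccoef j p l * k ^ (2 * j + 1 - l)) * (h l + of_real \<gamma> * h (l - 1)))"
    unfolding iq[symmetric] B_def by (rule boundary_form_identity[OF p])
  also have "(\<Sum>n=1..j+1. Lfun j p n 1 * (\<i> * (alpha j p n * k) + of_real \<gamma>) * B (alpha j p n * k))
     = \<i> * q * (\<Sum>n=1..j+1. Pfun j \<gamma> p n k * B (alpha j p n * k))"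
    unfolding sum_distrib_left
  proof (rule sum.cong[OF refl])
    fix n assume n: "n \<in> {1..j+1}"
    have "\<i> * q * Pfun j \<gamma> p n k = Lfun j p n 1 * (\<i> * (k * alpha j p n - \<i> * of_real \<gamma>))"
      unfolding Pfun_eq[OF p n k] q_def[symmetric] using q by simp
    also have "\<i> * (k * alpha j p n - \<i> * of_real \<gamma>) = \<i> * (alpha j p n * k) + of_real \<gamma>"
      by (simp add: algebra_simps)
    finally show "Lfun j p n 1 * (\<i> * (alpha j p n * k) + of_real \<gamma>) * B (alpha j p n * k) = \<i> * q * (Pfun j \<gamma> p n k * B (alpha j p n * k))"
      by (simp only: mult.assoc[symmetric])
  qed
  also have "(\<Sum>l=1..j. \<i> * (ccoef j p l * k ^ (2 * j + 1 - l)) * (h l + of_real \<gamma> * h (l - 1)))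
     = \<i> * q * (\<Sum>l=1..j. ccoef j p l * (boundary_symbol j \<gamma> l k * (h l + of_real \<gamma> * h (l - 1))))"
    unfolding sum_distrib_left
  proof (rule sum.cong[OF refl])
    fix l assume l: "l \<in> {1..j}"
    have "q * boundary_symbol j \<gamma> l k = k ^ (2 * j + 1 - l)"
    proof (cases "\<gamma> = 0")
      case True
      have "2 * j + 1 - l = Suc (2 * j - l)" using l by auto
      then show ?thesis using True by (simp add: boundary_symbol_def q_def)
    qed (use q in \<open>simp add: boundary_symbol_def q_def\<close>)
    then show "\<i> * (ccoef j p l * k ^ (2 * j + 1 - l)) * (h l + of_real \<gamma> * h (l - 1))
      = \<i> * q * (ccoef j p l * (boundary_symbol j \<gamma> l k * (h l + of_real \<gamma> * h (l - 1))))"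
      by (metis (no_types, lifting) mult.assoc mult.left_commute)
  qed
  finally have "\<i> * q * B k = \<i> * q * ((\<Sum>n=1..j+1. Pfun j \<gamma> p n k * B (alpha j p n * k))
    + (\<Sum>l=1..j. ccoef j p l * (boundary_symbol j \<gamma> l k * (h l + of_real \<gamma> * h (l - 1)))))"
    by (simp only: distrib_left)
  then show ?thesis using q by simp
qed

text \<open>At the pole the left-hand side of the identity vanishes, which leaves a relation between the
  residues of the coefficients.\<close>

lemma boundary_form_at_pole:
  fixes h :: "nat \<Rightarrow> complex"
  assumes p: "p \<in> {1..j}"
  defines "B \<equiv> \<lambda>w. (-1) ^ (j + 1) * (\<Sum>l\<le>2 * j. (\<i> * w) ^ (2 * j - l) * h l)"
  shows "of_real \<gamma> * poly (Qpoly j p) 1 *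
      (\<Sum>n=1..j+1. B (alpha j p n * (\<i> * of_real \<gamma>)) / poly (pderiv (Qpoly j p)) (alpha j p n)) =
    - \<i> * (\<Sum>l=1..j. ccoef j p l * ((\<i> * of_real \<gamma>) ^ (2 * j + 1 - l) * (h l + of_real \<gamma> * h (l - 1))))"
proof -
  define k where "k = \<i> * complex_of_real \<gamma>"
  have "(\<i> * k + of_real \<gamma>) * B k =
    (\<Sum>n=1..j+1. Lfun j p n 1 * (\<i> * (alpha j p n * k) + of_real \<gamma>) * B (alpha j p n * k))
    + (\<Sum>l=1..j. \<i> * (ccoef j p l * k ^ (2 * j + 1 - l)) * (h l + of_real \<gamma> * h (l - 1)))"
    unfolding B_def by (rule boundary_form_identity[OF p])
  moreover have "\<i> * k + of_real \<gamma> = 0" by (simp add: k_def)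
  moreover have "(\<Sum>n=1..j+1. Lfun j p n 1 * (\<i> * (alpha j p n * k) + of_real \<gamma>) * B (alpha j p n * k)) =
    of_real \<gamma> * poly (Qpoly j p) 1 * (\<Sum>n=1..j+1. B (alpha j p n * k) / poly (pderiv (Qpoly j p)) (alpha j p n))"
    unfolding sum_distrib_left
  proof (rule sum.cong[OF refl])
    fix n assume n: "n \<in> {1..j+1}"
    have "\<i> * (alpha j p n * k) + of_real \<gamma> = of_real \<gamma> * (1 - alpha j p n)" by (simp add: k_def algebra_simps)
    then have "Lfun j p n 1 * (\<i> * (alpha j p n * k) + of_real \<gamma>) = of_real \<gamma> * (Lfun j p n 1 * (1 - alpha j p n))"
      by (simp only: mult_ac)
    then show "Lfun j p n 1 * (\<i> * (alpha j p n * k) + of_real \<gamma>) * B (alpha j p n * k) =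
        of_real \<gamma> * poly (Qpoly j p) 1 * (B (alpha j p n * k) / poly (pderiv (Qpoly j p)) (alpha j p n))"
      unfolding Lfun_at_1[OF p n] by simp
  qed
  ultimately have "of_real \<gamma> * poly (Qpoly j p) 1 * (\<Sum>n=1..j+1. B (alpha j p n * k) / poly (pderiv (Qpoly j p)) (alpha j p n))
    = - (\<Sum>l=1..j. \<i> * (ccoef j p l * k ^ (2 * j + 1 - l)) * (h l + of_real \<gamma> * h (l - 1)))"
    by (simp add: eq_neg_iff_add_eq_0)
  also have "(\<Sum>l=1..j. \<i> * (ccoef j p l * k ^ (2 * j + 1 - l)) * (h l + of_real \<gamma> * h (l - 1)))
     = \<i> * (\<Sum>l=1..j. ccoef j p l * (k ^ (2 * j + 1 - l) * (h l + of_real \<gamma> * h (l - 1))))"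
    unfolding sum_distrib_left by (simp only: mult.assoc)
  finally show ?thesis unfolding k_def by simp
qed

section \<open>Functions of polynomial growth\<close>

text \<open>Functions whose product with \<open>exp (\<i> * k * x)\<close> is integrable along every ray that enters the
  open upper half-plane; the class is closed under the operations from which the integrands are built.\<close>

definition poly_growth_on :: "complex set \<Rightarrow> (complex \<Rightarrow> complex) \<Rightarrow> bool" where
  "poly_growth_on S h \<longleftrightarrow> continuous_on S h \<and> (\<exists>C M. \<forall>z\<in>S. norm (h z) \<le> C * (1 + norm z) ^ M)"

lemma poly_growth_onI:
  "continuous_on S h \<Longrightarrow> (\<And>z. z \<in> S \<Longrightarrow> norm (h z) \<le> C * (1 + norm z) ^ M) \<Longrightarrow> poly_growth_on S h"
  unfolding poly_growth_on_def by blast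

lemma poly_growth_on_bounded:
  "continuous_on S h \<Longrightarrow> (\<And>z. z \<in> S \<Longrightarrow> norm (h z) \<le> C) \<Longrightarrow> poly_growth_on S h"
  by (rule poly_growth_onI[of _ _ C 0]) auto

lemma poly_growth_on_const: "poly_growth_on S (\<lambda>_. c)"
  by (rule poly_growth_on_bounded[of _ _ "norm c"]) auto

lemma poly_growth_on_ident: "poly_growth_on S (\<lambda>z. z)"
  by (rule poly_growth_onI[of _ _ 1 1]) auto

lemma poly_growth_on_mult:
  assumes "poly_growth_on S f" "poly_growth_on S g"
  shows "poly_growth_on S (\<lambda>z. f z * g z)"
proof -
  from assms obtain C M D N where f: "\<And>z. z \<in> S \<Longrightarrow> norm (f z) \<le> C * (1 + norm z) ^ M"
    and g: "\<And>z. z \<in> S \<Longrightarrow> norm (g z) \<le> D * (1 + norm z) ^ N"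
    unfolding poly_growth_on_def by blast
  show ?thesis
  proof (rule poly_growth_onI[of _ _ "C * D" "M + N"])
    fix z assume z: "z \<in> S"
    have "norm (f z * g z) \<le> (C * (1 + norm z) ^ M) * (D * (1 + norm z) ^ N)"
      unfolding norm_mult by (intro mult_mono f g z norm_ge_zero order_trans[OF norm_ge_zero f[OF z]])
    then show "norm (f z * g z) \<le> C * D * (1 + norm z) ^ (M + N)" by (simp add: power_add mult_ac)
  qed (use assms in \<open>auto simp: poly_growth_on_def intro: continuous_on_mult\<close>)
qed

lemma poly_growth_on_add:
  assumes "poly_growth_on S f" "poly_growth_on S g"
  shows "poly_growth_on S (\<lambda>z. f z + g z)"
proof -
  from assms obtain C M D N where f: "\<And>z. z \<in> S \<Longrightarrow> norm (f z) \<le> C * (1 + norm z) ^ M"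
    and g: "\<And>z. z \<in> S \<Longrightarrow> norm (g z) \<le> D * (1 + norm z) ^ N"
    unfolding poly_growth_on_def by blast
  show ?thesis
  proof (rule poly_growth_onI[of _ _ "\<bar>C\<bar> + \<bar>D\<bar>" "M + N"])
    fix z assume z: "z \<in> S"
    have "norm (f z) \<le> \<bar>C\<bar> * (1 + norm z) ^ (M + N)"
      by (rule order_trans[OF f[OF z] mult_mono]) (auto intro: power_increasing)
    moreover have "norm (g z) \<le> \<bar>D\<bar> * (1 + norm z) ^ (M + N)"
      by (rule order_trans[OF g[OF z] mult_mono]) (auto intro: power_increasing)
    ultimately show "norm (f z + g z) \<le> (\<bar>C\<bar> + \<bar>D\<bar>) * (1 + norm z) ^ (M + N)"
      using norm_triangle_ineq[of "f z" "g z"] by (simp add: distrib_right)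
  qed (use assms in \<open>auto simp: poly_growth_on_def intro: continuous_on_add\<close>)
qed

lemma poly_growth_on_diff:
  assumes "poly_growth_on S f" "poly_growth_on S g"
  shows "poly_growth_on S (\<lambda>z. f z - g z)"
  using poly_growth_on_add[OF assms(1) poly_growth_on_mult[OF poly_growth_on_const[of S "-1"] assms(2)]] by simp

lemma poly_growth_on_power: "poly_growth_on S f \<Longrightarrow> poly_growth_on S (\<lambda>z. f z ^ n)"
  by (induction n) (auto intro: poly_growth_on_const poly_growth_on_mult)

lemma poly_growth_on_subset: "poly_growth_on S f \<Longrightarrow> R \<subseteq> S \<Longrightarrow> poly_growth_on R f"
  unfolding poly_growth_on_def by (meson continuous_on_subset subsetD)

lemma poly_growth_on_inverse:
  assumes "d > 0" "\<And>z. z \<in> S \<Longrightarrow> d \<le> norm (z - z0)"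
  shows "poly_growth_on S (\<lambda>z. inverse (z - z0))"
proof (rule poly_growth_on_bounded[of _ _ "inverse d"])
  have "z - z0 \<noteq> 0" if "z \<in> S" for z using assms that by force
  then show "continuous_on S (\<lambda>z. inverse (z - z0))" by (intro continuous_intros) auto
  show "norm (inverse (z - z0)) \<le> inverse d" if "z \<in> S" for z
    unfolding norm_inverse using assms that by (intro le_imp_inverse_le) auto
qed

lemmas poly_growth_intros = poly_growth_on_const poly_growth_on_ident poly_growth_on_mult poly_growth_on_add
  poly_growth_on_diff poly_growth_on_power

definition ray :: "real \<Rightarrow> complex set" where
  "ray \<theta> = (\<lambda>r. of_real r * cis \<theta>) ` {0..}"

lemma Im_of_real_mult_cis: "Im (of_real a * cis b) = a * sin b"
  by simp

lemma Im_mult_of_real: "Im (z * of_real a) = Im z * a"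
  by simp

lemma norm_exp_i_mult: "norm (exp (\<i> * z)) = exp (- Im z)"
  by (simp add: norm_exp_eq_Re)

lemma poly_growth_on_sum:
  "finite A \<Longrightarrow> (\<And>i. i \<in> A \<Longrightarrow> poly_growth_on S (h i)) \<Longrightarrow> poly_growth_on S (\<lambda>z. \<Sum>i\<in>A. h i z)"
  by (induction A rule: finite_induct) (auto intro: poly_growth_on_const poly_growth_on_add)

lemma poly_growth_Pfun:
  assumes "\<gamma> \<noteq> 0 \<Longrightarrow> poly_growth_on S (\<lambda>k. inverse (k - \<i> * of_real \<gamma>))"
  shows "poly_growth_on S (Pfun j \<gamma> p n)"
proof (cases "\<gamma> = 0")
  case True
  then have "Pfun j \<gamma> p n = (\<lambda>k. Pfun j \<gamma> p n 0)" by (auto simp: Pfun_def)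
  then show ?thesis by (metis poly_growth_on_const)
next
  case False
  define c where "c = poly (Qpoly j p) 1 / poly (pderiv (Qpoly j p)) (alpha j p n)"
  have eq: "Pfun j \<gamma> p n = (\<lambda>k. Lfun j p n 1 - c * (k * inverse (k - \<i> * of_real \<gamma>)))"
    using False by (auto simp: Pfun_def c_def divide_inverse)
  show ?thesis unfolding eq by (intro poly_growth_intros assms False)
qed

lemma wave_growth_bound:
  assumes "poly_growth_on S h"
  obtains C M where "\<And>z. z \<in> S \<Longrightarrow> norm (exp (\<i> * z * of_real x) * h z) \<le> C * (1 + norm z) ^ M * exp (- (x * Im z))"
proof -
  from assms obtain C M where bd: "\<And>z. z \<in> S \<Longrightarrow> norm (h z) \<le> C * (1 + norm z) ^ M"
    unfolding poly_growth_on_def by blast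
  show ?thesis
  proof
    fix z assume z: "z \<in> S"
    have "norm (exp (\<i> * z * of_real x) * h z) = norm (h z) * exp (- (x * Im z))"
      unfolding mult.assoc norm_mult norm_exp_i_mult by (simp add: mult_ac)
    then show "norm (exp (\<i> * z * of_real x) * h z) \<le> C * (1 + norm z) ^ M * exp (- (x * Im z))"
      using bd[OF z] by (simp add: mult_right_mono)
  qed
qed

lemma wave_ray_integrable:
  assumes h: "poly_growth_on (ray \<theta>) h" and x: "x > 0" and s: "sin \<theta> > 0"
    and g: "\<And>z. z \<in> ray \<theta> \<Longrightarrow> g z = exp (\<i> * z * of_real x) * h z"
  shows "(\<lambda>r. g (of_real r * cis \<theta>)) integrable_on {0..}"
proof -
  obtain C M where bd: "\<And>z. z \<in> ray \<theta> \<Longrightarrow> norm (exp (\<i> * z * of_real x) * h z) \<le> C * (1 + norm z) ^ M * exp (- (x * Im z))"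
    using wave_growth_bound[OF h] by blast
  have hc: "continuous_on (ray \<theta>) h" using h by (simp add: poly_growth_on_def)
  have ray: "of_real r * cis \<theta> \<in> ray \<theta>" if "r \<ge> 0" for r using that by (auto simp: ray_def)
  have "(\<lambda>r. (\<lambda>z. exp (\<i> * z * of_real x) * h z) (of_real r * cis \<theta>)) integrable_on {0..}"
  proof (rule ray_decay_integrable(1)[OF _ _ x s])
    show "continuous_on {0..} (\<lambda>r. exp (\<i> * (of_real r * cis \<theta>) * of_real x) * h (of_real r * cis \<theta>))"
      by (intro continuous_intros continuous_on_compose2[OF hc]) (use ray in auto)
    fix r :: real assume r: "r \<ge> 0"
    show "norm (exp (\<i> * (of_real r * cis \<theta>) * of_real x) * h (of_real r * cis \<theta>)) \<le> C * (1 + r) ^ M * exp (- (x * (r * sin \<theta>)))"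
      using bd[OF ray[OF r]] r unfolding Im_of_real_mult_cis by (simp add: norm_mult)
  qed
  then show ?thesis
    by (rule integrable_eq) (use ray g in auto)
qed

section \<open>Geometry of the sectors\<close>

lemma sin_even_multiple_minus: "sin (2 * real p * pi - y) = - sin y"
  using sin_2npi[of p] cos_2npi[of p] by (simp add: sin_diff)

locale sector_geometry =
  fixes j p :: nat
  assumes p: "p \<in> {1..j}"
begin

abbreviation "lo \<equiv> arg_lo j p"
abbreviation "hi \<equiv> arg_hi j p"

lemma m_lo: "real (2 * j + 1) * lo = (2 * real p - 1) * pi"
  and m_hi: "real (2 * j + 1) * hi = 2 * real p * pi"
  by (simp_all only: arg_lo_def arg_hi_def times_divide_eq_right) simp_all

lemma angles: "0 < lo" "lo < hi" "hi < pi"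
proof -
  show "0 < lo" using p by (simp add: arg_lo_def)
  show "lo < hi" unfolding arg_lo_def arg_hi_def
    by (intro divide_strict_right_mono mult_strict_right_mono) auto
  have "2 * real p * pi < real (2 * j + 1) * pi" using p by (intro mult_strict_right_mono) auto
  then show "hi < pi" unfolding arg_hi_def by (simp add: divide_less_eq mult.commute)
qed

lemma sin_pos: "sin lo > 0" "sin hi > 0"
  using angles by (auto intro!: sin_gt_zero)

lemma rays_in_sector: "ray lo \<subseteq> sector lo hi" "ray hi \<subseteq> sector lo hi"
  using angles by (auto simp: ray_def intro!: ray_in_sector)

lemma polar:
  assumes "k \<in> sector lo hi"
  obtains r \<theta> where "r \<ge> 0" "lo \<le> \<theta>" "\<theta> \<le> hi" "k = of_real r * cis \<theta>"
  using sector_polar[OF assms] angles by auto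

lemma power_Im_nonpos: "k \<in> sector lo hi \<Longrightarrow> Im (k ^ (2 * j + 1)) \<le> 0"
proof -
  assume "k \<in> sector lo hi"
  then obtain r \<theta> where k: "r \<ge> 0" "lo \<le> \<theta>" "\<theta> \<le> hi" "k = of_real r * cis \<theta>" by (rule polar)
  define y where "y = 2 * real p * pi - real (2 * j + 1) * \<theta>"
  have "real (2 * j + 1) * lo \<le> real (2 * j + 1) * \<theta>" "real (2 * j + 1) * \<theta> \<le> real (2 * j + 1) * hi"
    using k by (intro mult_left_mono; simp)+
  then have "0 \<le> y" "y \<le> pi" unfolding m_lo m_hi y_def by (auto simp: algebra_simps)
  then have "sin y \<ge> 0" by (rule sin_ge_zero)
  moreover have "sin (real (2 * j + 1) * \<theta>) = - sin y"
    unfolding y_def using sin_even_multiple_minus[of p "2 * real p * pi - real (2 * j + 1) * \<theta>"] by (simp only: diff_diff_eq2 add_diff_cancel_left')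
  moreover have "k ^ (2 * j + 1) = of_real (r ^ (2 * j + 1)) * cis (real (2 * j + 1) * \<theta>)"
    unfolding k(4) power_mult_distrib Complex.DeMoivre by (simp only: of_real_power)
  ultimately show ?thesis using k(1) by (simp only: Im_of_real_mult_cis) (simp add: mult_nonneg_nonneg)
qed

lemma power_Im_zero_on_rays:
  assumes "k \<in> ray lo \<union> ray hi"
  shows "Im (k ^ (2 * j + 1)) = 0"
proof -
  from assms obtain r \<theta> where k: "k = of_real r * cis \<theta>" "\<theta> = lo \<or> \<theta> = hi" by (auto simp: ray_def)
  have "\<exists>n. real (2 * j + 1) * \<theta> = real n * pi"
    using k(2)
  proof
    assume "\<theta> = lo"
    then show ?thesis using m_lo p by (intro exI[of _ "2 * p - 1"]) (simp add: of_nat_diff)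
  next
    assume "\<theta> = hi"
    then show ?thesis using m_hi by (intro exI[of _ "2 * p"]) simp
  qed
  then have "sin (real (2 * j + 1) * \<theta>) = 0" by (metis sin_npi)
  moreover have "k ^ (2 * j + 1) = of_real (r ^ (2 * j + 1)) * cis (real (2 * j + 1) * \<theta>)"
    unfolding k(1) power_mult_distrib Complex.DeMoivre by (simp only: of_real_power)
  ultimately show ?thesis by (simp only: Im_of_real_mult_cis mult_zero_right)
qed

text \<open>Adding the argument of \<open>alpha j p n\<close> moves the interval \<open>[lo, hi]\<close> into \<open>[pi, 2 * pi]\<close>: for the
  smallest \<open>n\<close> it starts at \<open>pi\<close>, for the largest it ends at \<open>2 * pi\<close>.\<close>

lemma alpha_rotation:
  assumes n: "n \<in> {1..j+1}" and th: "lo \<le> \<theta>" "\<theta> \<le> hi"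
  obtains \<psi> where "alpha j p n * (of_real r * cis \<theta>) = of_real r * cis (pi + \<psi>)" "0 \<le> \<psi>" "\<psi> \<le> pi"
    "lo < \<theta> \<Longrightarrow> 0 < \<psi>" "\<theta> < hi \<Longrightarrow> \<psi> < pi"
proof -
  define m where "m = real (2 * j + 1)"
  have m: "m > 0" by (simp add: m_def)
  define \<psi> where "\<psi> = 2 * pi * real (j - p + n) / m + \<theta> - pi"
  have e1: "real (j - p + n) = real j - real p + real n" using p by (simp add: of_nat_diff)
  have "\<psi> - (\<theta> - lo) = (2 * real n - 2) * pi / m"
    unfolding \<psi>_def e1 arg_lo_def m_def[symmetric] using m by (simp add: field_simps) (simp add: m_def algebra_simps)
  moreover have "(2 * real n - 2) * pi / m \<ge> 0" using n m by simp
  ultimately have lower: "\<psi> \<ge> \<theta> - lo" by linarith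
  have "pi - \<psi> - (hi - \<theta>) = (2 * real (j + 1) - 2 * real n) * pi / m"
    unfolding \<psi>_def e1 arg_hi_def m_def[symmetric] using m by (simp add: field_simps) (simp add: m_def algebra_simps)
  moreover have "(2 * real (j + 1) - 2 * real n) * pi / m \<ge> 0" using n m by simp
  ultimately have upper: "pi - \<psi> \<ge> hi - \<theta>" by linarith
  have "alpha j p n * (of_real r * cis \<theta>) = of_real r * cis (2 * pi * real (j - p + n) / m + \<theta>)"
    unfolding alpha_cis m_def[symmetric] by (simp add: mult.left_commute cis_mult)
  then have "alpha j p n * (of_real r * cis \<theta>) = of_real r * cis (pi + \<psi>)"
    by (simp add: \<psi>_def)
  then show ?thesis
    by (rule that) (use lower upper th in auto)
qed

lemma alpha_Im_nonpos:
  assumes n: "n \<in> {1..j+1}" and k: "k \<in> sector lo hi"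
  shows "Im (alpha j p n * k) \<le> 0"
proof -
  obtain r \<theta> where r: "r \<ge> 0" "lo \<le> \<theta>" "\<theta> \<le> hi" "k = of_real r * cis \<theta>" using k by (rule polar)
  obtain \<psi> where "alpha j p n * k = of_real r * cis (pi + \<psi>)" "0 \<le> \<psi>" "\<psi> \<le> pi"
    using alpha_rotation[OF n r(2,3)] r(4) by metis
  then show ?thesis using r(1) by (simp add: mult_nonneg_nonneg sin_ge_zero)
qed

lemma alpha_Im_neg:
  assumes n: "n \<in> {1..j+1}" and k: "k \<in> interior (sector lo hi)"
  shows "Im (alpha j p n * k) < 0"
proof -
  have "k \<in> sector lo hi" using k interior_subset by blast
  then obtain r \<theta> where r: "r \<ge> 0" "lo \<le> \<theta>" "\<theta> \<le> hi" "k = of_real r * cis \<theta>" by (rule polar)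
  have h: "r * sin (\<theta> - lo) > 0" "r * sin (\<theta> - hi) < 0"
    using k unfolding interior_sector r(4) by (auto simp only: mem_Collect_eq height_above_polar)
  have "r > 0" "lo < \<theta>" "\<theta> < hi"
    using h r(1-3) by (auto simp: less_le)
  moreover obtain \<psi> where "alpha j p n * k = of_real r * cis (pi + \<psi>)" "lo < \<theta> \<Longrightarrow> 0 < \<psi>" "\<theta> < hi \<Longrightarrow> \<psi> < pi"
    using alpha_rotation[OF n r(2,3)] r(4) by metis
  ultimately show ?thesis by (simp add: sin_gt_zero)
qed

text \<open>A ray with vertical direction would make the odd number \<open>2 * j + 1\<close> even.\<close>

lemma cos_rays_nonzero: "cos lo \<noteq> 0" "cos hi \<noteq> 0"
proof -
  have *: "cos \<theta> \<noteq> 0" if th: "0 < \<theta>" "\<theta> < pi" and m: "real (2 * j + 1) * \<theta> = real n * pi" for \<theta> n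
  proof
    assume "cos \<theta> = 0"
    then have "\<theta> = pi / 2" using cos_inj_pi[of \<theta> "pi / 2"] th by simp
    with m have "real (2 * j + 1) = real (2 * n)" by simp
    then have "2 * j + 1 = 2 * n" by (simp only: of_nat_eq_iff)
    then show False by presburger
  qed
  show "cos lo \<noteq> 0" using *[of lo "2 * p - 1"] angles m_lo p by (simp add: of_nat_diff)
  show "cos hi \<noteq> 0" using *[of hi "2 * p"] angles m_hi by simp
qed

lemma pole_in_sector:
  assumes "\<gamma> > 0" "j = 2 * p - 1"
  shows "\<i> * of_real \<gamma> \<in> interior (sector lo hi)"
proof -
  have h: "height_above \<theta> (\<i> * of_real \<gamma>) = \<gamma> * cos \<theta>" for \<theta> by (simp add: height_above_def)
  have m: "real (2 * j + 1) = 4 * real p - 1" using assms(2) p by (simp add: of_nat_diff)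
  have "lo < pi / 2" unfolding arg_lo_def m using p by (simp add: divide_less_eq field_simps)
  moreover have "hi > pi / 2" unfolding arg_hi_def m using p by (simp add: less_divide_eq field_simps)
  ultimately have "cos lo > 0" "cos hi < 0" using angles cos_monotone_0_pi[of "pi / 2" hi] by (auto intro: cos_gt_zero)
  then show ?thesis unfolding interior_sector mem_Collect_eq h using assms by (simp add: mult_pos_neg)
qed

text \<open>A pole on the positive imaginary axis forces \<open>lo \<le> pi / 2 \<le> hi\<close>, hence
  \<open>4 * p - 2 \<le> 2 * j + 1 \<le> 4 * p\<close>, and parity leaves only \<open>j = 2 * p - 1\<close>. The negative imaginary axis is disjoint from the sector.\<close>

lemma pole_not_in_sector:
  assumes "\<gamma> \<noteq> 0" "\<not> (\<gamma> > 0 \<and> j = 2 * p - 1)"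
  shows "\<i> * of_real \<gamma> \<notin> sector lo hi"
proof
  assume "\<i> * of_real \<gamma> \<in> sector lo hi"
  moreover have h: "height_above \<theta> (\<i> * of_real \<gamma>) = \<gamma> * cos \<theta>" for \<theta> by (simp add: height_above_def)
  ultimately have c: "\<gamma> * cos lo \<ge> 0" "\<gamma> * cos hi \<le> 0" by (auto simp: sector_def)
  have mono: "cos hi < cos lo" using angles by (intro cos_monotone_0_pi) auto
  show False
  proof (cases "\<gamma> > 0")
    case True
    then have "cos lo \<ge> 0" "cos hi \<le> 0" using c by (auto simp: zero_le_mult_iff mult_le_0_iff)
    then have "lo \<le> pi / 2" "hi \<ge> pi / 2"
      using angles cos_monotone_0_pi[of "pi / 2" lo] cos_gt_zero[of hi] by force+
    then have "real (2 * j + 1) * lo \<le> real (2 * j + 1) * (pi / 2)" "real (2 * j + 1) * (pi / 2) \<le> real (2 * j + 1) * hi"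
      by (intro mult_left_mono; simp)+
    then have "(2 * real p - 1) * pi \<le> (real (2 * j + 1) / 2) * pi" "(real (2 * j + 1) / 2) * pi \<le> (2 * real p) * pi"
      unfolding m_lo m_hi by simp_all
    then have "2 * real p - 1 \<le> real (2 * j + 1) / 2" "real (2 * j + 1) / 2 \<le> 2 * real p"
      by (simp_all only: mult_le_cancel_right_pos pi_gt_zero)
    then have "real (4 * p) \<le> real (2 * j + 3)" "real (2 * j + 1) \<le> real (4 * p)" by simp_all
    then have "4 * p \<le> 2 * j + 3" "2 * j + 1 \<le> 4 * p" by (simp_all only: of_nat_le_iff)
    then have "j = 2 * p - 1" using p by simp
    then show False using True assms by simp
  next
    case False
    then have "\<gamma> < 0" using assms by simp
    then have "cos lo \<le> 0" "cos hi \<ge> 0" using c by (auto simp: zero_le_mult_iff mult_le_0_iff)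
    then show False using mono by simp
  qed
qed

lemma poly_growth_wave_factor:
  "poly_growth_on (ray lo \<union> ray hi) (\<lambda>k. exp (\<i> * (k ^ (2 * j + 1) * of_real s)))"
proof (rule poly_growth_on_bounded[of _ _ 1])
  fix k assume "k \<in> ray lo \<union> ray hi"
  then have "Im (k ^ (2 * j + 1) * of_real s) = 0" using power_Im_zero_on_rays by simp
  then show "norm (exp (\<i> * (k ^ (2 * j + 1) * of_real s))) \<le> 1"
    unfolding norm_exp_i_mult by (simp only: minus_zero exp_zero order_refl)
qed (intro continuous_intros)

lemma poly_growth_pole_on_rays:
  assumes "\<gamma> \<noteq> 0"
  shows "poly_growth_on (ray lo \<union> ray hi) (\<lambda>k. inverse (k - \<i> * of_real \<gamma>))"
proof (rule poly_growth_on_inverse)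
  define d where "d = \<bar>\<gamma>\<bar> * min \<bar>cos lo\<bar> \<bar>cos hi\<bar>"
  show "d > 0" using assms cos_rays_nonzero by (simp add: d_def)
  fix k assume "k \<in> ray lo \<union> ray hi"
  then obtain r \<theta> where k: "k = of_real r * cis \<theta>" "\<theta> = lo \<or> \<theta> = hi" by (auto simp: ray_def)
  have "d \<le> \<bar>\<gamma>\<bar> * \<bar>cos \<theta>\<bar>" unfolding d_def using k(2) by (intro mult_left_mono) auto
  also have "\<dots> = \<bar>height_above \<theta> (\<i> * of_real \<gamma>)\<bar>" by (simp add: height_above_def abs_mult)
  also have "\<dots> \<le> norm (k - \<i> * of_real \<gamma>)" unfolding k(1) by (rule height_above_le_dist)
  finally show "d \<le> norm (k - \<i> * of_real \<gamma>)" .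
qed

lemma rays_avoid_pole:
  assumes "\<gamma> \<noteq> 0" "k \<in> ray lo \<union> ray hi"
  shows "k \<noteq> \<i> * of_real \<gamma>"
proof
  assume eq: "k = \<i> * of_real \<gamma>"
  obtain r \<theta> where k: "k = of_real r * cis \<theta>" "\<theta> = lo \<or> \<theta> = hi" using assms(2) by (auto simp: ray_def)
  have "height_above \<theta> k = 0" unfolding k(1) height_above_polar by simp
  moreover have "height_above \<theta> k = \<gamma> * cos \<theta>" unfolding eq by (simp add: height_above_def)
  ultimately show False using assms(1) cos_rays_nonzero k(2) by auto
qed

lemma sector_integrableI:
  assumes "poly_growth_on (ray lo \<union> ray hi) h" "x > 0"
    and "\<And>k. k \<in> ray lo \<union> ray hi \<Longrightarrow> g k = exp (\<i> * k * of_real x) * h k"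
  shows "sector_integrable j p g"
  unfolding sector_integrable_def
proof
  show "(\<lambda>r. g (of_real r * cis lo)) integrable_on {0..}"
    by (rule wave_ray_integrable[OF poly_growth_on_subset[OF assms(1)] assms(2) sin_pos(1)]) (auto intro: assms(3))
  show "(\<lambda>r. g (of_real r * cis hi)) integrable_on {0..}"
    by (rule wave_ray_integrable[OF poly_growth_on_subset[OF assms(1)] assms(2) sin_pos(2)]) (auto intro: assms(3))
qed

end

lemma sector_integral_add:
  assumes "sector_integrable j p f" "sector_integrable j p g"
  shows "sector_integral j p (\<lambda>k. f k + g k) = sector_integral j p f + sector_integral j p g"
    and "sector_integrable j p (\<lambda>k. f k + g k)"
  using assms unfolding sector_integral_def sector_integrable_def
  by (simp_all add: distrib_right Henstock_Kurzweil_Integration.integral_add integrable_on_mult_left integrable_add del: integral_mult_left integral_mult_right)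

lemma sector_integral_cmult:
  assumes "sector_integrable j p f"
  shows "sector_integral j p (\<lambda>k. c * f k) = c * sector_integral j p f"
    and "sector_integrable j p (\<lambda>k. c * f k)"
  using assms unfolding sector_integral_def sector_integrable_def
  by (simp_all add: mult.assoc right_diff_distrib integrable_on_mult_right)

lemma sector_integral_diff:
  assumes "sector_integrable j p f" "sector_integrable j p g"
  shows "sector_integral j p (\<lambda>k. f k - g k) = sector_integral j p f - sector_integral j p g"
    and "sector_integrable j p (\<lambda>k. f k - g k)"
  using sector_integral_add[OF assms(1) sector_integral_cmult(2)[OF assms(2), of "-1"]]
    sector_integral_cmult(1)[OF assms(2), of "-1"] by simp_all

lemma sector_integral_sum:
  assumes "finite A" "\<And>i. i \<in> A \<Longrightarrow> sector_integrable j p (f i)"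
  shows "sector_integral j p (\<lambda>k. \<Sum>i\<in>A. f i k) = (\<Sum>i\<in>A. sector_integral j p (f i))
    \<and> sector_integrable j p (\<lambda>k. \<Sum>i\<in>A. f i k)"
  using assms
proof (induction A rule: finite_induct)
  case empty
  have "(\<lambda>r. 0::complex) integrable_on {0::real..}"
    by (rule has_integral_integrable[OF has_integral_0])
  then show ?case by (simp add: sector_integral_def sector_integrable_def)
next
  case (insert i A)
  then show ?case using sector_integral_add[of j p "f i" "\<lambda>k. \<Sum>i\<in>A. f i k"] by simp
qed

text \<open>The vertex \<open>0\<close> is excluded because the elimination identity may fail there: for \<open>\<gamma> = 0\<close> it is the
  pole.\<close>

lemma sector_integral_cong:
  assumes "\<And>r \<theta>. r > 0 \<Longrightarrow> \<theta> \<in> {arg_lo j p, arg_hi j p} \<Longrightarrow> f (of_real r * cis \<theta>) = g (of_real r * cis \<theta>)"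
  shows "sector_integral j p f = sector_integral j p g"
proof -
  have "integral {0..} (\<lambda>r. f (of_real r * cis \<theta>) * cis \<theta>) = integral {0..} (\<lambda>r. g (of_real r * cis \<theta>) * cis \<theta>)"
    if "\<theta> \<in> {arg_lo j p, arg_hi j p}" for \<theta>
    by (rule integral_spike[of "{0}"]) (use assms that in auto)
  then show ?thesis unfolding sector_integral_def by simp
qed

section \<open>The solution formula\<close>

locale ibvp_solution = dispersive_solution +
  fixes \<gamma> :: real and u0 :: "real \<Rightarrow> complex" and \<phi> :: "nat \<Rightarrow> real \<Rightarrow> complex"
  assumes initial: "\<And>x. x > 0 \<Longrightarrow> u 0 x = u0 x"
    and boundary: "\<And>l t. l \<in> {1..j} \<Longrightarrow> t \<in> {0<..<T} \<Longrightarrow>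
        (Dx ^^ l) u t 0 + of_real \<gamma> * (Dx ^^ (l - 1)) u t 0 = \<phi> l t"
begin

lemma half_fourier_initial: "half_fourier (u 0) = half_fourier u0"
  unfolding half_fourier_def
  by (rule ext, rule integral_spike[of "{0}"]) (auto simp: initial)

lemma time_transform_data:
  assumes l: "l \<in> {1..j}"
  shows "time_transform (\<phi> l) T \<zeta> = boundary_transform l T \<zeta>
    + of_real \<gamma> * boundary_transform (l - 1) T \<zeta>"
proof -
  let ?g = "\<lambda>l \<tau>. exp (- \<i> * \<zeta> * of_real \<tau>) * (Dx ^^ l) u \<tau> 0"
  have int: "?g i integrable_on {0..T}" if "i \<le> 2 * j" for i
    by (intro integrable_continuous_interval continuous_intros boundary_value_cont that)
  have "((\<lambda>\<tau>. ?g l \<tau> + of_real \<gamma> * ?g (l - 1) \<tau>) has_integral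
      (integral {0..T} (?g l) + of_real \<gamma> * integral {0..T} (?g (l - 1)))) {0..T}"
    using l by (intro has_integral_add has_integral_mult_right integrable_integral int) auto
  then have "integral {0..T} (\<lambda>\<tau>. ?g l \<tau> + of_real \<gamma> * ?g (l - 1) \<tau>) = integral {0..T} (?g l) + of_real \<gamma> * integral {0..T} (?g (l - 1))"
    by (rule integral_unique)
  moreover have "integral {0..T} (\<lambda>\<tau>. exp (- \<i> * \<zeta> * of_real \<tau>) * \<phi> l \<tau>) = integral {0..T} (\<lambda>\<tau>. ?g l \<tau> + of_real \<gamma> * ?g (l - 1) \<tau>)"
  proof (rule integral_spike[of "{0, T}"])
    fix \<tau> assume "\<tau> \<in> {0..T} - {0, T}"
    then have "\<tau> \<in> {0<..<T}" by auto
    from boundary[OF l this, symmetric]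
    show "?g l \<tau> + of_real \<gamma> * ?g (l - 1) \<tau> = exp (- \<i> * \<zeta> * of_real \<tau>) * \<phi> l \<tau>"
      by (simp only: distrib_left mult.left_commute)
  qed auto
  ultimately show ?thesis unfolding time_transform_def by simp
qed

text \<open>The global relation at the final time, read as a formula for the data.\<close>

lemma data_transform_eq:
  assumes "Im k \<le> 0"
  shows "half_fourier u0 k + forcing_transform j f T k =
    exp (- \<i> * k ^ (2 * j + 1) * of_real T) * half_fourier (u T) k - boundary_form T k"
  using global_relation[of T k] T_pos assms by (simp add: half_fourier_initial)

text \<open>The integrands through which the terminal values \<open>u T\<close> enter; the formula must not contain them.\<close>

definition terminal_integrand :: "nat \<Rightarrow> nat \<Rightarrow> real \<Rightarrow> real \<Rightarrow> complex \<Rightarrow> complex" where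
  "terminal_integrand p n t x k =
     exp (\<i> * k * of_real x) * exp (\<i> * (k ^ (2 * j + 1) * of_real (t - T))) * half_fourier (u T) (alpha j p n * k) * Pfun j \<gamma> p n k"

lemma wave_eq: "wave j t x k = exp (\<i> * k * of_real x) * exp (\<i> * (k ^ (2 * j + 1) * of_real t))"
  unfolding wave_def exp_add[symmetric] by (simp only: mult.assoc)

lemma wave_terminal:
  "wave j t x k * exp (- \<i> * k ^ (2 * j + 1) * of_real T)
     = exp (\<i> * k * of_real x) * exp (\<i> * (k ^ (2 * j + 1) * of_real (t - T)))"
  unfolding wave_def exp_add[symmetric] by (rule arg_cong[of _ _ exp]) (simp add: algebra_simps)

lemma alpha_mult_power: "(alpha j p n * k) ^ (2 * j + 1) = k ^ (2 * j + 1)"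
  unfolding power_mult_distrib alpha_power by simp

context
  fixes t x :: real
  assumes t: "t \<in> {0..T}" and x: "x > 0"
begin

text \<open>Fourier inversion and contour deformation together; the global relation on the real line also
  provides the convergence of the first integral.\<close>

lemma line_integral_part:
  "((\<lambda>k. line_integrand j u0 f t x k) has_integral
     (2 * of_real pi * u t x - (\<Sum>p=1..j. sector_integral j p (\<lambda>k. wave j t x k * boundary_form t k)))) UNIV"
proof -
  let ?h = "\<lambda>k. wave j t x k * boundary_form t k"
  obtain D where D: "\<And>k. norm k \<ge> 1 \<Longrightarrow> Im (k ^ (2 * j + 1)) \<ge> 0 \<Longrightarrow>
      norm (exp (\<i> * k ^ (2 * j + 1) * of_real t) * boundary_form t k) \<le> D / norm k"
    using boundary_form_decay[OF t] by blast
  have 1: "((\<lambda>k. ?h (of_real k)) has_integral (\<Sum>p=1..j. sector_integral j p ?h)) UNIV"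
  proof (rule line_integral_eq_sector_integrals[OF _ x])
    show "?h holomorphic_on UNIV" unfolding wave_def
      by (intro holomorphic_intros holomorphic_boundary_form t)
    fix p :: nat and R \<theta> :: real assume R: "R \<ge> 1" and th: "2 * real p * pi / real (2 * j + 1) \<le> \<theta>" "\<theta> \<le> (2 * real p + 1) * pi / real (2 * j + 1)"
    define k where "k = of_real R * cis \<theta>"
    define y where "y = real (2 * j + 1) * \<theta> - 2 * real p * pi"
    have "2 * real p * pi \<le> real (2 * j + 1) * \<theta>" "real (2 * j + 1) * \<theta> \<le> (2 * real p + 1) * pi"
      using th by (simp_all add: pos_divide_le_eq pos_le_divide_eq mult.commute)
    then have "sin y \<ge> 0" unfolding y_def by (intro sin_ge_zero) (auto simp: algebra_simps)
    moreover have "sin (real (2 * j + 1) * \<theta>) = sin y"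
      using sin_2npi[of p] cos_2npi[of p] unfolding y_def by (simp only: sin_diff mult_1_right mult_zero_right diff_zero)
    moreover have "k ^ (2 * j + 1) = of_real (R ^ (2 * j + 1)) * cis (real (2 * j + 1) * \<theta>)"
      unfolding k_def power_mult_distrib Complex.DeMoivre by (simp only: of_real_power)
    ultimately have Im: "Im (k ^ (2 * j + 1)) \<ge> 0" using R by (simp only: Im_of_real_mult_cis) (simp add: mult_nonneg_nonneg)
    have nk: "norm k = R" using R by (simp add: k_def norm_mult)
    have "norm (exp (\<i> * k * of_real x)) = exp (- (x * (R * sin \<theta>)))"
      unfolding mult.assoc norm_exp_i_mult k_def by (simp add: mult_ac)
    moreover have "norm (exp (\<i> * (k ^ (2 * j + 1) * of_real t)) * boundary_form t k) \<le> D / R"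
      using D[OF _ Im] R unfolding nk by (simp only: mult.assoc)
    ultimately have "norm (?h k) \<le> exp (- (x * (R * sin \<theta>))) * (D / R)"
      unfolding wave_eq by (simp only: mult.assoc norm_mult[of "exp (\<i> * (k * of_real x))"] mult_left_mono exp_ge_zero)
    then show "norm (?h (of_real R * cis \<theta>)) \<le> D / R * exp (- (x * (R * sin \<theta>)))"
      unfolding k_def by (simp only: mult.commute)
  qed
  have 2: "((\<lambda>k. exp (\<i> * of_real k * of_real x) * half_fourier (u t) (of_real k)) has_integral (2 * of_real pi * u t x)) UNIV"
  proof (rule half_line_fourier_inversion[OF _ _ _ _ _ x])
    show "half_line_decay (u t) C" "half_line_decay ((Dx ^^ 1) u t) C" "half_line_decay ((Dx ^^ 2) u t) C"
      using u_decays[of 0 t] u_decays[of 1 t] u_decays[of 2 t] t by simp_all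
    show "(u t has_vector_derivative (Dx ^^ 1) u t y) (at y within {0..})" if "y \<ge> 0" for y
      using Dx_has_Dx[of 0 t y] t that by simp
    show "((Dx ^^ 1) u t has_vector_derivative (Dx ^^ 2) u t y) (at y within {0..})" if "y \<ge> 0" for y
      using Dx_has_Dx[of 1 t y] t that by (simp add: numeral_2_eq_2)
  qed
  have eq: "line_integrand j u0 f t x k = exp (\<i> * of_real k * of_real x) * half_fourier (u t) (of_real k) - ?h (of_real k)" for k
  proof -
    let ?k = "complex_of_real k"
    have gr: "half_fourier u0 ?k + forcing_transform j f t ?k = exp (- \<i> * ?k ^ (2 * j + 1) * of_real t) * half_fourier (u t) ?k - boundary_form t ?k"
      using global_relation[OF t, of ?k] by (simp add: half_fourier_initial)
    have "wave j t x ?k * exp (- \<i> * ?k ^ (2 * j + 1) * of_real t) = exp (\<i> * ?k * of_real x)"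
      unfolding wave_def exp_add[symmetric] by (rule arg_cong[of _ _ exp]) simp
    then show ?thesis unfolding line_integrand_def gr right_diff_distrib mult.assoc[symmetric, of "wave j t x ?k" "exp _"] by simp
  qed
  show ?thesis unfolding eq by (rule has_integral_diff[OF 2 1])
qed

context
  fixes p :: nat
  assumes p: "p \<in> {1..j}"
begin

interpretation sector_geometry j p using p by unfold_locales

lemma poly_growth_terminal_transform:
  assumes n: "n \<in> {1..j+1}"
  shows "poly_growth_on (sector lo hi) (\<lambda>k. half_fourier (u T) (alpha j p n * k))"
proof -
  interpret uT: half_line_decay "u T" C using u_decays[of 0 T] T_pos by simp
  show ?thesis
  proof (rule poly_growth_on_bounded)
    show "continuous_on (sector lo hi) (\<lambda>k. half_fourier (u T) (alpha j p n * k))"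
      by (intro continuous_on_compose2[OF uT.continuous_on_half_fourier] continuous_intros) (use alpha_Im_nonpos[OF n] in auto)
    show "norm (half_fourier (u T) (alpha j p n * k)) \<le> C" if "k \<in> sector lo hi" for k
      by (rule uT.half_fourier_bounded[OF alpha_Im_nonpos[OF n that]])
  qed
qed

lemma holomorphic_terminal_transform:
  assumes n: "n \<in> {1..j+1}"
  shows "(\<lambda>k. half_fourier (u T) (alpha j p n * k)) holomorphic_on interior (sector lo hi)"
proof -
  interpret uT: half_line_decay "u T" C using u_decays[of 0 T] T_pos by simp
  have "(half_fourier (u T) \<circ> (\<lambda>k. alpha j p n * k)) holomorphic_on interior (sector lo hi)"
    by (rule holomorphic_on_compose_gen[OF _ uT.holomorphic_half_fourier])
       (use alpha_Im_neg[OF n] in \<open>auto intro!: holomorphic_intros\<close>)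
  then show ?thesis by (simp only: o_def)
qed

lemma poly_growth_time_factor:
  "poly_growth_on (sector lo hi) (\<lambda>k. exp (\<i> * (k ^ (2 * j + 1) * of_real (t - T))))"
proof (rule poly_growth_on_bounded[of _ _ 1])
  fix k assume k: "k \<in> sector lo hi"
  have "Im (k ^ (2 * j + 1) * of_real (t - T)) = Im (k ^ (2 * j + 1)) * (t - T)" by (rule Im_mult_of_real)
  also have "\<dots> \<ge> 0" using power_Im_nonpos[OF k] t by (intro mult_nonpos_nonpos) auto
  finally show "norm (exp (\<i> * (k ^ (2 * j + 1) * of_real (t - T)))) \<le> 1" unfolding norm_exp_i_mult by (simp only: exp_le_one_iff neg_le_0_iff_le)
qed (intro continuous_intros)

lemma sector_integral_congI:
  assumes "\<And>k. k \<in> ray lo \<union> ray hi \<Longrightarrow> k \<noteq> 0 \<Longrightarrow> F k = G k"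
  shows "sector_integral j p F = sector_integral j p G"
proof (rule sector_integral_cong)
  fix r \<theta> :: real assume "r > 0" "\<theta> \<in> {lo, hi}"
  then show "F (of_real r * cis \<theta>) = G (of_real r * cis \<theta>)"
    by (intro assms) (auto simp: ray_def)
qed

lemma sector_integral_regular:
  assumes h: "poly_growth_on (sector lo hi) h" "h holomorphic_on interior (sector lo hi)"
  shows "sector_integral j p (\<lambda>k. exp (\<i> * k * of_real x) * h k) = 0"
proof -
  obtain D M where bd: "\<And>z. z \<in> sector lo hi \<Longrightarrow> norm (exp (\<i> * z * of_real x) * h z) \<le> D * (1 + norm z) ^ M * exp (- (x * Im z))"
    using wave_growth_bound[OF h(1)] by blast
  have "continuous_on (sector lo hi) (\<lambda>k. exp (\<i> * k * of_real x) * h k)"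
    using h(1) unfolding poly_growth_on_def by (intro continuous_intros) auto
  moreover have "(\<lambda>k. exp (\<i> * k * of_real x) * h k) holomorphic_on interior (sector lo hi)"
    by (intro holomorphic_intros h(2))
  ultimately show ?thesis
    unfolding sector_integral_def using cauchy_theorem_sector[OF angles x _ _ bd] by simp
qed

lemma sector_integral_simple_pole:
  assumes h: "poly_growth_on (sector lo hi) h" "h holomorphic_on interior (sector lo hi)"
    and z0: "z0 \<in> interior (sector lo hi)"
  shows "sector_integral j p (\<lambda>k. exp (\<i> * k * of_real x) * h k / (k - z0)) = 2 * of_real pi * \<i> * (exp (\<i> * z0 * of_real x) * h z0)"
proof -
  obtain D M where bd: "\<And>z. z \<in> sector lo hi \<Longrightarrow> norm (exp (\<i> * z * of_real x) * h z) \<le> D * (1 + norm z) ^ M * exp (- (x * Im z))"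
    using wave_growth_bound[OF h(1)] by blast
  have "continuous_on (sector lo hi) (\<lambda>k. exp (\<i> * k * of_real x) * h k)"
    using h(1) unfolding poly_growth_on_def by (intro continuous_intros) auto
  moreover have "(\<lambda>k. exp (\<i> * k * of_real x) * h k) holomorphic_on interior (sector lo hi)"
    by (intro holomorphic_intros h(2))
  ultimately show ?thesis
    unfolding sector_integral_def by (rule cauchy_formula_sector[OF angles x _ _ bd z0])
qed

lemma sector_integral_terminal_no_pole:
  assumes n: "n \<in> {1..j+1}" and no_pole: "\<not> (\<gamma> > 0 \<and> j = 2 * p - 1)"
  shows "sector_integral j p (terminal_integrand p n t x) = 0"
proof -
  let ?P = "Pfun j \<gamma> p n"
  have P: "poly_growth_on (sector lo hi) ?P \<and> ?P holomorphic_on interior (sector lo hi)"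
  proof (cases "\<gamma> = 0")
    case True
    then have "?P = (\<lambda>k. ?P 0)" by (auto simp: Pfun_def)
    then show ?thesis by (metis poly_growth_on_const holomorphic_on_const)
  next
    case False
    define c where "c = poly (Qpoly j p) 1 / poly (pderiv (Qpoly j p)) (alpha j p n)"
    have eq: "?P = (\<lambda>k. Lfun j p n 1 - c * (k * inverse (k - \<i> * of_real \<gamma>)))"
      using False by (auto simp: Pfun_def c_def divide_inverse)
    have out: "\<i> * of_real \<gamma> \<notin> sector lo hi" by (rule pole_not_in_sector[OF False no_pole])
    have "closed (sector lo hi)"
    proof -
      have "sector lo hi = {z. 0 \<le> height_above lo z} \<inter> {z. height_above hi z \<le> 0}" by (auto simp: sector_def)
      then show ?thesis unfolding height_above_def by (auto intro!: closed_Int closed_Collect_le continuous_intros)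
    qed
    then obtain d where d: "d > 0" "\<And>k. k \<in> sector lo hi \<Longrightarrow> d \<le> dist (\<i> * of_real \<gamma>) k"
      using separate_point_closed[OF _ out] by blast
    have "poly_growth_on (sector lo hi) ?P"
      by (intro poly_growth_Pfun poly_growth_on_inverse[OF d(1)]) (use d(2) in \<open>auto simp: dist_norm norm_minus_commute\<close>)
    moreover have "k - \<i> * of_real \<gamma> \<noteq> 0" if "k \<in> interior (sector lo hi)" for k
      using out that interior_subset[of "sector lo hi"] by auto
    then have "?P holomorphic_on interior (sector lo hi)"
      unfolding eq by (intro holomorphic_intros) auto
    ultimately show ?thesis by blast
  qed
  have "sector_integral j p (\<lambda>k. exp (\<i> * k * of_real x) *
     (exp (\<i> * (k ^ (2 * j + 1) * of_real (t - T))) * half_fourier (u T) (alpha j p n * k) * ?P k)) = 0"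
    by (rule sector_integral_regular)
       (intro poly_growth_intros poly_growth_time_factor poly_growth_terminal_transform[OF n] P[THEN conjunct1],
        intro holomorphic_intros holomorphic_terminal_transform[OF n] P[THEN conjunct2])
  then show ?thesis by (simp only: terminal_integrand_def[abs_def] mult.assoc)
qed

lemma sector_integral_terminal_pole:
  assumes n: "n \<in> {1..j+1}" and pole: "\<gamma> > 0" "j = 2 * p - 1"
  defines "z0 \<equiv> \<i> * of_real \<gamma>"
  shows "sector_integral j p (terminal_integrand p n t x) =
    2 * of_real pi * (wave j t x z0 * (of_real \<gamma> * poly (Qpoly j p) 1 *
      (exp (- \<i> * z0 ^ (2 * j + 1) * of_real T) * half_fourier (u T) (alpha j p n * z0) / poly (pderiv (Qpoly j p)) (alpha j p n))))"
proof -
  let ?h = "\<lambda>k. exp (\<i> * (k ^ (2 * j + 1) * of_real (t - T))) * half_fourier (u T) (alpha j p n * k) * (Lfun j p n 1 * (k * alpha j p n - z0))"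
  have "sector_integral j p (terminal_integrand p n t x) = sector_integral j p (\<lambda>k. exp (\<i> * k * of_real x) * ?h k / (k - z0))"
  proof (rule sector_integral_congI)
    fix k assume "k \<in> ray lo \<union> ray hi"
    then have "k \<noteq> \<i> * of_real \<gamma>" using rays_avoid_pole pole by auto
    then show "terminal_integrand p n t x k = exp (\<i> * k * of_real x) * ?h k / (k - z0)"
      unfolding terminal_integrand_def z0_def by (simp add: Pfun_eq[OF p n] mult.assoc)
  qed
  also have "\<dots> = 2 * of_real pi * \<i> * (exp (\<i> * z0 * of_real x) * ?h z0)"
  proof (rule sector_integral_simple_pole)
    show "poly_growth_on (sector lo hi) ?h"
      by (intro poly_growth_intros poly_growth_time_factor poly_growth_terminal_transform[OF n])
    show "?h holomorphic_on interior (sector lo hi)"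
      by (intro holomorphic_intros holomorphic_terminal_transform[OF n])
    show "z0 \<in> interior (sector lo hi)" unfolding z0_def by (rule pole_in_sector[OF pole])
  qed
  also have "Lfun j p n 1 * (z0 * alpha j p n - z0) = - z0 * (Lfun j p n 1 * (1 - alpha j p n))" by (simp add: algebra_simps)
  also have "\<dots> = - z0 * (poly (Qpoly j p) 1 / poly (pderiv (Qpoly j p)) (alpha j p n))" unfolding Lfun_at_1[OF p n] ..
  also have "exp (\<i> * z0 * of_real x) * (exp (\<i> * (z0 ^ (2 * j + 1) * of_real (t - T))) * half_fourier (u T) (alpha j p n * z0)
      * (- z0 * (poly (Qpoly j p) 1 / poly (pderiv (Qpoly j p)) (alpha j p n))))
     = (exp (\<i> * z0 * of_real x) * exp (\<i> * (z0 ^ (2 * j + 1) * of_real (t - T)))) * half_fourier (u T) (alpha j p n * z0)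
      * (- z0 * (poly (Qpoly j p) 1 / poly (pderiv (Qpoly j p)) (alpha j p n)))"
    by (simp only: mult.assoc)
  also note wave_terminal[symmetric]
  finally have "sector_integral j p (terminal_integrand p n t x) = 2 * of_real pi * \<i> *
     (wave j t x z0 * exp (- \<i> * z0 ^ (2 * j + 1) * of_real T) * half_fourier (u T) (alpha j p n * z0)
      * (- z0 * (poly (Qpoly j p) 1 / poly (pderiv (Qpoly j p)) (alpha j p n))))" .
  also have "2 * of_real pi * \<i> * (w * e * v * (- z0 * (q / q'))) = 2 * of_real pi * (w * (of_real \<gamma> * q * (e * v / q')))" for w e v q q'
  proof -
    have "2 * of_real pi * \<i> * (w * e * v * (- z0 * (q / q'))) = (\<i> * - z0) * (2 * of_real pi * (w * (q * (e * v / q'))))"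
      by (simp only: mult_ac times_divide_eq_right times_divide_eq_left)
    also have "\<i> * - z0 = of_real \<gamma>" by (simp add: z0_def)
    finally show ?thesis by (simp only: mult_ac)
  qed
  finally show ?thesis .
qed

lemma poly_growth_boundary_transform:
  assumes l: "l \<le> 2 * j"
  shows "poly_growth_on (sector lo hi) (\<lambda>k. boundary_transform l T (k ^ (2 * j + 1)))"
proof (rule poly_growth_on_bounded)
  show "continuous_on (sector lo hi) (\<lambda>k. boundary_transform l T (k ^ (2 * j + 1)))"
    by (rule continuous_on_subset[OF holomorphic_on_imp_continuous_on[OF holomorphic_boundary_transform[OF _ l]]])
       (use T_pos in auto)
  show "norm (boundary_transform l T (k ^ (2 * j + 1))) \<le> C * T" if "k \<in> sector lo hi" for k
    by (rule boundary_transform_bounded[OF l power_Im_nonpos[OF that]])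
qed

lemma poly_growth_boundary_form:
  assumes a: "a ^ (2 * j + 1) = 1"
  shows "poly_growth_on (sector lo hi) (\<lambda>k. boundary_form T (a * k))"
proof -
  have eq: "boundary_form T (a * k) = (-1) ^ (j + 1) * (\<Sum>l\<le>2 * j. (\<i> * (a * k)) ^ (2 * j - l) *
      boundary_transform l T (k ^ (2 * j + 1)))" for k
    unfolding boundary_form_def power_mult_distrib[of a k "2 * j + 1"] a mult_1 ..
  show ?thesis
    unfolding eq by (intro poly_growth_intros poly_growth_on_sum poly_growth_boundary_transform) auto
qed

lemma poly_growth_Pfun_rays: "poly_growth_on (ray lo \<union> ray hi) (Pfun j \<gamma> p n)"
  by (intro poly_growth_Pfun poly_growth_pole_on_rays)

lemma poly_growth_symbol_rays: "poly_growth_on (ray lo \<union> ray hi) (boundary_symbol j \<gamma> l)"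
proof (cases "\<gamma> = 0")
  case True
  then have eq: "boundary_symbol j \<gamma> l = (\<lambda>k. k ^ (2 * j - l))" by (auto simp: boundary_symbol_def)
  show ?thesis unfolding eq by (intro poly_growth_intros)
next
  case False
  then have eq: "boundary_symbol j \<gamma> l = (\<lambda>k. k ^ (2 * j + 1 - l) * inverse (k - \<i> * of_real \<gamma>))"
    by (auto simp: boundary_symbol_def divide_inverse)
  show ?thesis unfolding eq by (intro poly_growth_intros poly_growth_pole_on_rays False)
qed

lemmas on_rays = poly_growth_on_subset[OF _ Un_least[OF rays_in_sector]]

text \<open>The transform of the data is not used directly: through the global relation it inherits
  continuity and growth from the transform of \<open>u T\<close> and from the boundary form.\<close>

lemma data_integrand_split:
  assumes n: "n \<in> {1..j+1}" and k: "k \<in> sector lo hi"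
  shows "data_integrand j \<gamma> T u0 f p n t x k = terminal_integrand p n t x k - wave j t x k * boundary_form T (alpha j p n * k) * Pfun j \<gamma> p n k"
proof -
  have "data_integrand j \<gamma> T u0 f p n t x k = wave j t x k *
     (exp (- \<i> * k ^ (2 * j + 1) * of_real T) * half_fourier (u T) (alpha j p n * k) - boundary_form T (alpha j p n * k)) * Pfun j \<gamma> p n k"
    unfolding data_integrand_def data_transform_eq[OF alpha_Im_nonpos[OF n k]] alpha_mult_power ..
  also have "\<dots> = (wave j t x k * exp (- \<i> * k ^ (2 * j + 1) * of_real T)) * half_fourier (u T) (alpha j p n * k) * Pfun j \<gamma> p n k
     - wave j t x k * boundary_form T (alpha j p n * k) * Pfun j \<gamma> p n k"
    by (simp only: left_diff_distrib right_diff_distrib mult.assoc)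
  finally show ?thesis unfolding wave_terminal terminal_integrand_def .
qed

lemma terminal_integrable:
  assumes n: "n \<in> {1..j+1}"
  shows "sector_integrable j p (terminal_integrand p n t x)"
proof (rule sector_integrableI[OF _ x])
  show "poly_growth_on (ray lo \<union> ray hi) (\<lambda>k. exp (\<i> * (k ^ (2 * j + 1) * of_real (t - T))) * half_fourier (u T) (alpha j p n * k) * Pfun j \<gamma> p n k)"
    by (intro poly_growth_intros poly_growth_Pfun_rays poly_growth_wave_factor on_rays poly_growth_terminal_transform n)
qed (simp only: terminal_integrand_def mult.assoc)

lemma eliminated_integrable:
  "sector_integrable j p (\<lambda>k. wave j t x k * boundary_form T (alpha j p n * k) * Pfun j \<gamma> p n k)"
proof (rule sector_integrableI[OF _ x])
  show "poly_growth_on (ray lo \<union> ray hi) (\<lambda>k. exp (\<i> * (k ^ (2 * j + 1) * of_real t)) * boundary_form T (alpha j p n * k) * Pfun j \<gamma> p n k)"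
    by (intro poly_growth_intros poly_growth_Pfun_rays poly_growth_wave_factor on_rays poly_growth_boundary_form alpha_power)
qed (simp only: wave_eq mult.assoc)

lemma sector_integrable_cong:
  assumes "sector_integrable j p F" "\<And>k. k \<in> ray lo \<union> ray hi \<Longrightarrow> F k = G k"
  shows "sector_integrable j p G"
  unfolding sector_integrable_def
proof
  show "(\<lambda>r. G (of_real r * cis lo)) integrable_on {0..}"
    by (rule integrable_eq[of "\<lambda>r. F (of_real r * cis lo)"])
       (use assms in \<open>auto simp: sector_integrable_def ray_def\<close>)
  show "(\<lambda>r. G (of_real r * cis hi)) integrable_on {0..}"
    by (rule integrable_eq[of "\<lambda>r. F (of_real r * cis hi)"])
       (use assms in \<open>auto simp: sector_integrable_def ray_def\<close>)
qed

lemma data_integrable: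
  assumes n: "n \<in> {1..j+1}"
  shows "sector_integrable j p (data_integrand j \<gamma> T u0 f p n t x)"
  by (rule sector_integrable_cong[OF sector_integral_diff(2)[OF terminal_integrable[OF n] eliminated_integrable]])
     (use data_integrand_split[OF n] rays_in_sector in auto)

lemma boundary_integrable:
  assumes l: "l \<in> {1..j}"
  shows "sector_integrable j p (boundary_integrand j \<gamma> T \<phi> l t x)"
proof (rule sector_integrableI[OF _ x])
  show "poly_growth_on (ray lo \<union> ray hi) (\<lambda>k. exp (\<i> * (k ^ (2 * j + 1) * of_real t)) * boundary_symbol j \<gamma> l k * time_transform (\<phi> l) T (k ^ (2 * j + 1)))"
    unfolding time_transform_data[OF l]
    by (intro poly_growth_intros poly_growth_symbol_rays poly_growth_wave_factor on_rays poly_growth_boundary_transform) (use l in auto)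
qed (simp only: boundary_integrand_def wave_eq mult.assoc)

lemma sector_integral_final_time:
  "sector_integral j p (\<lambda>k. wave j t x k * boundary_form t k) = sector_integral j p (\<lambda>k. wave j t x k * boundary_form T k)"
proof -
  \<comment> \<open>Where \<open>Im (k ^ (2 * j + 1)) \<le> 0\<close> the difference grows only polynomially.\<close>
  let ?d = "\<lambda>k. exp (\<i> * k ^ (2 * j + 1) * of_real t) * (boundary_form T k - boundary_form t k)"
  have holo: "?d holomorphic_on S" for S
    by (rule holomorphic_on_subset[of _ UNIV]) (use t T_pos in \<open>auto intro!: holomorphic_intros holomorphic_boundary_form\<close>)
  have pg: "poly_growth_on (sector lo hi) ?d"
  proof (rule poly_growth_onI)
    show "norm (?d k) \<le> (2 * real j + 1) * (C * T) * (1 + norm k) ^ (2 * j)" if "k \<in> sector lo hi" for k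
      by (rule boundary_form_difference_bounded[OF t power_Im_nonpos[OF that]])
  qed (rule holomorphic_on_imp_continuous_on[OF holo])
  have zero: "sector_integral j p (\<lambda>k. exp (\<i> * k * of_real x) * ?d k) = 0"
    by (rule sector_integral_regular[OF pg holo])
  have int: "sector_integrable j p (\<lambda>k. exp (\<i> * k * of_real x) * ?d k)"
    by (rule sector_integrableI[OF on_rays[OF pg] x refl])
  have intT: "sector_integrable j p (\<lambda>k. wave j t x k * boundary_form T k)"
  proof (rule sector_integrableI[OF _ x])
    show "poly_growth_on (ray lo \<union> ray hi) (\<lambda>k. exp (\<i> * (k ^ (2 * j + 1) * of_real t)) * boundary_form T (1 * k))"
      by (intro poly_growth_intros poly_growth_wave_factor on_rays poly_growth_boundary_form) simp
  qed (simp only: wave_eq mult.assoc mult_1)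
  have "(\<lambda>k. wave j t x k * boundary_form t k) = (\<lambda>k. wave j t x k * boundary_form T k - exp (\<i> * k * of_real x) * ?d k)"
    unfolding wave_eq by (simp add: algebra_simps)
  then show ?thesis using sector_integral_diff(1)[OF intT int] zero by simp
qed

lemma sector_integral_boundary_form:
  "sector_integral j p (\<lambda>k. wave j t x k * boundary_form t k) =
     (\<Sum>n=1..j+1. sector_integral j p (terminal_integrand p n t x))
   - (\<Sum>n=1..j+1. sector_integral j p (data_integrand j \<gamma> T u0 f p n t x))
   + (\<Sum>l=1..j. ccoef j p l * sector_integral j p (boundary_integrand j \<gamma> T \<phi> l t x))"
proof -
  let ?E = "\<lambda>n k. terminal_integrand p n t x k - data_integrand j \<gamma> T u0 f p n t x k"
  let ?B = "\<lambda>l k. ccoef j p l * boundary_integrand j \<gamma> T \<phi> l t x k"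
  have E: "sector_integral j p (\<lambda>k. \<Sum>n=1..j+1. ?E n k) = (\<Sum>n=1..j+1. sector_integral j p (?E n)) \<and> sector_integrable j p (\<lambda>k. \<Sum>n=1..j+1. ?E n k)"
    by (rule sector_integral_sum) (auto intro!: sector_integral_diff(2) terminal_integrable data_integrable)
  have B: "sector_integral j p (\<lambda>k. \<Sum>l=1..j. ?B l k) = (\<Sum>l=1..j. sector_integral j p (?B l)) \<and> sector_integrable j p (\<lambda>k. \<Sum>l=1..j. ?B l k)"
    by (rule sector_integral_sum) (auto intro!: sector_integral_cmult(2) boundary_integrable)
  have "sector_integral j p (\<lambda>k. wave j t x k * boundary_form T k) = sector_integral j p (\<lambda>k. (\<Sum>n=1..j+1. ?E n k) + (\<Sum>l=1..j. ?B l k))"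
  proof (rule sector_integral_congI)
    fix k assume k: "k \<in> ray lo \<union> ray hi" and k0: "k \<noteq> 0"
    have kS: "k \<in> sector lo hi" using k rays_in_sector by blast
    have ne: "k \<noteq> \<i> * of_real \<gamma>" using rays_avoid_pole[OF _ k, of \<gamma>] k0 by (cases "\<gamma> = 0") auto
    let ?h = "\<lambda>l. boundary_transform l T (k ^ (2 * j + 1))"
    have bf: "boundary_form T (alpha j p n * k) = (-1) ^ (j + 1) * (\<Sum>l\<le>2 * j. (\<i> * (alpha j p n * k)) ^ (2 * j - l) * ?h l)" for n
      unfolding boundary_form_def alpha_mult_power ..
    have "boundary_form T k = (\<Sum>n=1..j+1. Pfun j \<gamma> p n k * boundary_form T (alpha j p n * k))
      + (\<Sum>l=1..j. ccoef j p l * (boundary_symbol j \<gamma> l k * (?h l + of_real \<gamma> * ?h (l - 1))))"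
      unfolding bf using boundary_form_elimination[OF p ne, of ?h] by (simp only: boundary_form_def)
    also have "(\<Sum>l=1..j. ccoef j p l * (boundary_symbol j \<gamma> l k * (?h l + of_real \<gamma> * ?h (l - 1))))
       = (\<Sum>l=1..j. ccoef j p l * (boundary_symbol j \<gamma> l k * time_transform (\<phi> l) T (k ^ (2 * j + 1))))"
      by (rule sum.cong[OF refl]) (simp only: time_transform_data)
    finally have "wave j t x k * boundary_form T k = (\<Sum>n=1..j+1. wave j t x k * boundary_form T (alpha j p n * k) * Pfun j \<gamma> p n k)
      + (\<Sum>l=1..j. ?B l k)"
      unfolding boundary_integrand_def by (simp only: distrib_left sum_distrib_left mult_ac)
    also have "(\<Sum>n=1..j+1. wave j t x k * boundary_form T (alpha j p n * k) * Pfun j \<gamma> p n k) = (\<Sum>n=1..j+1. ?E n k)"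
      by (rule sum.cong[OF refl]) (simp only: data_integrand_split[OF _ kS], simp)
    finally show "wave j t x k * boundary_form T k = (\<Sum>n=1..j+1. ?E n k) + (\<Sum>l=1..j. ?B l k)" .
  qed
  also have "\<dots> = (\<Sum>n=1..j+1. sector_integral j p (?E n)) + (\<Sum>l=1..j. sector_integral j p (?B l))"
    by (rule trans[OF sector_integral_add(1)[OF E[THEN conjunct2] B[THEN conjunct2]]
          arg_cong2[of _ _ _ _ "(+)", OF E[THEN conjunct1] B[THEN conjunct1]]])
  also have "(\<Sum>n=1..j+1. sector_integral j p (?E n)) = (\<Sum>n=1..j+1. sector_integral j p (terminal_integrand p n t x))
     - (\<Sum>n=1..j+1. sector_integral j p (data_integrand j \<gamma> T u0 f p n t x))"
    unfolding sum_subtractf[symmetric]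
    by (rule sum.cong[OF refl]) (rule sector_integral_diff(1)[OF terminal_integrable data_integrable])
  also have "(\<Sum>l=1..j. sector_integral j p (?B l)) = (\<Sum>l=1..j. ccoef j p l * sector_integral j p (boundary_integrand j \<gamma> T \<phi> l t x))"
    by (rule sum.cong[OF refl]) (rule sector_integral_cmult(1)[OF boundary_integrable])
  finally show ?thesis unfolding sector_integral_final_time .
qed

text \<open>The residues contain the transform of \<open>u T\<close>. The global relation replaces it by the data and the
  boundary form, and the elimination identity at the pole replaces the boundary form by the
  prescribed boundary data.\<close>

lemma terminal_sum_at_pole:
  assumes pole: "\<gamma> > 0" "j = 2 * p - 1"
  shows "(\<Sum>n=1..j+1. sector_integral j p (terminal_integrand p n t x)) = 2 * of_real pi * residue_term j \<gamma> T u0 \<phi> f t x"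
proof -
  define z0 where "z0 = \<i> * complex_of_real \<gamma>"
  define q where "q n = poly (pderiv (Qpoly j p)) (alpha j p n)" for n
  define D where "D n = half_fourier u0 (z0 * alpha j p n) + forcing_transform j f T (z0 * alpha j p n)" for n
  have odd: "odd j" "(j + 1) div 2 = p" using pole p by auto
  have zS: "z0 \<in> sector lo hi" using pole_in_sector[OF pole] interior_subset unfolding z0_def by blast
  have "\<i> ^ (2 * j + 1) = - \<i>" using odd by (simp add: power_mult)
  then have zm: "z0 ^ (2 * j + 1) = - \<i> * of_real (\<gamma> ^ (2 * j + 1))" unfolding z0_def power_mult_distrib by (simp only: of_real_power)
  have w: "wave j t x z0 = complex_of_real (exp (- \<gamma> * x + \<gamma> ^ (2 * j + 1) * t))"
  proof -
    have "\<i> * z0 * of_real x + \<i> * z0 ^ (2 * j + 1) * of_real t = of_real (- \<gamma> * x + \<gamma> ^ (2 * j + 1) * t)"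
      unfolding zm by (simp add: z0_def)
    then show ?thesis unfolding wave_def by (simp only: exp_of_real)
  qed
  have terminal_value: "exp (- \<i> * z0 ^ (2 * j + 1) * of_real T) * half_fourier (u T) (alpha j p n * z0) = D n + boundary_form T (alpha j p n * z0)"
    if "n \<in> {1..j+1}" for n
    using data_transform_eq[OF alpha_Im_nonpos[OF that zS]] unfolding D_def mult.commute[of z0] alpha_mult_power by simp
  have "(\<Sum>n=1..j+1. sector_integral j p (terminal_integrand p n t x)) =
     (\<Sum>n=1..j+1. 2 * of_real pi * (wave j t x z0 * (of_real \<gamma> * poly (Qpoly j p) 1 * (D n / q n + boundary_form T (alpha j p n * z0) / q n))))"
  proof (rule sum.cong[OF refl])
    fix n assume n: "n \<in> {1..j+1}"
    show "sector_integral j p (terminal_integrand p n t x) = 2 * of_real pi * (wave j t x z0 * (of_real \<gamma> * poly (Qpoly j p) 1 * (D n / q n + boundary_form T (alpha j p n * z0) / q n)))"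
      unfolding sector_integral_terminal_pole[OF n pole] z0_def[symmetric] terminal_value[OF n] q_def add_divide_distrib ..
  qed
  also have "\<dots> = 2 * of_real pi * (wave j t x z0 * (of_real \<gamma> * poly (Qpoly j p) 1 * (\<Sum>n=1..j+1. D n / q n)
      + of_real \<gamma> * poly (Qpoly j p) 1 * (\<Sum>n=1..j+1. boundary_form T (alpha j p n * z0) / q n)))"
    by (simp only: sum_distrib_left[symmetric] sum.distrib distrib_left)
  also have "of_real \<gamma> * poly (Qpoly j p) 1 * (\<Sum>n=1..j+1. boundary_form T (alpha j p n * z0) / q n) =
      - \<i> * (\<Sum>l=1..j. ccoef j p l * (z0 ^ (2 * j + 1 - l) * time_transform (\<phi> l) T (z0 ^ (2 * j + 1))))"
  proof -
    let ?h = "\<lambda>l. boundary_transform l T (z0 ^ (2 * j + 1))"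
    have bf: "boundary_form T (alpha j p n * z0) = (-1) ^ (j + 1) * (\<Sum>l\<le>2 * j. (\<i> * (alpha j p n * z0)) ^ (2 * j - l) * ?h l)" for n
      unfolding boundary_form_def alpha_mult_power ..
    have "of_real \<gamma> * poly (Qpoly j p) 1 * (\<Sum>n=1..j+1. boundary_form T (alpha j p n * z0) / q n) =
      - \<i> * (\<Sum>l=1..j. ccoef j p l * (z0 ^ (2 * j + 1 - l) * (?h l + of_real \<gamma> * ?h (l - 1))))"
      using boundary_form_at_pole[OF p, of \<gamma> ?h] unfolding bf q_def unfolding z0_def .
    also have "(\<Sum>l=1..j. ccoef j p l * (z0 ^ (2 * j + 1 - l) * (?h l + of_real \<gamma> * ?h (l - 1)))) =
       (\<Sum>l=1..j. ccoef j p l * (z0 ^ (2 * j + 1 - l) * time_transform (\<phi> l) T (z0 ^ (2 * j + 1))))"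
      by (rule sum.cong[OF refl]) (simp only: time_transform_data)
    finally show ?thesis .
  qed
  also have "a * (v * (g * r * s + - \<i> * s')) = a * (g * r * v * s - \<i> * v * s')" for a v g r s s' :: complex
    by (simp add: algebra_simps)
  also have "of_real \<gamma> * poly (Qpoly j p) 1 * wave j t x z0 * (\<Sum>n=1..j+1. D n / q n)
      - \<i> * wave j t x z0 * (\<Sum>l=1..j. ccoef j p l * (z0 ^ (2 * j + 1 - l) * time_transform (\<phi> l) T (z0 ^ (2 * j + 1))))
     = residue_term j \<gamma> T u0 \<phi> f t x"
    unfolding residue_term_def Let_def odd(2) D_def q_def w zm unfolding z0_def using pole(1) odd(1)
    by (simp only: if_True simp_thms mult.assoc)
  finally show ?thesis .
qed

end

theorem solution_formula:
  "line_integrand j u0 f t x integrable_on UNIV \<and>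
   u t x = 1 / (2 * of_real pi) * integral UNIV (line_integrand j u0 f t x)
     - 1 / (2 * of_real pi) * (\<Sum>p=1..j. \<Sum>n=1..j+1. sector_integral j p (data_integrand j \<gamma> T u0 f p n t x))
     + 1 / (2 * of_real pi) * (\<Sum>p=1..j. \<Sum>l=1..j. ccoef j p l * sector_integral j p (boundary_integrand j \<gamma> T \<phi> l t x))
     + residue_term j \<gamma> T u0 \<phi> f t x"
proof
  show "line_integrand j u0 f t x integrable_on UNIV"
    using line_integral_part by (auto simp: integrable_on_def)
  have line: "integral UNIV (line_integrand j u0 f t x) = 2 * of_real pi * u t x - (\<Sum>p=1..j. sector_integral j p (\<lambda>k. wave j t x k * boundary_form t k))"
    using line_integral_part by (rule integral_unique)
  have terminal: "(\<Sum>p=1..j. \<Sum>n=1..j+1. sector_integral j p (terminal_integrand p n t x)) = 2 * of_real pi * residue_term j \<gamma> T u0 \<phi> f t x"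
  proof (cases "odd j \<and> \<gamma> > 0")
    case True
    define q where "q = (j + 1) div 2"
    have q: "q \<in> {1..j}" "j = 2 * q - 1" using True by (auto simp: q_def elim!: oddE)
    have "(\<Sum>p=1..j. \<Sum>n=1..j+1. sector_integral j p (terminal_integrand p n t x)) =
       (\<Sum>p=1..j. if p = q then 2 * of_real pi * residue_term j \<gamma> T u0 \<phi> f t x else 0)"
    proof (rule sum.cong[OF refl])
      fix p assume p: "p \<in> {1..j}"
      show "(\<Sum>n=1..j+1. sector_integral j p (terminal_integrand p n t x)) = (if p = q then 2 * of_real pi * residue_term j \<gamma> T u0 \<phi> f t x else 0)"
      proof (cases "p = q")
        case True
        then have "j = 2 * p - 1" using q(2) by blast
        then show ?thesis
          unfolding if_P[OF True] using terminal_sum_at_pole[OF p] \<open>odd j \<and> \<gamma> > 0\<close> by blast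
      next
        case False
        then have "\<not> (\<gamma> > 0 \<and> j = 2 * p - 1)" using q p by auto
        then have "(\<Sum>n=1..j+1. sector_integral j p (terminal_integrand p n t x)) = 0"
          using sector_integral_terminal_no_pole[OF p] by (intro sum.neutral) blast
        then show ?thesis using False by simp
      qed
    qed
    also have "\<dots> = 2 * of_real pi * residue_term j \<gamma> T u0 \<phi> f t x" using q(1) by (simp add: sum.delta')
    finally show ?thesis .
  next
    case False
    have "sector_integral j p (terminal_integrand p n t x) = 0" if "p \<in> {1..j}" "n \<in> {1..j+1}" for p n
    proof (rule sector_integral_terminal_no_pole[OF that])
      show "\<not> (\<gamma> > 0 \<and> j = 2 * p - 1)" using False that by auto
    qed
    then have "(\<Sum>p=1..j. \<Sum>n=1..j+1. sector_integral j p (terminal_integrand p n t x)) = 0"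
      by (intro sum.neutral ballI) auto
    moreover have "residue_term j \<gamma> T u0 \<phi> f t x = 0" using False by (auto simp: residue_term_def)
    ultimately show ?thesis by simp
  qed
  have "(\<Sum>p=1..j. sector_integral j p (\<lambda>k. wave j t x k * boundary_form t k)) =
      (\<Sum>p=1..j. \<Sum>n=1..j+1. sector_integral j p (terminal_integrand p n t x))
    - (\<Sum>p=1..j. \<Sum>n=1..j+1. sector_integral j p (data_integrand j \<gamma> T u0 f p n t x))
    + (\<Sum>p=1..j. \<Sum>l=1..j. ccoef j p l * sector_integral j p (boundary_integrand j \<gamma> T \<phi> l t x))"
  proof -
    have "(\<Sum>p=1..j. sector_integral j p (\<lambda>k. wave j t x k * boundary_form t k)) =
      (\<Sum>p=1..j. (\<Sum>n=1..j+1. sector_integral j p (terminal_integrand p n t x))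
        - (\<Sum>n=1..j+1. sector_integral j p (data_integrand j \<gamma> T u0 f p n t x))
        + (\<Sum>l=1..j. ccoef j p l * sector_integral j p (boundary_integrand j \<gamma> T \<phi> l t x)))"
      by (rule sum.cong[OF refl]) (rule sector_integral_boundary_form)
    then show ?thesis by (simp only: sum.distrib sum_subtractf)
  qed
  with line terminal have "2 * of_real pi * u t x = integral UNIV (line_integrand j u0 f t x)
    - (\<Sum>p=1..j. \<Sum>n=1..j+1. sector_integral j p (data_integrand j \<gamma> T u0 f p n t x))
    + (\<Sum>p=1..j. \<Sum>l=1..j. ccoef j p l * sector_integral j p (boundary_integrand j \<gamma> T \<phi> l t x))
    + 2 * of_real pi * residue_term j \<gamma> T u0 \<phi> f t x" (is "_ = ?a - ?b + ?c + ?d")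
    by (simp only:) simp
  then have "u t x = (?a - ?b + ?c + ?d) / (2 * of_real pi)" by (simp add: nonzero_eq_divide_eq mult.commute)
  then show "u t x = 1 / (2 * of_real pi) * integral UNIV (line_integrand j u0 f t x)
     - 1 / (2 * of_real pi) * (\<Sum>p=1..j. \<Sum>n=1..j+1. sector_integral j p (data_integrand j \<gamma> T u0 f p n t x))
     + 1 / (2 * of_real pi) * (\<Sum>p=1..j. \<Sum>l=1..j. ccoef j p l * sector_integral j p (boundary_integrand j \<gamma> T \<phi> l t x))
     + residue_term j \<gamma> T u0 \<phi> f t x"
    by (simp add: add_divide_distrib diff_divide_distrib)
qed

end
end

theorem proposition3p4:
  fixes j :: nat
  shows "\<exists>N::nat. \<forall>(\<gamma>::real) (T::real) (u0::real \<Rightarrow> complex) (\<phi>::nat \<Rightarrow> real \<Rightarrow> complex)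
      (f::real \<Rightarrow> real \<Rightarrow> complex) (u::real \<Rightarrow> real \<Rightarrow> complex).
    T > 0 \<longrightarrow> initial_class N u0 \<longrightarrow> (\<forall>l\<in>{1..j}. Ck_on N {0..T} (\<phi> l)) \<longrightarrow>
    forcing_class N T f \<longrightarrow> solution_class N T u \<longrightarrow> solves_ibvp j \<gamma> T u0 \<phi> f u \<longrightarrow>
    (\<forall>x>0. \<forall>t\<in>{0..T}.
       line_integrand j u0 f t x integrable_on UNIV \<and>
       (\<forall>p\<in>{1..j}. \<forall>n\<in>{1..j+1}. sector_integrable j p (data_integrand j \<gamma> T u0 f p n t x)) \<and>
       (\<forall>p\<in>{1..j}. \<forall>l\<in>{1..j}. sector_integrable j p (boundary_integrand j \<gamma> T \<phi> l t x)) \<and>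
       u t x =
         1 / (2 * of_real pi) * integral UNIV (line_integrand j u0 f t x)
         - 1 / (2 * of_real pi) *
           (\<Sum>p=1..j. \<Sum>n=1..j+1. sector_integral j p (data_integrand j \<gamma> T u0 f p n t x))
         + 1 / (2 * of_real pi) *
           (\<Sum>p=1..j. \<Sum>l=1..j. ccoef j p l *
              sector_integral j p (boundary_integrand j \<gamma> T \<phi> l t x))
         + residue_term j \<gamma> T u0 \<phi> f t x)"
proof (rule exI[of _ "2 * j + 3"], intro allI impI)
  \<comment> \<open>This order makes the first \<open>2 * j + 2\<close> space derivatives continuously differentiable, which
      covers all boundary values and, for \<open>j = 0\<close>, the two derivatives used in Fourier inversion.
      Being at least \<open>2\<close>, it also gives decay like \<open>(1 + x)\<^sup>-\<^sup>2\<close>.\<close>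
  fix \<gamma> T :: real and u0 :: "real \<Rightarrow> complex" and \<phi> :: "nat \<Rightarrow> real \<Rightarrow> complex" and f u :: "real \<Rightarrow> real \<Rightarrow> complex"
  assume T: "T > 0" and f: "forcing_class (2 * j + 3) T f" and u: "solution_class (2 * j + 3) T u"
    and ibvp: "solves_ibvp j \<gamma> T u0 \<phi> f u"
  fix x :: real assume x: "x > 0"
  obtain C1 where C1: "\<And>n t x. n \<le> 2 * j + 3 \<Longrightarrow> t \<in> {0..T} \<Longrightarrow> x \<ge> 0 \<Longrightarrow> (1 + x) ^ (2 * j + 3) * norm ((Dx ^^ n) u t x) \<le> C1"
    using u unfolding solution_class_def by blast
  obtain C2 where C2: "\<And>a b t x. a + b \<le> 2 * j + 3 \<Longrightarrow> t \<in> {0..T} \<Longrightarrow> x \<ge> 0 \<Longrightarrow> (1 + x) ^ (2 * j + 3) * norm ((Dt T ^^ a) ((Dx ^^ b) f) t x) \<le> C2"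
    using f unfolding forcing_class_def by blast
  interpret ibvp_solution j T f u "max C1 C2" \<gamma> u0 \<phi>
  proof
    show "Ck_strip (2 * j + 3) T u" using u by (simp only: solution_class_def)
    show "continuous_on ({0..T} \<times> {0..}) (\<lambda>(t, x). f t x)"
      using f Ck_strip_continuous by (simp only: forcing_class_def) blast
    show "norm ((Dx ^^ n) u t x) \<le> max C1 C2 / (1 + x)\<^sup>2" if "n \<le> 2 * j + 3" "t \<in> {0..T}" "x \<ge> 0" for n t x
      using C1[OF that] that(3) by (intro polynomial_decay_imp_inverse_square[where N = "2 * j + 3"]) auto
    show "norm (f t x) \<le> max C1 C2 / (1 + x)\<^sup>2" if "t \<in> {0..T}" "x \<ge> 0" for t x
      using C2[of 0 0 t x] that by (intro polynomial_decay_imp_inverse_square[where N = "2 * j + 3"]) auto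
    show "(Dx ^^ l) u t 0 + of_real \<gamma> * (Dx ^^ (l - 1)) u t 0 = \<phi> l t" if l: "l \<in> {1..j}" and t: "t \<in> {0<..<T}" for l t
    proof -
      have "l = Suc (l - 1)" using l by simp
      then have "(Dx ^^ l) u = Dx ((Dx ^^ (l - 1)) u)" by (metis funpow.simps(2) comp_apply)
      then show ?thesis using ibvp l t by (simp add: solves_ibvp_def)
    qed
    show "Dt T u t x + (-1) ^ (j + 1) * (Dx ^^ (2 * j + 1)) u t x = f t x" if "t \<in> {0<..<T}" "x > 0" for t x
      using ibvp that unfolding solves_ibvp_def by blast
    show "u 0 x = u0 x" if "x > 0" for x
      using ibvp that unfolding solves_ibvp_def by blast
  qed (rule T)
  show "\<forall>t\<in>{0..T}.
       line_integrand j u0 f t x integrable_on UNIV \<and>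
       (\<forall>p\<in>{1..j}. \<forall>n\<in>{1..j+1}. sector_integrable j p (data_integrand j \<gamma> T u0 f p n t x)) \<and>
       (\<forall>p\<in>{1..j}. \<forall>l\<in>{1..j}. sector_integrable j p (boundary_integrand j \<gamma> T \<phi> l t x)) \<and>
       u t x =
         1 / (2 * of_real pi) * integral UNIV (line_integrand j u0 f t x)
         - 1 / (2 * of_real pi) *
           (\<Sum>p=1..j. \<Sum>n=1..j+1. sector_integral j p (data_integrand j \<gamma> T u0 f p n t x))
         + 1 / (2 * of_real pi) *
           (\<Sum>p=1..j. \<Sum>l=1..j. ccoef j p l *
              sector_integral j p (boundary_integrand j \<gamma> T \<phi> l t x))
         + residue_term j \<gamma> T u0 \<phi> f t x"
    using solution_formula[OF _ x] data_integrable[OF _ x] boundary_integrable[OF _ x] by blast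
qed

end
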